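(* Let $\Lambda$ be an admissible sequence whose associated expansion has exactly one negative exponent, i.e. $\Theta(t)\sim\sum_{i\ge0}A_{k_i}t^{k_i}$ as $t\to0^+$ with $k_0<0$ and $k_i\ge0$ for all $i>0$, and put $\mu=-k_0$. Let $k\ge1$ be an integer. Then, as $n\to\infty$: (i) For $\mu>1$, $$t_\Lambda^k(n)=t_\Lambda^0(n)\cdot\left(\frac{n}{\mu\zeta_R(\mu+1)}\right)^{\frac{\mu k}{\mu+1}}A_{-\mu}^{\frac{k}{\mu+1}}[\zeta_R(\mu)]^k\,[1+o(1)].$$ (ii) For $\mu=1$, $$t_\Lambda^k(n)=t_\Lambda^0(n)\cdot n^{\frac k2}\left(\frac{\pi^2A_{-1}}{6}\right)^{-\frac k2}Y_k\left(\mathrm{FP}_{t=1}\zeta_\Lambda(t)-\frac{A_{-1}}2\log\left(\frac{\pi^2A_{-1}}{6n}\right),\ \zeta_\Lambda(2),\ 2\zeta_\Lambda(3),\ldots,(k-1)!\,\zeta_\Lambda(k)\right)[1+o(1)].$$ (iii) For $\mu<1$, $$t_\Lambda^k(n)=t_\Lambda^0(n)\cdot n^{\frac{k}{\mu+1}}\bigl(\zeta_R(\mu+1)\mu A_{-\mu}\bigr)^{-\frac{k}{\mu+1}}\,Y_k\bigl(\zeta_\Lambda(1),\ \zeta_\Lambda(2),\ 2\zeta_\Lambda(3),\ldots,(k-1)!\,\zeta_\Lambda(k)\bigr)[1+o(1)].$$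
   Context: A sequence $\Lambda$ is called admissible if it is a nondecreasing sequence of positive integers (the same integer may occur finitely many times; all sums and products over $\lambda\in\Lambda$ count multiplicity) such that: (i) $1\in\Lambda$; (ii) $\Theta(t)=\sum_{\lambda\in\Lambda}e^{-\lambda t}$ converges for all $t>0$; (iii) as $t\to0^+$, $\Theta$ admits a full asymptotic expansion $\Theta(t)\sim\sum_{i\ge0}A_{k_i}t^{k_i}$ with real exponents $k_0<k_1<k_2<\cdots$, $k_i\to\infty$, $k_0<0$ and $A_{k_0}\neq0$. Thus $A_x$ is the coefficient of $t^x$ in the expansion. Let $\zeta_\Lambda(s)=\sum_{\lambda\in\Lambda}\lambda^{-s}$ for $\Re s>-k_0$, also denoting its meromorphic continuation to $\mathbb{C}$; $\mathrm{FP}_{t=1}\zeta_\Lambda(t)$ is the constant term of the Laurent expansion of $\zeta_\Lambda(t)$ about $t=1$. $\zeta_R$ is the Riemann zeta-function. Let $p_\Lambda(n,m)$ be the number of partitions of $n$ into $m$ summands from $\Lambda$, where repetition of summands is allowed and equal integers occupying different positions of $\Lambda$ are regarded as different; that is, $\prod_{\lambda\in\Lambda}(1-zx^\lambda)^{-1}=\sum_{n,m\ge0}p_\Lambda(n,m)x^nz^m$. For $n\ge1$ and $k\ge0$, $t_\Lambda^k(n)=\sum_{m\ge0}m^kp_\Lambda(n,m)$ (the $k$ in $t_\Lambda^k$ is an index; $t_\Lambda^0(n)=\sum_m p_\Lambda(n,m)$). For $k\ge1$, $$Y_k(x_1,\ldots,x_k)=\sum\frac{k!}{b_1!b_2!\cdots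 b_k!}\left(\frac{x_1}{1!}\right)^{b_1}\left(\frac{x_2}{2!}\right)^{b_2}\cdots\left(\frac{x_k}{k!}\right)^{b_k},$$ the sum being over all $b_1,\ldots,b_k\in\mathbb{N}_0$ with $b_1+2b_2+\cdots+kb_k=k$. *)

theory Defs
  imports "HOL-Complex_Analysis.Complex_Analysis"
begin

text \<open>
  A sequence \<open>\<Lambda>\<close> of positive integers is a function \<open>L :: nat \<Rightarrow> nat\<close>. Summing or
  counting over the index \<open>i\<close> accounts for multiplicities.
\<close>

definition theta :: "(nat \<Rightarrow> nat) \<Rightarrow> real \<Rightarrow> real" where
  "theta L t = (\<Sum>i. exp (- real (L i) * t))"

text \<open>
  \<open>\<kappa> i\<close> is the \<open>i\<close>-th exponent and \<open>A x\<close> the coefficient of \<open>t\<^sup>x\<close>; only the values of \<open>A\<close> at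
  the exponents matter. Only the leading coefficient has to be nonzero, so a finite expansion is
  covered by padding with zero coefficients.
\<close>

definition theta_expansion ::
  "(nat \<Rightarrow> nat) \<Rightarrow> (nat \<Rightarrow> real) \<Rightarrow> (real \<Rightarrow> real) \<Rightarrow> bool" where
  "theta_expansion L \<kappa> A \<longleftrightarrow>
     strict_mono \<kappa> \<and> filterlim \<kappa> at_top sequentially \<and> \<kappa> 0 < 0 \<and> A (\<kappa> 0) \<noteq> 0 \<and>
     (\<forall>N. (\<lambda>t. theta L t - (\<Sum>i\<le>N. A (\<kappa> i) * t powr \<kappa> i)) \<in> o[at_right 0](\<lambda>t. t powr \<kappa> N))"

definition admissible :: "(nat \<Rightarrow> nat) \<Rightarrow> bool" where
  "admissible L \<longleftrightarrow>
     mono L \<and> (\<forall>i. L i > 0) \<and> (\<forall>n. finite {i. L i = n}) \<and>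
     1 \<in> range L \<and>
     (\<forall>t>0. summable (\<lambda>i. exp (- real (L i) * t))) \<and>
     (\<exists>\<kappa> A. theta_expansion L \<kappa> A)"

definition zeta_series :: "(nat \<Rightarrow> nat) \<Rightarrow> complex \<Rightarrow> complex" where
  "zeta_series L s = (\<Sum>i. of_nat (L i) powr (- s))"

text \<open>
  The parameter \<open>\<sigma>\<close> is the abscissa \<open>-k\<^sub>0\<close>. A meromorphic continuation from the half-plane to the
  whole plane is unique once the removable singularities have been removed and the value at every
  pole is set to 0, which is what \<^const>\<open>nicely_meromorphic_on\<close> demands.
\<close>

definition zeta_cont :: "(nat \<Rightarrow> nat) \<Rightarrow> real \<Rightarrow> complex \<Rightarrow> complex" where
  "zeta_cont L \<sigma> =
     (THE F. F nicely_meromorphic_on UNIV \<and> (\<forall>s. Re s > \<sigma> \<longrightarrow> F s = zeta_series L s))"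

definition zeta_seq :: "(nat \<Rightarrow> nat) \<Rightarrow> real \<Rightarrow> complex \<Rightarrow> complex" where
  "zeta_seq L \<sigma> s = (if Re s > \<sigma> then zeta_series L s else zeta_cont L \<sigma> s)"

definition finite_part :: "(complex \<Rightarrow> complex) \<Rightarrow> complex \<Rightarrow> complex" where
  "finite_part f z = fls_nth (laurent_expansion f z) 0"

text \<open>The Riemann zeta function, only meaningful for real arguments \<open>s > 1\<close>.\<close>

definition riemann_zeta :: "real \<Rightarrow> real" where
  "riemann_zeta s = (\<Sum>n. 1 / real (Suc n) powr s)"

text \<open>
  Summands are chosen as positions in the sequence, so equal integers at different positions are
  distinguished.
\<close>

definition partitions_into :: "(nat \<Rightarrow> nat) \<Rightarrow> nat \<Rightarrow> nat \<Rightarrow> nat" where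
  "partitions_into L n m = card {M :: nat multiset. size M = m \<and> (\<Sum>i\<in>#M. L i) = n}"

definition partition_moment :: "(nat \<Rightarrow> nat) \<Rightarrow> nat \<Rightarrow> nat \<Rightarrow> real" where
  "partition_moment L k n = (\<Sum>m. real m ^ k * real (partitions_into L n m))"

definition bell_Y :: "nat \<Rightarrow> (nat \<Rightarrow> real) \<Rightarrow> real" where
  "bell_Y k x =
     (\<Sum>b \<in> {b \<in> {1..k} \<rightarrow>\<^sub>E UNIV. (\<Sum>j=1..k. j * b j) = k}.
        fact k / (\<Prod>j=1..k. fact (b j)) * (\<Prod>j=1..k. (x j / fact j) ^ b j))"

end

theory Submission
  imports Defs "HOL-Real_Asymp.Real_Asymp"
begin

text \<open>
  Write \<open>p(n)\<close> for the number of partitions of \<open>n\<close> and \<open>P\<close> for its generating function. Removing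
  copies of one summand from a partition shows that the generating function of the \<open>k\<close>-th moment is
  \<open>G\<^sub>k P\<close>, where \<open>G\<^sub>k\<close> has nonnegative coefficients and obeys the recursion of the complete Bell
  polynomials in the series \<open>\<Sum>\<^sub>\<lambda> \<Sum>\<^sub>j j\<^sup>r x\<^sup>j\<^sup>\<lambda>\<close>, whose behaviour as \<open>x \<rightarrow> 1\<close> is read off from \<open>\<Theta>\<close>.

  It remains to see that the coefficient of \<open>x\<^sup>n\<close> in \<open>G P\<close> is asymptotic to \<open>p(n) G(e\<^sup>-\<^sup>\<tau>)\<close>, with \<open>\<tau>\<close> the
  saddle point \<open>(D / n)\<^sup>1\<^sup>/\<^sup>\<alpha>\<close>, \<open>\<alpha> = \<mu> + 1\<close>. For this only \<open>p(n - u / \<tau>) / p(n) \<rightarrow> e\<^sup>-\<^sup>u\<close> is needed, and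
  neither the growth of \<open>p\<close> nor complex analysis enters. The same removal argument gives
  \<open>n p(n) = \<Sum>\<^sub>m \<sigma>(m) p(n - m)\<close>; iterating it, \<open>\<Sum>\<^sub>m \<sigma>\<^sup>*\<^sup>k(m) p(n - m) \<sim> n\<^sup>k p(n)\<close> for every \<open>k\<close>. Since
  \<open>1 \<in> \<Lambda>\<close>, \<open>p\<close> is monotone, so Abel summation turns these sums into expectations of the partial sums of
  \<open>\<sigma>\<^sup>*\<^sup>k\<close>, which Karamata's theorem evaluates as \<open>c\<^sub>k m\<^sup>k\<^sup>\<alpha>\<close>. Hence all moments of order \<open>k\<alpha>\<close> are known
  asymptotically; under the weight \<open>m\<^sup>k\<^sup>\<alpha>\<close> the variable \<open>m\<close> concentrates near \<open>k\<alpha> / \<tau>\<close> for large \<open>k\<close>, and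
  \<open>(1 - u / (k\<alpha>))\<^sup>k\<^sup>\<alpha> \<rightarrow> e\<^sup>-\<^sup>u\<close> gives the ratio.

  The finite part of \<open>\<zeta>\<^sub>\<Lambda>\<close> at 1 does not influence the leading order in case (ii), because the first argument
  of \<open>Y\<^sub>k\<close> tends to infinity.
\<close>

section \<open>Laplace transforms of nonnegative sequences and Karamata's theorem\<close>

text \<open>The coefficients of \<open>\<sigma>\<close> are sums over divisors and fluctuate; only
  the partial sums of \<open>\<sigma>^k\<close> behave regularly. Hence the differences have to fall
  on p, and the monotonicity of p is what turns them into nonnegative weights. The ratio of p at two
  arguments comes from evaluating the coefficient of \<open>\<sigma>^k p\<close> at
  \<open>n - h\<close> in two ways. It is close to \<open>n^k p(n - h)\<close>. It is also close to
  \<open>c_k p(n)\<close> times the average of \<open>(m - h)^(k \<alpha>)\<close>, extended by 0 to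
  \<open>m < h\<close>, for the weights that belong to n; with \<open>h = 0\<close> the average is
  that of \<open>m^(k \<alpha>)\<close>. So \<open>p(n - h) / p(n)\<close> is a quotient of two
  averages under one measure, whose integrands differ by the factor
  \<open>(1 - h / m)^(k \<alpha>)\<close>. For \<open>h = u / \<tau>\<close> and m near
  \<open>k \<alpha> / \<tau>\<close> this factor is about
  \<open>(1 - u / (k \<alpha>))^(k \<alpha>)\<close>. Both the concentration of m and the passage to
  \<open>exp (- u)\<close> improve with k, which is fixed before n grows. The constant is
  \<open>D = \<mu> A \<zeta>(\<mu> + 1)\<close>: minus the derivative of \<Theta> behaves like
  \<open>\<mu> A t^(-\<alpha>)\<close>, and the transform of \<open>\<sigma>\<close> sums it over
  all multiples of t.\<close>

definition lap :: "(nat \<Rightarrow> real) \<Rightarrow> real \<Rightarrow> real" where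
  "lap a t = (\<Sum>m. a m * exp (- (real m * t)))"

definition lap_conv :: "(nat \<Rightarrow> real) \<Rightarrow> bool" where
  "lap_conv a \<longleftrightarrow> (\<forall>m. a m \<ge> 0) \<and> (\<forall>t>0. summable (\<lambda>m. a m * exp (- (real m * t))))"

text \<open>Karamata's test functionals. With one factor \<open>exp (- (m t))\<close> kept outside
  of \<open>g\<close>, the monomial \<open>g x = x^i\<close> turns into
  \<open>lap a ((i + 1) t)\<close>, and every bounded \<open>g\<close> has a convergent sum.\<close>

definition wlap :: "(nat \<Rightarrow> real) \<Rightarrow> (real \<Rightarrow> real) \<Rightarrow> real \<Rightarrow> real" where
  "wlap a g t = (\<Sum>m. a m * exp (- (real m * t)) * g (exp (- (real m * t))))"

definition cum :: "(nat \<Rightarrow> real) \<Rightarrow> real \<Rightarrow> real" where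
  "cum a x = sum a {m. real m \<le> x}"

lemma lap_convD:
  assumes "lap_conv a"
  shows "a m \<ge> 0" "t > 0 \<Longrightarrow> summable (\<lambda>m. a m * exp (- (real m * t)))"
  using assms by (auto simp: lap_conv_def)

lemma lap_nonneg: "lap_conv a \<Longrightarrow> t > 0 \<Longrightarrow> lap a t \<ge> 0"
  unfolding lap_def by (intro suminf_nonneg) (auto simp: lap_convD)

lemma finite_real_nat_le [simp]: "finite {m. real m \<le> x}"
proof -
  have "{m. real m \<le> x} \<subseteq> {..nat \<lceil>x\<rceil>}" by (auto; linarith)
  thus ?thesis using finite_subset by blast
qed

lemma lap_tendsto_scale:
  assumes "((\<lambda>t. t powr \<rho> * lap a t) \<longlongrightarrow> C) (at_right 0)" "c > 0"
  shows "((\<lambda>t. t powr \<rho> * lap a (c * t)) \<longlongrightarrow> C * c powr (-\<rho>)) (at_right 0)"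
proof -
  have f: "filterlim (\<lambda>t. c * t) (at_right 0) (at_right (0::real))"
    using assms(2) by real_asymp
  have "((\<lambda>t. (c * t) powr \<rho> * lap a (c * t)) \<longlongrightarrow> C) (at_right 0)"
    by (rule filterlim_compose[OF assms(1) f])
  from tendsto_mult_left[OF this, of "c powr (-\<rho>)"]
  have "((\<lambda>t. c powr (-\<rho>) * ((c * t) powr \<rho> * lap a (c * t))) \<longlongrightarrow> c powr (-\<rho>) * C) (at_right 0)" .
  moreover have "\<forall>\<^sub>F t in at_right 0. c powr (-\<rho>) * ((c * t) powr \<rho> * lap a (c * t)) = t powr \<rho> * lap a (c * t)"
    using eventually_at_right_less[of 0]
    by eventually_elim (use assms(2) in \<open>simp add: powr_mult powr_minus field_simps\<close>)
  ultimately show ?thesis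
    unfolding mult.commute[of C] by (rule Lim_transform_eventually)
qed

lemma wlap_summable:
  assumes "lap_conv a" "t > 0" "\<And>x. 0 \<le> x \<Longrightarrow> x \<le> 1 \<Longrightarrow> \<bar>g x\<bar> \<le> K"
  shows "summable (\<lambda>m. a m * exp (- (real m * t)) * g (exp (- (real m * t))))"
proof (rule summable_comparison_test')
  show "summable (\<lambda>m. K * (a m * exp (- (real m * t))))"
    by (intro summable_mult lap_convD assms)
  fix n :: nat
  have "\<bar>g (exp (- (real n * t)))\<bar> \<le> K" using assms(2) by (intro assms(3)) auto
  hence "a n * exp (- (real n * t)) * \<bar>g (exp (- (real n * t)))\<bar> \<le> a n * exp (- (real n * t)) * K"
    by (intro mult_left_mono) (auto simp: lap_convD[OF assms(1)])
  thus "norm (a n * exp (- (real n * t)) * g (exp (- (real n * t)))) \<le> K * (a n * exp (- (real n * t)))"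
    by (simp add: abs_mult lap_convD[OF assms(1)] mult_ac)
qed

lemma wlap_bound:
  assumes "lap_conv a" "t > 0" "\<And>x. 0 \<le> x \<Longrightarrow> x \<le> 1 \<Longrightarrow> \<bar>g x\<bar> \<le> K"
  shows "\<bar>wlap a g t\<bar> \<le> K * lap a t"
proof -
  have sm: "summable (\<lambda>m. a m * exp (- (real m * t)) * \<bar>g (exp (- (real m * t)))\<bar>)"
    using assms by (intro wlap_summable[where K = K]) auto
  have "\<bar>wlap a g t\<bar> \<le> (\<Sum>m. \<bar>a m * exp (- (real m * t)) * g (exp (- (real m * t)))\<bar>)"
    unfolding wlap_def by (intro summable_rabs) (use sm in \<open>simp add: abs_mult lap_convD[OF assms(1)]\<close>)
  also have "\<dots> \<le> (\<Sum>m. K * (a m * exp (- (real m * t))))"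
  proof (intro suminf_le)
    fix n :: nat
    have "\<bar>g (exp (- (real n * t)))\<bar> \<le> K" using assms(2) by (intro assms(3)) auto
    hence "a n * exp (- (real n * t)) * \<bar>g (exp (- (real n * t)))\<bar> \<le> a n * exp (- (real n * t)) * K"
      by (intro mult_left_mono) (auto simp: lap_convD[OF assms(1)])
    thus "\<bar>a n * exp (- (real n * t)) * g (exp (- (real n * t)))\<bar> \<le> K * (a n * exp (- (real n * t)))"
      by (simp add: abs_mult lap_convD[OF assms(1)] mult_ac)
  qed (use sm in \<open>simp_all add: abs_mult lap_convD[OF assms(1)] lap_convD(2)[OF assms(1,2)] summable_mult\<close>)
  also have "\<dots> = K * lap a t"
    unfolding lap_def by (intro suminf_mult lap_convD assms)
  finally show ?thesis .
qed

lemma wlap_diff: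
  assumes "lap_conv a" "t > 0" "\<And>x. 0 \<le> x \<Longrightarrow> x \<le> 1 \<Longrightarrow> \<bar>g x\<bar> \<le> K"
    "\<And>x. 0 \<le> x \<Longrightarrow> x \<le> 1 \<Longrightarrow> \<bar>h x\<bar> \<le> K'"
  shows "wlap a (\<lambda>x. g x - h x) t = wlap a g t - wlap a h t"
  unfolding wlap_def
  by (subst suminf_diff[OF wlap_summable[OF assms(1,2,3)] wlap_summable[OF assms(1,2,4)]])
     (auto simp: algebra_simps)

lemma wlap_poly:
  assumes "lap_conv a" "t > 0"
  shows "wlap a (\<lambda>x. \<Sum>i\<le>n. c i * x ^ i) t = (\<Sum>i\<le>n. c i * lap a (real (Suc i) * t))"
proof -
  have s: "summable (\<lambda>m. a m * exp (- (real m * (real (Suc i) * t))))" for i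
    using assms by (intro lap_convD) auto
  have "wlap a (\<lambda>x. \<Sum>i\<le>n. c i * x ^ i) t
      = (\<Sum>m. \<Sum>i\<le>n. c i * (a m * exp (- (real m * (real (Suc i) * t)))))"
    unfolding wlap_def
  proof (intro suminf_cong)
    fix m
    have "exp (- (real m * t)) * exp (- (real m * t)) ^ i = exp (- (real m * (real (Suc i) * t)))" for i
      by (simp add: exp_of_nat_mult[symmetric] exp_add[symmetric] algebra_simps)
    thus "a m * exp (- (real m * t)) * (\<Sum>i\<le>n. c i * exp (- (real m * t)) ^ i)
      = (\<Sum>i\<le>n. c i * (a m * exp (- (real m * (real (Suc i) * t)))))"
      by (simp add: sum_distrib_left mult.assoc mult.left_commute)
  qed
  also have "\<dots> = (\<Sum>i\<le>n. \<Sum>m. c i * (a m * exp (- (real m * (real (Suc i) * t)))))"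
    by (intro suminf_sum summable_mult s)
  also have "\<dots> = (\<Sum>i\<le>n. c i * lap a (real (Suc i) * t))"
    unfolding lap_def by (intro sum.cong refl suminf_mult s)
  finally show ?thesis .
qed

text \<open>For a polynomial \<open>g\<close>, \<open>wlap\<close> is a combination of values of
  \<open>lap\<close> at multiples of t, whose scaled limits agree for both sequences. Weierstrass
  approximation extends this to continuous \<open>g\<close>, since a uniform error \<open>d\<close>
  costs at most \<open>d\<close> times the bounded quantity \<open>t powr \<rho> * lap\<close>.
  Comparing two sequences avoids identifying the limit with an integral.\<close>

lemma wlap_cont:
  assumes a: "lap_conv a" "((\<lambda>t. t powr \<rho> * lap a t) \<longlongrightarrow> C) (at_right 0)"
    and b: "lap_conv b" "((\<lambda>t. t powr \<rho> * lap b t) \<longlongrightarrow> C) (at_right 0)"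
    and g: "continuous_on {0..1} g"
  shows "((\<lambda>t. t powr \<rho> * (wlap a g t - wlap b g t)) \<longlongrightarrow> 0) (at_right 0)"
proof (rule tendstoI)
  fix e :: real assume e: "e > 0"
  have C: "C \<ge> 0"
    by (rule tendsto_lowerbound[OF a(2)])
       (auto intro!: eventually_at_rightI[of 0 1] mult_nonneg_nonneg lap_nonneg a)
  \<comment> \<open>The polynomial part may use up \<open>e / 2\<close> and each of the two
    approximation errors \<open>d (C + 1) = e / 4\<close>; eventually \<open>C + 1\<close> bounds
    both scaled transforms.\<close>
  define d where "d = e / (4 * (C + 1))"
  have d: "d > 0" using e C by (simp add: d_def)
  obtain P where P: "real_polynomial_function P" "\<And>x. x \<in> {0..1} \<Longrightarrow> \<bar>g x - P x\<bar> < d"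
    using Stone_Weierstrass_real_polynomial_function[OF _ g d] by auto
  obtain c n where Pc: "P = (\<lambda>x. \<Sum>i\<le>n. c i * x ^ i)"
    using P(1) real_polynomial_function_iff_sum by auto
  have bd: "\<exists>K. \<forall>x. 0 \<le> x \<longrightarrow> x \<le> 1 \<longrightarrow> \<bar>h x\<bar> \<le> K" if "continuous_on {0..1} h" for h :: "real \<Rightarrow> real"
  proof -
    have "bounded (h ` {0..1})" using that by (intro compact_imp_bounded compact_continuous_image) auto
    then obtain K where "\<forall>x\<in>{0..1}. \<bar>h x\<bar> \<le> K" by (auto simp: bounded_iff)
    thus ?thesis by (intro exI[of _ K]) auto
  qed
  obtain K where K: "\<And>x. 0 \<le> x \<Longrightarrow> x \<le> 1 \<Longrightarrow> \<bar>g x\<bar> \<le> K" using bd[OF g] by blast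
  have "continuous_on {0..1} P" unfolding Pc by (intro continuous_intros)
  then obtain K' where K': "\<And>x. 0 \<le> x \<Longrightarrow> x \<le> 1 \<Longrightarrow> \<bar>P x\<bar> \<le> K'" using bd by blast
  have "((\<lambda>t. \<Sum>i\<le>n. c i * (t powr \<rho> * lap a (real (Suc i) * t) - t powr \<rho> * lap b (real (Suc i) * t)))
    \<longlongrightarrow> (\<Sum>i\<le>n. c i * (C * real (Suc i) powr (-\<rho>) - C * real (Suc i) powr (-\<rho>)))) (at_right 0)"
    by (intro tendsto_intros lap_tendsto_scale a b) auto
  hence lim: "((\<lambda>t. \<Sum>i\<le>n. c i * (t powr \<rho> * lap a (real (Suc i) * t) - t powr \<rho> * lap b (real (Suc i) * t)))
    \<longlongrightarrow> 0) (at_right 0)" by simp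
  have "\<forall>\<^sub>F t in at_right 0. \<bar>\<Sum>i\<le>n. c i * (t powr \<rho> * lap a (real (Suc i) * t) - t powr \<rho> * lap b (real (Suc i) * t))\<bar> < e/2"
    using tendstoD[OF lim, of "e/2"] e by (simp add: dist_real_def)
  moreover have "\<forall>\<^sub>F t in at_right 0. t powr \<rho> * lap a t < C + 1"
    by (rule order_tendstoD(2)[OF a(2)]) auto
  moreover have "\<forall>\<^sub>F t in at_right 0. t powr \<rho> * lap b t < C + 1"
    by (rule order_tendstoD(2)[OF b(2)]) auto
  ultimately show "\<forall>\<^sub>F t in at_right 0. dist (t powr \<rho> * (wlap a g t - wlap b g t)) 0 < e"
    using eventually_at_right_less[of 0]
  proof eventually_elim
    case (elim t)
    have D: "\<bar>wlap u g t - wlap u P t\<bar> \<le> d * lap u t" if "lap_conv u" for u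
    proof -
      have "wlap u g t - wlap u P t = wlap u (\<lambda>x. g x - P x) t"
        by (rule wlap_diff[OF that elim(4) K K', symmetric]) auto
      thus ?thesis using wlap_bound[OF that elim(4), of "\<lambda>x. g x - P x" d] P(2) by (force simp: less_imp_le)
    qed
    have "wlap a P t - wlap b P t = (\<Sum>i\<le>n. c i * (lap a (real (Suc i) * t) - lap b (real (Suc i) * t)))"
      unfolding Pc using wlap_poly[OF a(1) elim(4)] wlap_poly[OF b(1) elim(4)]
      by (simp add: sum_subtractf algebra_simps)
    hence "t powr \<rho> * (wlap a P t - wlap b P t) = 
       (\<Sum>i\<le>n. c i * (t powr \<rho> * lap a (real (Suc i) * t) - t powr \<rho> * lap b (real (Suc i) * t)))"
      by (simp add: sum_distrib_left algebra_simps)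
    hence 1: "\<bar>t powr \<rho> * (wlap a P t - wlap b P t)\<bar> < e/2" using elim(1) by simp
    have "\<bar>t powr \<rho> * (wlap a g t - wlap a P t)\<bar> \<le> d * (t powr \<rho> * lap a t)"
      using mult_left_mono[OF D[OF a(1)], of "t powr \<rho>"] by (simp add: abs_mult mult_ac)
    also have "\<dots> \<le> d * (C + 1)" using elim(2) d by simp
    also have "\<dots> = e/4" using C by (simp add: d_def field_simps)
    finally have 2: "\<bar>t powr \<rho> * (wlap a g t - wlap a P t)\<bar> \<le> e/4" .
    have "\<bar>t powr \<rho> * (wlap b g t - wlap b P t)\<bar> \<le> d * (t powr \<rho> * lap b t)"
      using mult_left_mono[OF D[OF b(1)], of "t powr \<rho>"] by (simp add: abs_mult mult_ac)
    also have "\<dots> \<le> d * (C + 1)" using elim(3) d by simp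
    also have "\<dots> = e/4" using C by (simp add: d_def field_simps)
    finally have 3: "\<bar>t powr \<rho> * (wlap b g t - wlap b P t)\<bar> \<le> e/4" .
    have "t powr \<rho> * (wlap a g t - wlap b g t) = t powr \<rho> * (wlap a P t - wlap b P t)
       + t powr \<rho> * (wlap a g t - wlap a P t) - t powr \<rho> * (wlap b g t - wlap b P t)"
      by (simp add: algebra_simps)
    thus ?case using 1 2 3 unfolding dist_real_def by linarith
  qed
qed

text \<open>The indicator function of \<open>[e\<^sup>-\<^sup>s, 1]\<close> lies below a continuous function that vanishes on \<open>[0, e\<^sup>-\<^sup>r]\<close>.\<close>

lemma cum_compare:
  assumes a: "lap_conv a" "((\<lambda>t. t powr \<rho> * lap a t) \<longlongrightarrow> C) (at_right 0)"
    and b: "lap_conv b" "((\<lambda>t. t powr \<rho> * lap b t) \<longlongrightarrow> C) (at_right 0)"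
    and sr: "0 < s" "s < r" and e: "e > 0"
  shows "\<forall>\<^sub>F t in at_right 0. t powr \<rho> * cum a (s / t) \<le> t powr \<rho> * cum b (r / t) + e"
proof -
  define E where "E = exp (-s) - exp (-r)"
  have E: "E > 0" using sr by (simp add: E_def)
  define \<phi> where "\<phi> x = max 0 (min 1 ((x - exp (-r)) / E))" for x
  \<comment> \<open>Since \<open>wlap\<close> supplies a factor \<open>x\<close>, what counts is
    \<open>x * g x = \<phi> x\<close>. The maximum changes the denominator only where
    \<open>\<phi>\<close> vanishes and keeps \<open>g\<close> continuous at 0.\<close>
  define g where "g x = \<phi> x / max x (exp (-r))" for x
  have \<phi>: "0 \<le> \<phi> x" "\<phi> x \<le> 1" for x by (auto simp: \<phi>_def)
  have xg1: "x * g x = 1" if "x \<ge> exp (-s)" for x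
  proof -
    have "x > exp (-r)" using that sr by (smt (verit) exp_less_mono)
    moreover have "(x - exp (-r)) / E \<ge> 1" using that E by (simp add: field_simps E_def)
    moreover have "x > 0" using that by (smt (verit) exp_gt_zero)
    ultimately show ?thesis by (simp add: g_def \<phi>_def max_def min_def)
  qed
  have xg0: "x * g x = 0" if "x \<le> exp (-r)" for x
  proof -
    have "(x - exp (-r)) / E \<le> 0" using that E by (simp add: field_simps)
    thus ?thesis by (simp add: g_def \<phi>_def)
  qed
  have g_nonneg: "g x \<ge> 0" for x
    unfolding g_def using \<phi>(1)[of x] by (intro divide_nonneg_pos) (auto simp: less_max_iff_disj)
  have xg: "x * g x \<le> 1" if "x \<ge> 0" for x
  proof (cases "x \<le> exp (-r)")
    case False
    hence "exp (-r) < x" by simp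
    hence "x > 0" by (rule less_trans[OF exp_gt_zero])
    thus ?thesis using \<phi>(2)[of x] False by (simp add: g_def max_def)
  next
    case True
    thus ?thesis using xg0[OF True] by linarith
  qed
  have cont: "continuous_on {0..1} g"
    unfolding g_def \<phi>_def using E by (intro continuous_intros) (auto simp: max_def)
  obtain K where K: "\<And>x. 0 \<le> x \<Longrightarrow> x \<le> 1 \<Longrightarrow> \<bar>g x\<bar> \<le> K"
  proof -
    have "bounded (g ` {0..1})" using cont by (intro compact_imp_bounded compact_continuous_image) auto
    then obtain K where "\<forall>x\<in>{0..1}. \<bar>g x\<bar> \<le> K" by (auto simp: bounded_iff)
    thus ?thesis by (intro that[of K]) auto
  qed
  have "\<forall>\<^sub>F t in at_right 0. \<bar>t powr \<rho> * (wlap a g t - wlap b g t)\<bar> < e"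
    using tendstoD[OF wlap_cont[OF a b cont] e] by (simp add: dist_real_def)
  thus ?thesis using eventually_at_right_less[of 0]
  proof eventually_elim
    case (elim t)
    have le: "(\<Sum>m\<in>{m. real m \<le> s / t}. a m) \<le> wlap a g t"
    proof -
      have "(\<Sum>m\<in>{m. real m \<le> s / t}. a m) =
        (\<Sum>m\<in>{m. real m \<le> s / t}. a m * exp (- (real m * t)) * g (exp (- (real m * t))))"
      proof (intro sum.cong refl)
        fix m assume "m \<in> {m. real m \<le> s / t}"
        hence "real m * t \<le> s" using elim by (simp add: field_simps)
        from xg1[of "exp (- (real m * t))"] this
        show "a m = a m * exp (- (real m * t)) * g (exp (- (real m * t)))" by (simp add: mult.assoc)
      qed
      also have "\<dots> \<le> wlap a g t" unfolding wlap_def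
        by (intro sum_le_suminf wlap_summable[OF a(1) elim(2) K] ballI mult_nonneg_nonneg g_nonneg lap_convD[OF a(1)]) auto
      finally show ?thesis .
    qed
    have ge: "wlap b g t \<le> (\<Sum>m\<in>{m. real m \<le> r / t}. b m)"
    proof -
      have "wlap b g t = (\<Sum>m\<in>{m. real m \<le> r / t}. b m * exp (- (real m * t)) * g (exp (- (real m * t))))"
        unfolding wlap_def
      proof (intro suminf_finite)
        fix m assume "m \<notin> {m. real m \<le> r / t}"
        hence "real m * t \<ge> r" using elim by (simp add: field_simps)
        from xg0[of "exp (- (real m * t))"] this
        show "b m * exp (- (real m * t)) * g (exp (- (real m * t))) = 0" by (simp add: mult.assoc)
      qed auto
      also have "\<dots> \<le> (\<Sum>m\<in>{m. real m \<le> r / t}. b m)"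
      proof (intro sum_mono)
        fix m
        show "b m * exp (- (real m * t)) * g (exp (- (real m * t))) \<le> b m"
          using mult_left_mono[OF xg[of "exp (- (real m * t))"], of "b m"] lap_convD[OF b(1)]
          by (simp add: mult.assoc)
      qed
      finally show ?thesis .
    qed
    have "t powr \<rho> * cum a (s / t) \<le> t powr \<rho> * wlap a g t"
      unfolding cum_def by (intro mult_left_mono le) auto
    also have "\<dots> = t powr \<rho> * (wlap a g t - wlap b g t) + t powr \<rho> * wlap b g t" by (simp add: algebra_simps)
    also have "t powr \<rho> * wlap b g t \<le> t powr \<rho> * cum b (r / t)"
      unfolding cum_def by (intro mult_left_mono ge) auto
    finally show ?case using elim(1) by linarith
  qed
qed

section \<open>The coefficients of \<open>(1 - x)^(-\<rho>)\<close> and Karamata's theorem\<close>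

lemma lap_conv_pochhammer:
  assumes "\<rho> > 0" "C \<ge> 0"
  shows "lap_conv (\<lambda>m. C * pochhammer \<rho> m / fact m)"
    and "t > 0 \<Longrightarrow> lap (\<lambda>m. C * pochhammer \<rho> m / fact m) t = C * (1 - exp (-t)) powr (-\<rho>)"
proof -
  have *: "(\<lambda>m. C * pochhammer \<rho> m / fact m * exp (- (real m * t))) sums (C * (1 - exp (-t)) powr (-\<rho>))"
    if "t > 0" for t :: real
  proof -
    have "(\<lambda>n. (-\<rho> gchoose n) * (- exp (-t)) ^ n) sums (1 + (- exp (-t))) powr (-\<rho>)"
      by (rule gen_binomial_real) (use that in auto)
    also have "(\<lambda>n. (-\<rho> gchoose n) * (- exp (-t)) ^ n) = (\<lambda>m. pochhammer \<rho> m / fact m * exp (- (real m * t)))"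
    proof
      fix n
      have "((-1) ^ n * (- exp (-t)) ^ n :: real) = exp (- (real n * t))"
        by (simp add: power_mult_distrib[symmetric] exp_of_nat_mult[symmetric])
      thus "(-\<rho> gchoose n) * (- exp (-t)) ^ n = pochhammer \<rho> n / fact n * exp (- (real n * t))"
        by (simp add: gbinomial_pochhammer)
    qed
    finally have "(\<lambda>m. C * (pochhammer \<rho> m / fact m * exp (- (real m * t)))) sums (C * (1 - exp (-t)) powr (-\<rho>))"
      unfolding diff_conv_add_uminus by (rule sums_mult)
    thus ?thesis by (simp add: mult.assoc)
  qed
  show "lap_conv (\<lambda>m. C * pochhammer \<rho> m / fact m)"
    unfolding lap_conv_def using * assms by (auto simp: sums_iff intro!: pochhammer_nonneg divide_nonneg_pos mult_nonneg_nonneg)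
  show "lap (\<lambda>m. C * pochhammer \<rho> m / fact m) t = C * (1 - exp (-t)) powr (-\<rho>)" if "t > 0"
    using *[OF that] by (simp add: lap_def sums_iff)
qed

text \<open>Taking partial sums multiplies \<open>(1 - x)^(-\<rho>)\<close> by
  \<open>1 / (1 - x)\<close>, hence raises the exponent by one.\<close>

lemma sum_pochhammer_fact:
  "(\<Sum>m\<le>M. pochhammer \<rho> m / fact m) = pochhammer (\<rho> + 1) M / (fact M :: real)"
proof (induction M)
  case (Suc M)
  have 1: "pochhammer \<rho> (Suc M) = \<rho> * pochhammer (\<rho> + 1) M" by (simp only: pochhammer_rec)
  have "(\<Sum>m\<le>Suc M. pochhammer \<rho> m / fact m) =
      pochhammer (\<rho> + 1) M / fact M + \<rho> * pochhammer (\<rho> + 1) M / fact (Suc M)"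
    using Suc by (simp only: sum.atMost_Suc 1)
  also have "\<dots> = pochhammer (\<rho> + 1) (Suc M) / fact (Suc M)"
    unfolding pochhammer_Suc[of "\<rho> + 1"] fact_Suc by (simp add: divide_simps) (simp add: algebra_simps)
  finally show ?case .
qed simp

text \<open>Euler's limit formula for \<open>1 / Gamma \<rho>\<close>, shifted by one through
  \<open>pochhammer \<rho> (n + 1) = \<rho> * pochhammer (\<rho> + 1) n\<close>.\<close>

lemma pochhammer_fact_limit:
  assumes "\<rho> > 0"
  shows "(\<lambda>M. pochhammer (\<rho> + 1) M / (fact M * real M powr \<rho>)) \<longlonglongrightarrow> 1 / Gamma (\<rho> + 1 :: real)"
proof -
  have "(\<lambda>n. rGamma_series \<rho> n / \<rho>) \<longlonglongrightarrow> rGamma \<rho> / \<rho>"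
    by (intro tendsto_intros rGamma_series_LIMSEQ) (use assms in auto)
  also have "rGamma \<rho> / \<rho> = 1 / Gamma (\<rho> + 1)"
    using assms by (simp add: rGamma_plus1[of \<rho>, symmetric]) (simp add: rGamma_inverse_Gamma inverse_eq_divide)
  finally have L: "(\<lambda>n. rGamma_series \<rho> n / \<rho>) \<longlonglongrightarrow> 1 / Gamma (\<rho> + 1)" .
  have "\<forall>\<^sub>F n in sequentially. rGamma_series \<rho> n / \<rho> = pochhammer (\<rho> + 1) n / (fact n * real n powr \<rho>)"
    using eventually_gt_at_top[of 0]
  proof eventually_elim
    case (elim n)
    have "pochhammer \<rho> (n + 1) = \<rho> * pochhammer (\<rho> + 1) n" by (simp add: pochhammer_rec)
    thus ?case using elim assms by (simp add: rGamma_series_def powr_def mult.commute)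
  qed
  from Lim_transform_eventually[OF L this] show ?thesis .
qed

lemma cum_of_nat: "cum a (real M) = (\<Sum>m\<le>M. a m)"
  unfolding cum_def by (rule sum.cong) auto

lemma cum_floor: "x \<ge> 0 \<Longrightarrow> cum a x = cum a (real (nat \<lfloor>x\<rfloor>))"
proof -
  assume "x \<ge> 0"
  hence "real m \<le> x \<longleftrightarrow> m \<le> nat \<lfloor>x\<rfloor>" for m by (simp add: le_nat_iff le_floor_iff)
  thus ?thesis by (simp add: cum_def)
qed

lemma cum_real_limit:
  assumes "(\<lambda>M. cum b (real M) / real M powr \<rho>) \<longlonglongrightarrow> c" "r > 0"
  shows "(\<lambda>M. cum b (r * real M) / real M powr \<rho>) \<longlonglongrightarrow> c * r powr \<rho>"
proof -
  define f where "f M = nat \<lfloor>r * real M\<rfloor>" for M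
  have f: "filterlim f at_top sequentially"
    unfolding f_def using assms(2) by real_asymp
  have ratio: "(\<lambda>M. real (f M) / real M) \<longlonglongrightarrow> r"
    unfolding f_def using assms(2) by real_asymp
  have "(\<lambda>M. cum b (real (f M)) / real (f M) powr \<rho> * (real (f M) / real M) powr \<rho>) \<longlonglongrightarrow> c * r powr \<rho>"
    by (intro tendsto_mult filterlim_compose[OF assms(1) f] tendsto_powr[OF ratio] tendsto_const) (use assms in auto)
  moreover have "\<forall>\<^sub>F M in sequentially. cum b (real (f M)) / real (f M) powr \<rho> * (real (f M) / real M) powr \<rho>
       = cum b (r * real M) / real M powr \<rho>"
    using eventually_gt_at_top[of 0] filterlim_at_top[THEN iffD1, OF f, rule_format, of 1]
  proof eventually_elim
    case (elim M)
    have "cum b (r * real M) = cum b (real (f M))" unfolding f_def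
      by (rule cum_floor) (use assms in auto)
    thus ?case using elim by (simp add: powr_divide)
  qed
  ultimately show ?thesis by (rule Lim_transform_eventually)
qed

text \<open>The comparison sequence consists of the coefficients of \<open>C (1 - x)\<^sup>-\<^sup>\<rho>\<close>, whose partial sums are
  explicit.\<close>

theorem karamata:
  assumes a: "lap_conv a" "((\<lambda>t. t powr \<rho> * lap a t) \<longlongrightarrow> C) (at_right 0)" and \<rho>: "\<rho> > 0"
  shows "(\<lambda>M. (\<Sum>m\<le>M. a m) / real M powr \<rho>) \<longlonglongrightarrow> C / Gamma (\<rho> + 1)"
proof -
  have C: "C \<ge> 0"
    by (rule tendsto_lowerbound[OF a(2)])
       (auto intro!: eventually_at_rightI[of 0 1] mult_nonneg_nonneg lap_nonneg a)
  define b where "b m = C * pochhammer \<rho> m / fact m" for m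
  define c where "c = C / Gamma (\<rho> + 1)"
  have b: "lap_conv b" unfolding b_def using lap_conv_pochhammer[OF \<rho> C] by simp
  have "((\<lambda>t::real. t powr \<rho> * (C * (1 - exp (-t)) powr (-\<rho>))) \<longlongrightarrow> C) (at_right 0)"
    by real_asymp
  moreover have "\<forall>\<^sub>F t in at_right 0. t powr \<rho> * (C * (1 - exp (-t)) powr (-\<rho>)) = t powr \<rho> * lap b t"
    using eventually_at_right_less[of 0]
    by eventually_elim (simp add: b_def[abs_def] lap_conv_pochhammer[OF \<rho> C])
  ultimately have b': "((\<lambda>t. t powr \<rho> * lap b t) \<longlongrightarrow> C) (at_right 0)"
    by (rule Lim_transform_eventually)
  have "(\<lambda>M. C * (pochhammer (\<rho> + 1) M / (fact M * real M powr \<rho>))) \<longlonglongrightarrow> C * (1 / Gamma (\<rho> + 1))"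
    by (intro tendsto_intros pochhammer_fact_limit \<rho>)
  moreover have "cum b (real M) = C * (pochhammer (\<rho> + 1) M / fact M)" for M
    unfolding cum_of_nat b_def using sum_pochhammer_fact[of \<rho> M]
    by (simp add: sum_distrib_left[symmetric] times_divide_eq_right[symmetric] del: times_divide_eq_right)
  ultimately have "(\<lambda>M. cum b (real M) / real M powr \<rho>) \<longlonglongrightarrow> c"
    by (simp add: c_def)
  note blim = cum_real_limit[OF this]
  have inv: "filterlim (\<lambda>M. 1 / real M) (at_right 0) sequentially" by real_asymp
  have pw: "(1 / real M) powr \<rho> * x = x / real M powr \<rho>" for M x by (simp add: powr_divide)
  have upper: "\<forall>\<^sub>F M in sequentially. cum a (real M) / real M powr \<rho> < y" if y: "y > c" for y
  proof -
    \<comment> \<open>At \<open>t = 1 / M\<close> the comparison cuts \<open>b\<close> off at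
      \<open>r M\<close> instead of \<open>M\<close>, which costs the factor
      \<open>r powr \<rho>\<close>; so \<open>r\<close> is taken close enough to 1 for
      \<open>c * r powr \<rho>\<close> to stay below \<open>y\<close>.\<close>
    have "((\<lambda>r. c * r powr \<rho>) \<longlongrightarrow> c) (at_right 1)" by (auto intro!: tendsto_eq_intros)
    from order_tendstoD(2)[OF this y] eventually_at_right_less[of 1]
    have "\<forall>\<^sub>F r in at_right 1. c * r powr \<rho> < y \<and> r > 1" by eventually_elim simp
    then obtain r where r: "r > 1" "c * r powr \<rho> < y"
      using eventually_happens'[OF trivial_limit_at_right_real] by auto
    define e where "e = (y - c * r powr \<rho>) / 2"
    have e: "e > 0" using r by (simp add: e_def)
    have "\<forall>\<^sub>F t in at_right 0. t powr \<rho> * cum a (1 / t) \<le> t powr \<rho> * cum b (r / t) + e"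
      by (rule cum_compare[OF a b b']) (use r e in auto)
    from eventually_compose_filterlim[OF this inv]
    have "\<forall>\<^sub>F M in sequentially. cum a (real M) / real M powr \<rho> \<le> cum b (r * real M) / real M powr \<rho> + e"
      by (simp add: pw)
    moreover have "\<forall>\<^sub>F M in sequentially. cum b (r * real M) / real M powr \<rho> < c * r powr \<rho> + e"
      by (rule order_tendstoD(2)[OF blim]) (use r e in auto)
    ultimately show ?thesis by eventually_elim (use e in \<open>simp add: e_def field_simps\<close>)
  qed
  \<comment> \<open>The same comparison with the two sequences exchanged and \<open>r\<close>
    slightly below 1.\<close>
  have lower: "\<forall>\<^sub>F M in sequentially. cum a (real M) / real M powr \<rho> > y" if y: "y < c" for y
  proof -
    have "((\<lambda>r. c * r powr \<rho>) \<longlongrightarrow> c) (at_left 1)" by (auto intro!: tendsto_eq_intros)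
    from order_tendstoD(1)[OF this y] eventually_at_left_real[OF zero_less_one]
    have "\<forall>\<^sub>F r in at_left 1. c * r powr \<rho> > y \<and> r \<in> {0<..<1}" by eventually_elim simp
    then obtain r where r: "0 < r" "r < 1" "c * r powr \<rho> > y"
      using eventually_happens'[OF trivial_limit_at_left_real] by auto
    define e where "e = (c * r powr \<rho> - y) / 2"
    have e: "e > 0" using r by (simp add: e_def)
    have "\<forall>\<^sub>F t in at_right 0. t powr \<rho> * cum b (r / t) \<le> t powr \<rho> * cum a (1 / t) + e"
      by (rule cum_compare[OF b b' a]) (use r e in auto)
    from eventually_compose_filterlim[OF this inv]
    have "\<forall>\<^sub>F M in sequentially. cum b (r * real M) / real M powr \<rho> \<le> cum a (real M) / real M powr \<rho> + e"
      by (simp add: pw)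
    moreover have "\<forall>\<^sub>F M in sequentially. cum b (r * real M) / real M powr \<rho> > c * r powr \<rho> - e"
      by (rule order_tendstoD(1)[OF blim]) (use r e in auto)
    ultimately show ?thesis by eventually_elim (use e in \<open>simp add: e_def field_simps\<close>)
  qed
  have "(\<lambda>M. cum a (real M) / real M powr \<rho>) \<longlonglongrightarrow> c"
    by (rule order_tendstoI) (use upper lower in auto)
  thus ?thesis by (simp add: cum_of_nat c_def)
qed

section \<open>Monotone sequences satisfying a logarithmic-derivative recurrence\<close>

lemma lap_fps_mult:
  fixes f g :: "real fps"
  assumes "lap_conv (fps_nth f)" "lap_conv (fps_nth g)"
  shows "lap_conv (fps_nth (f * g))"
    and "t > 0 \<Longrightarrow> lap (fps_nth (f * g)) t = lap (fps_nth f) t * lap (fps_nth g) t"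
proof -
  have *: "(\<lambda>m. fps_nth (f * g) m * exp (- (real m * t))) sums (lap (fps_nth f) t * lap (fps_nth g) t)"
    if "t > 0" for t
  proof -
    define a where "a m = fps_nth f m * exp (- (real m * t))" for m
    define b where "b m = fps_nth g m * exp (- (real m * t))" for m
    have "(\<lambda>k. \<Sum>i\<le>k. a i * b (k - i)) sums ((\<Sum>k. a k) * (\<Sum>k. b k))"
      using lap_convD[OF assms(1)] lap_convD[OF assms(2)] that
      by (intro Cauchy_product_sums) (auto simp: a_def b_def abs_mult)
    moreover have "(\<Sum>i\<le>k. a i * b (k - i)) = fps_nth (f * g) k * exp (- (real k * t))" for k
    proof -
      have "a i * b (k - i) = fps_nth f i * fps_nth g (k - i) * exp (- (real k * t))" if "i \<le> k" for i
      proof -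
        have "exp (- (real i * t)) * exp (- (real (k - i) * t)) = exp (- (real k * t))"
          using that by (simp add: exp_add[symmetric] of_nat_diff algebra_simps)
        thus ?thesis by (simp add: a_def b_def)
      qed
      thus ?thesis by (simp add: fps_mult_nth sum_distrib_right atLeast0AtMost)
    qed
    ultimately show ?thesis by (simp add: lap_def a_def b_def)
  qed
  show "lap_conv (fps_nth (f * g))"
    unfolding lap_conv_def using * lap_convD(1)[OF assms(1)] lap_convD(1)[OF assms(2)]
    by (auto simp: sums_iff fps_mult_nth intro!: sum_nonneg)
  show "lap (fps_nth (f * g)) t = lap (fps_nth f) t * lap (fps_nth g) t" if "t > 0"
    using *[OF that] by (simp add: lap_def sums_iff)
qed

lemma lap_fps_one:
  shows "lap_conv (fps_nth (1 :: real fps))" and "lap (fps_nth (1 :: real fps)) t = 1"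
proof -
  have *: "(\<lambda>m. fps_nth (1 :: real fps) m * exp (- (real m * t))) sums 1" for t
    using sums_single[of 0 "\<lambda>_. 1::real"] by (simp add: if_distrib[of "\<lambda>x. x * _"] fps_one_nth cong: if_cong)
  show "lap_conv (fps_nth (1 :: real fps))" using * by (auto simp: lap_conv_def sums_iff fps_one_nth)
  show "lap (fps_nth (1 :: real fps)) t = 1" using * by (auto simp: lap_def sums_iff)
qed

lemma lap_fps_power:
  fixes f :: "real fps"
  assumes "lap_conv (fps_nth f)"
  shows "lap_conv (fps_nth (f ^ k))" and "t > 0 \<Longrightarrow> lap (fps_nth (f ^ k)) t = lap (fps_nth f) t ^ k"
proof -
  have "lap_conv (fps_nth (f ^ k)) \<and> (t > 0 \<longrightarrow> lap (fps_nth (f ^ k)) t = lap (fps_nth f) t ^ k)"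
  proof (induction k)
    case 0
    show ?case unfolding power_0 using lap_fps_one by blast
  next
    case (Suc k)
    thus ?case unfolding power_Suc using lap_fps_mult[OF assms] by simp
  qed
  thus "lap_conv (fps_nth (f ^ k))" and "t > 0 \<Longrightarrow> lap (fps_nth (f ^ k)) t = lap (fps_nth f) t ^ k" by auto
qed

text \<open>What the argument uses of partitions: \<open>rec\<close> says that
  \<open>\<sigma>\<close> is the logarithmic derivative \<open>X p' / p\<close>, while
  \<open>D\<close> and \<open>\<alpha>\<close> describe its growth \<open>D t^(-\<alpha>)\<close> at
  \<open>x = exp (- t)\<close>.\<close>

locale mono_recurrence =
  fixes p \<sigma> :: "real fps" and \<alpha> D :: real
  assumes p0: "fps_nth p 0 > 0" and p_mono: "mono (fps_nth p)"
    and \<sigma>: "lap_conv (fps_nth \<sigma>)"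
    and rec: "\<sigma> * p = fps_X * fps_deriv p"
    and \<alpha>: "\<alpha> > 1" and D: "D > 0"
    and lim: "((\<lambda>t. t powr \<alpha> * lap (fps_nth \<sigma>) t) \<longlongrightarrow> D) (at_right 0)"
begin

text \<open>The solution of \<open>D t^(-\<alpha>) = n\<close>. For partitions,
  \<open>lap \<sigma> t\<close> is minus the derivative of the logarithm of the generating function
  at \<open>exp (- t)\<close>, so this is the saddle point equation to leading order.\<close>

definition \<tau> :: "nat \<Rightarrow> real" where "\<tau> n = (D / real n) powr (1 / \<alpha>)"

lemma p_pos: "fps_nth p n > 0"
  using p0 monoD[OF p_mono, of 0 n] by linarith

lemma p_le: "m \<le> n \<Longrightarrow> fps_nth p m \<le> fps_nth p n"
  using monoD[OF p_mono] by blast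

lemma \<sigma>_nonneg: "fps_nth \<sigma> m \<ge> 0"
  using lap_convD[OF \<sigma>] by blast

lemma rec_nth: "real n * fps_nth p n = (\<Sum>m\<le>n. fps_nth \<sigma> m * fps_nth p (n - m))"
proof -
  have "fps_nth (fps_X * fps_deriv p) n = real n * fps_nth p n" by (cases n) auto
  thus ?thesis unfolding rec[symmetric] by (simp add: fps_mult_nth atLeast0AtMost)
qed

lemma \<tau>_pos: "n > 0 \<Longrightarrow> \<tau> n > 0"
  using D by (simp add: \<tau>_def)

lemma \<tau>_powr: "n > 0 \<Longrightarrow> \<tau> n powr \<alpha> = D / real n"
  using D \<alpha> by (simp add: \<tau>_def powr_powr)

lemma \<tau>_lim: "filterlim \<tau> (at_right 0) sequentially"
  unfolding \<tau>_def[abs_def] using D \<alpha> by real_asymp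

lemma n\<tau>_lim: "filterlim (\<lambda>n. real n * \<tau> n) at_top sequentially"
  unfolding \<tau>_def[abs_def] using D \<alpha> by real_asymp

text \<open>By Karamata's theorem the partial sum of \<open>\<sigma>\<close> up to a suitable multiple \<open>w / \<tau> n\<close> exceeds \<open>2 n\<close>, so the
  recurrence forces \<open>p\<close> to halve over each stretch of this length.\<close>

lemma decay:
  "\<exists>C \<delta>. C > 0 \<and> 0 < \<delta> \<and> \<delta> \<le> 1 \<and> (\<forall>\<^sub>F n in sequentially. \<forall>m\<le>n.
     fps_nth p (n - m) \<le> C * exp (- (\<delta> * (real m * \<tau> n))) * fps_nth p n)"
proof -
  define S where "S M = (\<Sum>m\<le>M. fps_nth \<sigma> m)" for M
  define c where "c = D / Gamma (\<alpha> + 1)"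
  have c: "c > 0" using D \<alpha> by (simp add: c_def Gamma_real_pos)
  have Slim: "(\<lambda>M. S M / real M powr \<alpha>) \<longlonglongrightarrow> c"
    unfolding S_def c_def by (rule karamata[OF \<sigma> lim]) (use \<alpha> in auto)
  \<comment> \<open>Chosen so that \<open>c (w / \<tau> n)^\<alpha> = 3 n\<close>; giving up a third
    in Karamata's limit leaves a partial sum of at least \<open>2 n\<close>.\<close>
  define w where "w = (3 * D / c) powr (1 / \<alpha>)"
  have w: "w > 0" "w powr \<alpha> = 3 * D / c" using c D \<alpha> by (auto simp: w_def powr_powr)
  define M where "M n = nat \<lceil>w / \<tau> n\<rceil>" for n
  have w\<tau>: "filterlim (\<lambda>n. w / \<tau> n) at_top sequentially"
    by (rule filterlim_compose[OF _ \<tau>_lim]) (use w in real_asymp)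
  have Mlim: "filterlim M at_top sequentially"
    unfolding M_def by (rule filterlim_compose[OF _ w\<tau>, of "\<lambda>x. nat \<lceil>x\<rceil>"]) real_asymp
  \<comment> \<open>One halving takes at most \<open>2 w / \<tau> n\<close> steps, hence the rate
    \<open>ln 2 / (2 w)\<close> on the scale \<open>1 / \<tau> n\<close>. The bound by 1 lets
    \<open>exp (- (\<delta> y))\<close> dominate \<open>exp (- y)\<close> later on.\<close>
  define \<delta> where "\<delta> = min 1 (ln 2 / (2 * w))"
  have \<delta>: "0 < \<delta>" "\<delta> \<le> 1" using w by (auto simp: \<delta>_def)
  have "\<forall>\<^sub>F M in sequentially. S M / real M powr \<alpha> > (2/3) * c"
    by (rule order_tendstoD(1)[OF Slim]) (use c in auto)
  from eventually_compose_filterlim[OF this Mlim]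
  have "\<forall>\<^sub>F n in sequentially. \<forall>m\<le>n. fps_nth p (n - m) \<le> 2 * exp (- (\<delta> * (real m * \<tau> n))) * fps_nth p n"
    using eventually_gt_at_top[of 0] filterlim_at_top[THEN iffD1, OF w\<tau>, rule_format, of 1]
  proof eventually_elim
    case (elim n)
    have t: "\<tau> n > 0" using \<tau>_pos elim by auto
    have M1: "real (M n) \<ge> w / \<tau> n" "real (M n) \<le> 2 * w / \<tau> n"
      using elim(3) unfolding M_def by linarith+
    hence M0: "M n > 0" using elim(3) by linarith
    have "(w / \<tau> n) powr \<alpha> \<le> real (M n) powr \<alpha>" using M1 w t \<alpha> by (intro powr_mono2) auto
    hence "3 * real n / c \<le> real (M n) powr \<alpha>"
      using t w D elim by (simp add: powr_divide \<tau>_powr)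
    hence "3 * real n \<le> c * real (M n) powr \<alpha>" using c by (simp add: field_simps)
    also have "c * real (M n) powr \<alpha> \<le> (3/2) * S (M n)"
      using elim(1) M0 by (simp add: field_simps)
    finally have S2: "2 * real n \<le> S (M n)" by simp
    \<comment> \<open>In the recurrence at \<open>n'\<close> only the terms
      \<open>m \<le> M n\<close> are kept, and there \<open>p(n' - m) \<ge> p(n' - M n)\<close>. So
      \<open>n' p(n')\<close> is at least \<open>S (M n) p(n' - M n)\<close>, and
      \<open>S (M n) \<ge> 2 n \<ge> 2 n'\<close>.\<close>
    have step: "fps_nth p (n' - M n) \<le> fps_nth p n' / 2" if n': "n' \<le> n" "M n \<le> n'" for n'
    proof -
      have "2 * real n' * fps_nth p (n' - M n) \<le> S (M n) * fps_nth p (n' - M n)"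
        using S2 n' p_pos[of "n' - M n"] by (intro mult_right_mono) auto
      also have "\<dots> \<le> (\<Sum>m\<le>M n. fps_nth \<sigma> m * fps_nth p (n' - m))"
        unfolding S_def sum_distrib_right
        by (intro sum_mono mult_left_mono p_le \<sigma>_nonneg) auto
      also have "\<dots> \<le> (\<Sum>m\<le>n'. fps_nth \<sigma> m * fps_nth p (n' - m))"
        by (intro sum_mono2) (use n' in \<open>auto intro!: mult_nonneg_nonneg \<sigma>_nonneg less_imp_le[OF p_pos]\<close>)
      also have "\<dots> = real n' * fps_nth p n'" by (simp add: rec_nth)
      finally show ?thesis using M0 n' by (simp add: field_simps)
    qed
    have iter: "j * M n \<le> n \<Longrightarrow> fps_nth p (n - j * M n) \<le> fps_nth p n * (1/2) ^ j" for j
    proof (induction j)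
      case (Suc j)
      have "fps_nth p (n - j * M n - M n) \<le> fps_nth p (n - j * M n) / 2"
        by (rule step) (use Suc.prems in auto)
      also have "\<dots> \<le> fps_nth p n * (1/2) ^ j / 2" using Suc by simp
      finally show ?case by (simp add: algebra_simps)
    qed simp
    show ?case
    proof (intro allI impI)
      fix m assume m: "m \<le> n"
      define j where "j = m div M n"
      have jm: "j * M n \<le> m" by (simp add: j_def)
      have "fps_nth p (n - m) \<le> fps_nth p (n - j * M n)" using jm by (intro p_le) auto
      also have "\<dots> \<le> fps_nth p n * (1/2) ^ j" using jm m by (intro iter) auto
      \<comment> \<open>\<open>m\<close> exceeds \<open>j * M n\<close> by less than one full
        stretch, and the factor 2 pays for this remainder.\<close>
      also have "(1/2::real) ^ j \<le> 2 * exp (- (\<delta> * (real m * \<tau> n)))"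
      proof -
        have "m < (j + 1) * M n" using M0 unfolding j_def by (metis Suc_eq_plus1 dividend_less_div_times mult.commute mult_Suc_right add.commute)
        hence "real m < (real j + 1) * real (M n)"
          by (metis of_nat_less_iff of_nat_mult of_nat_add of_nat_1)
        hence 1: "real m / real (M n) \<le> real j + 1" using M0 by (simp add: field_simps)
        have "\<delta> * \<tau> n \<le> ln 2 / (2 * w) * \<tau> n" using t by (intro mult_right_mono) (auto simp: \<delta>_def)
        also have "\<dots> = ln 2 / (2 * w / \<tau> n)" using t by simp
        also have "\<dots> \<le> ln 2 / real (M n)" using M1 M0 w t by (intro divide_left_mono) auto
        finally have "\<delta> * \<tau> n * real m \<le> ln 2 / real (M n) * real m" by (intro mult_right_mono) auto
        also have "\<dots> \<le> ln 2 * (real j + 1)" using mult_left_mono[OF 1, of "ln 2"] by simp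
        finally have "exp (- (ln 2 * (real j + 1))) \<le> exp (- (\<delta> * (real m * \<tau> n)))" by (simp add: mult_ac)
        moreover have "exp (- (ln 2 * (real j + 1))) = (1/2) ^ j / (2::real)"
        proof -
          have "- (ln 2 * (real j + 1)) = real j * ln (1/2) + ln (1/2)"
            by (simp add: ln_div algebra_simps)
          thus ?thesis by (simp only: exp_add exp_of_nat_mult) simp
        qed
        ultimately show ?thesis by simp
      qed
      hence "fps_nth p n * (1/2) ^ j \<le> fps_nth p n * (2 * exp (- (\<delta> * (real m * \<tau> n))))"
        using p_pos[of n] by (intro mult_left_mono) auto
      finally show "fps_nth p (n - m) \<le> 2 * exp (- (\<delta> * (real m * \<tau> n))) * fps_nth p n" by (simp add: mult_ac)
    qed
  qed
  thus ?thesis using \<delta> by (intro exI[of _ 2] exI[of _ \<delta>]) auto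
qed

text \<open>By the product rule \<open>\<sigma>\<^sup>k\<^sup>+\<^sup>1 p = X (\<sigma>\<^sup>k p)' - X (\<sigma>\<^sup>k)' p\<close>. The exponential decay confines the last term to
  indices of order \<open>1 / \<tau> n\<close>, which makes it smaller than the first by a factor \<open>1 / (n \<tau> n)\<close>.\<close>

lemma power_coeff_limit:
  "(\<lambda>n. fps_nth (\<sigma> ^ k * p) n / (real n ^ k * fps_nth p n)) \<longlonglongrightarrow> 1"
proof (induction k)
  case 0
  have "fps_nth p n \<noteq> 0" for n using p_pos[of n] by simp
  thus ?case by simp
next
  case (Suc k)
  obtain C \<delta> where C: "C > 0" "0 < \<delta>" "\<delta> \<le> 1" and dec: "\<forall>\<^sub>F n in sequentially. \<forall>m\<le>n.
     fps_nth p (n - m) \<le> C * exp (- (\<delta> * (real m * \<tau> n))) * fps_nth p n"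
    using decay by blast
  define V where "V = fps_X * fps_deriv (\<sigma> ^ k) * p"
  have sk: "lap_conv (fps_nth (\<sigma> ^ k))" by (rule lap_fps_power[OF \<sigma>])
  have Xd: "fps_nth (fps_X * fps_deriv f) n = real n * fps_nth f n" for f :: "real fps" and n
    by (cases n) auto
  have recU: "fps_nth (\<sigma> ^ Suc k * p) n = real n * fps_nth (\<sigma> ^ k * p) n - fps_nth V n" for n
  proof -
    have "\<sigma> ^ Suc k * p = \<sigma> ^ k * (fps_X * fps_deriv p)" by (simp add: rec[symmetric] mult_ac)
    also have "\<dots> = fps_X * fps_deriv (\<sigma> ^ k * p) - V" by (simp add: V_def algebra_simps)
    finally show ?thesis by (simp add: Xd del: fps_deriv_mult)
  qed
  have Vnth: "fps_nth V n = (\<Sum>i\<le>n. real i * fps_nth (\<sigma> ^ k) i * fps_nth p (n - i))" for n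
    unfolding V_def fps_mult_nth[of _ p] Xd by (simp add: atLeast0AtMost)
  have Vlim: "(\<lambda>n. fps_nth V n / (real n ^ Suc k * fps_nth p n)) \<longlonglongrightarrow> 0"
  proof (rule tendsto_sandwich[OF _ _ tendsto_const])
    have "((\<lambda>t. t powr \<alpha> * lap (fps_nth \<sigma>) (\<delta> / 2 * t)) \<longlongrightarrow> D * (\<delta> / 2) powr (-\<alpha>)) (at_right 0)"
      by (rule lap_tendsto_scale[OF lim]) (use C in auto)
    note Z = filterlim_compose[OF this \<tau>_lim]
    have Y: "(\<lambda>n. 1 / (real n * \<tau> n)) \<longlonglongrightarrow> 0"
      by (rule tendsto_divide_0[OF tendsto_const filterlim_at_top_imp_at_infinity[OF n\<tau>_lim]])
    have "(\<lambda>n. C * (2 / \<delta>) * (1 / (real n * \<tau> n)) * (\<tau> n powr \<alpha> * lap (fps_nth \<sigma>) (\<delta> / 2 * \<tau> n) / D) ^ k)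
      \<longlonglongrightarrow> C * (2 / \<delta>) * 0 * (D * (\<delta> / 2) powr (-\<alpha>) / D) ^ k"
      by (intro tendsto_mult tendsto_const tendsto_power tendsto_divide Z Y) (use D in auto)
    thus "(\<lambda>n. C * (2 / \<delta>) * (1 / (real n * \<tau> n)) * (\<tau> n powr \<alpha> * lap (fps_nth \<sigma>) (\<delta> / 2 * \<tau> n) / D) ^ k) \<longlonglongrightarrow> 0"
      by simp
    show "\<forall>\<^sub>F n in sequentially. 0 \<le> fps_nth V n / (real n ^ Suc k * fps_nth p n)"
      unfolding Vnth using p_pos lap_convD(1)[OF sk]
      by (intro always_eventually allI divide_nonneg_nonneg sum_nonneg mult_nonneg_nonneg)
         (auto intro: less_imp_le)
    show "\<forall>\<^sub>F n in sequentially. fps_nth V n / (real n ^ Suc k * fps_nth p n) \<le>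
       C * (2 / \<delta>) * (1 / (real n * \<tau> n)) * (\<tau> n powr \<alpha> * lap (fps_nth \<sigma>) (\<delta> / 2 * \<tau> n) / D) ^ k"
      using dec eventually_gt_at_top[of 0]
    proof eventually_elim
      case (elim n)
      \<comment> \<open>Half of the decay rate absorbs the factor \<open>i\<close> at the price
        \<open>1 / t\<close>; the other half sums up to \<open>lap (\<sigma>^k) t\<close>, which is
        of order \<open>n^k\<close>. What remains is of relative order
        \<open>1 / (n \<tau> n)\<close>.\<close>
      define t where "t = \<delta> / 2 * \<tau> n"
      have t: "t > 0" using \<tau>_pos[OF elim(2)] C by (simp add: t_def)
      have "fps_nth V n \<le> (\<Sum>i\<le>n. C * fps_nth p n / t * (fps_nth (\<sigma> ^ k) i * exp (- (real i * t))))"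
        unfolding Vnth
      proof (intro sum_mono)
        fix i assume i: "i \<in> {..n}"
        have "real i * t \<le> exp (real i * t)" using exp_ge_add_one_self[of "real i * t"] by linarith
        hence ie: "real i * exp (- (real i * t)) \<le> 1 / t" using t by (simp add: exp_minus field_simps)
        have "fps_nth p (n - i) \<le> C * exp (- (\<delta> * (real i * \<tau> n))) * fps_nth p n" using elim i by auto
        also have "exp (- (\<delta> * (real i * \<tau> n))) = exp (- (real i * t)) * exp (- (real i * t))"
          by (simp add: exp_add[symmetric] t_def algebra_simps)
        finally have "real i * fps_nth (\<sigma> ^ k) i * fps_nth p (n - i) \<le>
            real i * fps_nth (\<sigma> ^ k) i * (C * (exp (- (real i * t)) * exp (- (real i * t))) * fps_nth p n)"
          using lap_convD(1)[OF sk] by (intro mult_left_mono) auto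
        also have "\<dots> = (real i * exp (- (real i * t))) * (C * fps_nth p n * (fps_nth (\<sigma> ^ k) i * exp (- (real i * t))))"
          by (simp add: mult_ac)
        also have "\<dots> \<le> (1 / t) * (C * fps_nth p n * (fps_nth (\<sigma> ^ k) i * exp (- (real i * t))))"
          using lap_convD(1)[OF sk] C p_pos[of n] by (intro mult_right_mono ie) auto
        finally show "real i * fps_nth (\<sigma> ^ k) i * fps_nth p (n - i) \<le>
          C * fps_nth p n / t * (fps_nth (\<sigma> ^ k) i * exp (- (real i * t)))" by simp
      qed
      also have "\<dots> \<le> C * fps_nth p n / t * lap (fps_nth (\<sigma> ^ k)) t"
        unfolding lap_def sum_distrib_left[symmetric] using C p_pos[of n] t lap_convD(1)[OF sk]
        by (intro mult_left_mono sum_le_suminf lap_convD(2)[OF sk]) auto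
      also have "lap (fps_nth (\<sigma> ^ k)) t = lap (fps_nth \<sigma>) t ^ k" using t by (rule lap_fps_power[OF \<sigma>])
      finally have "fps_nth V n / (real n ^ Suc k * fps_nth p n) \<le>
          C * fps_nth p n / t * lap (fps_nth \<sigma>) t ^ k / (real n ^ Suc k * fps_nth p n)"
        using p_pos[of n] by (intro divide_right_mono) auto
      also have "\<dots> = C * (2 / \<delta>) * (1 / (real n * \<tau> n)) * (lap (fps_nth \<sigma>) t / real n) ^ k"
        using p_pos[of n] elim(2) by (simp add: t_def field_simps power_divide)
      also have "lap (fps_nth \<sigma>) t / real n = \<tau> n powr \<alpha> * lap (fps_nth \<sigma>) (\<delta> / 2 * \<tau> n) / D"
        using elim(2) D by (simp add: \<tau>_powr t_def)
      finally show ?case .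
    qed
  qed
  have "(\<lambda>n. fps_nth (\<sigma> ^ k * p) n / (real n ^ k * fps_nth p n) - fps_nth V n / (real n ^ Suc k * fps_nth p n)) \<longlonglongrightarrow> 1 - 0"
    by (intro tendsto_diff Suc.IH Vlim)
  moreover have "\<forall>\<^sub>F n in sequentially. fps_nth (\<sigma> ^ k * p) n / (real n ^ k * fps_nth p n) - fps_nth V n / (real n ^ Suc k * fps_nth p n)
     = fps_nth (\<sigma> ^ Suc k * p) n / (real n ^ Suc k * fps_nth p n)"
    using eventually_gt_at_top[of 0]
  proof eventually_elim
    case (elim n)
    thus ?case unfolding recU using p_pos[of n] by (simp add: field_simps)
  qed
  ultimately show ?case by (simp add: Lim_transform_eventually)
qed

end

section \<open>Gamma quotients and powers close to exponentials\<close>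

lemma Gamma_add_le:
  fixes x a :: real
  assumes "x > 0" "0 \<le> a" "a \<le> 1"
  shows "Gamma (x + a) \<le> Gamma x * x powr a"
proof -
  have cvx: "convex_on {0<..} (\<lambda>x. ln (Gamma x :: real))"
    using log_convex_Gamma_real by (simp add: o_def)
  have "ln (Gamma ((1 - a) *\<^sub>R x + a *\<^sub>R (x + 1))) \<le> (1 - a) * ln (Gamma x) + a * ln (Gamma (x + 1))"
    by (rule convex_onD[OF cvx]) (use assms in auto)
  also have "(1 - a) *\<^sub>R x + a *\<^sub>R (x + 1) = x + a" by (simp add: algebra_simps)
  also have "Gamma (x + 1) = x * Gamma x" using assms by (subst Gamma_plus1) auto
  also have "(1 - a) * ln (Gamma x) + a * ln (x * Gamma x) = ln (Gamma x * x powr a)"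
    using assms Gamma_real_pos[of x] by (simp add: ln_mult ln_powr algebra_simps)
  finally show ?thesis using assms Gamma_real_pos[of x] Gamma_real_pos[of "x + a"] by simp
qed

text \<open>For \<open>0 \<le> a \<le> 1\<close> log-convexity between \<open>x\<close> and
  \<open>x + 1\<close> gives the upper bound. The same inequality at \<open>x + a\<close> with
  increment \<open>1 - a\<close>, which ends at \<open>Gamma (x + 1) = x * Gamma x\<close>, gives
  the lower one. The functional equation then adds the integer part of \<open>a\<close>.\<close>

lemma Gamma_ratio_limit:
  fixes a :: real
  assumes "a \<ge> 0"
  shows "((\<lambda>x. Gamma (x + a) / (Gamma x * x powr a)) \<longlongrightarrow> 1) at_top"
proof -
  have frac: "((\<lambda>x. Gamma (x + a) / (Gamma x * x powr a)) \<longlongrightarrow> 1) at_top" if a: "0 \<le> a" "a \<le> 1" for a :: real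
  proof (rule tendsto_sandwich[OF _ _ _ tendsto_const])
    show "\<forall>\<^sub>F x in at_top. Gamma (x + a) / (Gamma x * x powr a) \<le> 1"
      using eventually_gt_at_top[of 0]
    proof eventually_elim
      case (elim x)
      show ?case using Gamma_add_le[OF elim a] elim Gamma_real_pos[OF elim] by simp
    qed
    show "\<forall>\<^sub>F x in at_top. x * (x + a) powr (a - 1) / x powr a \<le> Gamma (x + a) / (Gamma x * x powr a)"
      using eventually_gt_at_top[of 0]
    proof eventually_elim
      case (elim x)
      have "Gamma (x + a + (1 - a)) \<le> Gamma (x + a) * (x + a) powr (1 - a)"
        by (rule Gamma_add_le) (use elim a in auto)
      moreover have "x + a + (1 - a) = x + 1" by simp
      hence "Gamma (x + a + (1 - a)) = x * Gamma x"
        using elim by (simp only:) (subst Gamma_plus1, auto)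
      ultimately have "x * Gamma x * (x + a) powr (a - 1) \<le> Gamma (x + a) * (x + a) powr (1 - a) * (x + a) powr (a - 1)"
        by (intro mult_right_mono) auto
      also have "\<dots> = Gamma (x + a)" using elim a by (simp add: mult.assoc powr_add[symmetric])
      finally show ?case using elim Gamma_real_pos[OF elim] by (simp add: field_simps)
    qed
    show "((\<lambda>x. x * (x + a) powr (a - 1) / x powr a) \<longlongrightarrow> 1) at_top"
      by real_asymp
  qed
  have step: "((\<lambda>x. Gamma (x + (b + real n)) / (Gamma x * x powr (b + real n))) \<longlongrightarrow> 1) at_top"
    if b: "0 \<le> b" "b \<le> 1" for b n
  proof (induction n)
    case 0
    show ?case using frac[OF b] by simp
  next
    case (Suc n)
    have "((\<lambda>x. Gamma (x + (b + real n)) / (Gamma x * x powr (b + real n)) * ((x + (b + real n)) / x)) \<longlongrightarrow> 1 * 1) at_top"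
      by (intro tendsto_mult Suc) real_asymp
    hence "((\<lambda>x. Gamma (x + (b + real n)) / (Gamma x * x powr (b + real n)) * ((x + (b + real n)) / x)) \<longlongrightarrow> 1) at_top"
      by simp
    moreover have "\<forall>\<^sub>F x in at_top. Gamma (x + (b + real n)) / (Gamma x * x powr (b + real n)) * ((x + (b + real n)) / x)
       = Gamma (x + (b + real (Suc n))) / (Gamma x * x powr (b + real (Suc n)))"
      using eventually_gt_at_top[of 0]
    proof eventually_elim
      case (elim x)
      have "Gamma (x + (b + real n) + 1) = (x + (b + real n)) * Gamma (x + (b + real n))"
        by (rule Gamma_plus1) (use elim b in \<open>auto elim!: nonpos_Ints_cases\<close>)
      thus ?case using elim by (simp add: powr_add algebra_simps)
    qed
    ultimately show ?case by (rule Lim_transform_eventually)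
  qed
  have "a = (a - of_int \<lfloor>a\<rfloor>) + real (nat \<lfloor>a\<rfloor>)" using assms by simp
  moreover have "0 \<le> a - of_int \<lfloor>a\<rfloor>" "a - of_int \<lfloor>a\<rfloor> \<le> 1" by linarith+
  ultimately show ?thesis using step by metis
qed

text \<open>The limit relation becomes an inequality for every index, the finitely many exceptions
  being paid by \<open>K\<close>. This form is needed because averages run over all
  \<open>m \<le> n\<close>, including small ones; after division by \<open>n^k\<close> the constant
  disappears.\<close>

lemma ratio_limit_error_bound:
  fixes a b :: "nat \<Rightarrow> real"
  assumes "(\<lambda>j. a j / b j) \<longlonglongrightarrow> c" "\<And>j. b j \<ge> 0" "\<forall>\<^sub>F j in sequentially. b j > 0" "\<epsilon> > 0"
  shows "\<exists>K\<ge>0. \<forall>j. \<bar>a j - c * b j\<bar> \<le> \<epsilon> * b j + K"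
proof -
  have "\<forall>\<^sub>F j in sequentially. \<bar>a j / b j - c\<bar> < \<epsilon> \<and> b j > 0"
    using tendstoD[OF assms(1,4)] assms(3) by eventually_elim (simp add: dist_real_def)
  then obtain N where N: "\<And>j. j \<ge> N \<Longrightarrow> \<bar>a j / b j - c\<bar> < \<epsilon> \<and> b j > 0"
    by (auto simp: eventually_at_top_linorder)
  define K where "K = (\<Sum>j<N. \<bar>a j - c * b j\<bar>)"
  have K: "K \<ge> 0" by (simp add: K_def sum_nonneg)
  have "\<bar>a j - c * b j\<bar> \<le> \<epsilon> * b j + K" for j
  proof (cases "j < N")
    case True
    hence "\<bar>a j - c * b j\<bar> \<le> K" unfolding K_def by (intro member_le_sum) auto
    moreover have "\<epsilon> * b j \<ge> 0" using assms(2,4) by simp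
    ultimately show ?thesis by linarith
  next
    case False
    hence j: "\<bar>a j / b j - c\<bar> < \<epsilon>" "b j > 0" using N by auto
    have "\<bar>a j - c * b j\<bar> = \<bar>a j / b j - c\<bar> * b j" using j(2) by (simp add: abs_mult_pos' field_simps abs_if)
    also have "\<dots> \<le> \<epsilon> * b j" using j by (intro mult_right_mono) auto
    finally show ?thesis using K by linarith
  qed
  with K show ?thesis by blast
qed

text \<open>The base is monotone in \<open>z\<close>, so uniformity in \<open>z\<close> only
  requires the classical limit at the endpoints \<open>u - d\<close> and \<open>u + d\<close>. In
  the later use, the cut-off at 0 stands for the indices \<open>m < h\<close>.\<close>

lemma exp_power_approx:
  fixes u e :: real
  assumes "e > 0"
  shows "\<exists>\<delta>>0. \<exists>X>0. \<forall>x\<ge>X. \<forall>z. \<bar>z - u\<bar> \<le> \<delta> \<longrightarrow> \<bar>max 0 (1 - z / x) powr x - exp (- u)\<bar> \<le> e"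
proof -
  have "((\<lambda>d. exp (- (u - d))) \<longlongrightarrow> exp (- u)) (at_right 0)" "((\<lambda>d. exp (- (u + d))) \<longlongrightarrow> exp (- u)) (at_right 0)"
    by (auto intro!: tendsto_eq_intros)
  moreover have "exp (- u) < exp (- u) + e/2" "exp (- u) - e/2 < exp (- u)" using assms by auto
  ultimately have "\<forall>\<^sub>F d in at_right 0. exp (- (u - d)) < exp (-u) + e/2"
    "\<forall>\<^sub>F d in at_right 0. exp (- (u + d)) > exp (-u) - e/2"
    by - (rule order_tendstoD, assumption, assumption)+
  with eventually_at_right_less[of 0]
  have "\<forall>\<^sub>F d in at_right 0. exp (- (u - d)) < exp (-u) + e/2 \<and> exp (- (u + d)) > exp (-u) - e/2 \<and> d > 0"
    by eventually_elim auto
  then obtain d where d: "exp (- (u - d)) < exp (-u) + e/2" "exp (- (u + d)) > exp (-u) - e/2" "d > 0"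
    using eventually_happens'[OF trivial_limit_at_right_real] by auto
  have 1: "((\<lambda>x. (1 - (u - d) / x) powr x) \<longlongrightarrow> exp (- (u - d))) at_top"
    using tendsto_exp_limit_at_top[of "- (u - d)"] by (simp only: minus_divide_left[symmetric] add_uminus_conv_diff)
  have 2: "((\<lambda>x. (1 - (u + d) / x) powr x) \<longlongrightarrow> exp (- (u + d))) at_top"
    using tendsto_exp_limit_at_top[of "- (u + d)"] by (simp only: minus_divide_left[symmetric] add_uminus_conv_diff)
  have 3: "((\<lambda>x. 1 - (u + d) / x) \<longlongrightarrow> 1) at_top" by real_asymp
  have "exp (- (u - d)) < exp (- u) + e" "exp (- u) - e < exp (- (u + d))" using d assms by auto
  from order_tendstoD(2)[OF 1 this(1)] order_tendstoD(1)[OF 2 this(2)]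
    order_tendstoD(1)[OF 3 zero_less_one] eventually_gt_at_top[of 0]
  have "\<forall>\<^sub>F x in at_top. (1 - (u - d) / x) powr x < exp (- u) + e \<and> (1 - (u + d) / x) powr x > exp (- u) - e
     \<and> 1 - (u + d) / x > 0 \<and> x > 0"
    by eventually_elim blast
  then obtain X where X: "\<And>x. x \<ge> X \<Longrightarrow> (1 - (u - d) / x) powr x < exp (- u) + e \<and> (1 - (u + d) / x) powr x > exp (- u) - e
     \<and> 1 - (u + d) / x > 0 \<and> x > 0" by (auto simp: eventually_at_top_linorder)
  have "\<bar>max 0 (1 - z / x) powr x - exp (- u)\<bar> \<le> e" if x: "x \<ge> max 1 X" and z: "\<bar>z - u\<bar> \<le> d" for x z
  proof -
    note Xx = X[of x]
    have x0: "x > 0" using x by simp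
    have zl: "1 - (u + d) / x \<le> 1 - z / x" and zu: "1 - z / x \<le> 1 - (u - d) / x"
      using z x0 by (auto intro!: divide_right_mono)
    have z0: "0 \<le> 1 - z / x" using zl Xx x by linarith
    hence m: "max 0 (1 - z / x) = 1 - z / x" by (rule max_absorb2)
    have "(1 - (u + d) / x) powr x \<le> (1 - z / x) powr x"
      using zl Xx x by (intro powr_mono2) auto
    moreover have "(1 - z / x) powr x \<le> (1 - (u - d) / x) powr x"
      by (rule powr_mono2[OF less_imp_le[OF x0] z0 zu])
    ultimately show ?thesis
      unfolding m using Xx x by (simp add: abs_le_iff)
  qed
  moreover have "max 1 X > 0" by simp
  ultimately show ?thesis using d(3) by blast
qed

text \<open>To be read with \<open>v = h \<tau>\<close> and
  \<open>q = (m \<tau> / x) powr \<alpha>\<close>, where \<open>x = k \<alpha>\<close>: then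
  \<open>v * q powr (- (1 / \<alpha>))\<close> is \<open>x h / m\<close>, the quantity that has to
  be close to \<open>u\<close>, while concentration is known only for \<open>q\<close>.\<close>

lemma scaled_root_approx:
  fixes u \<alpha> \<delta> :: real
  assumes "\<delta> > 0" "\<alpha> > 0" "u > 0"
  shows "\<exists>d. 0 < d \<and> d < 1 \<and> d < u \<and> (\<forall>v q. \<bar>v - u\<bar> \<le> d \<longrightarrow> \<bar>q - 1\<bar> \<le> d \<longrightarrow> \<bar>v * q powr (- (1 / \<alpha>)) - u\<bar> \<le> \<delta>)"
proof -
  have 1: "((\<lambda>d. (u + d) * (1 - d) powr (- (1 / \<alpha>))) \<longlongrightarrow> u) (at_right 0)"
    by (auto intro!: tendsto_eq_intros)
  have 2: "((\<lambda>d. (u - d) * (1 + d) powr (- (1 / \<alpha>))) \<longlongrightarrow> u) (at_right 0)"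
    by (auto intro!: tendsto_eq_intros)
  have "\<forall>\<^sub>F d in at_right 0. d \<in> {0<..<min 1 u}" by (rule eventually_at_right_real) (use assms in auto)
  moreover have "u < u + \<delta>" "u - \<delta> < u" using assms by auto
  note order_tendstoD(2)[OF 1 this(1)] order_tendstoD(1)[OF 2 this(2)]
  ultimately have "\<forall>\<^sub>F d in at_right 0. (u + d) * (1 - d) powr (- (1 / \<alpha>)) < u + \<delta> \<and> (u - d) * (1 + d) powr (- (1 / \<alpha>)) > u - \<delta>
     \<and> 0 < d \<and> d < 1 \<and> d < u"
    by eventually_elim simp
  then obtain d where d: "(u + d) * (1 - d) powr (- (1 / \<alpha>)) < u + \<delta>" "(u - d) * (1 + d) powr (- (1 / \<alpha>)) > u - \<delta>"
     "0 < d" "d < 1" "d < u"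
    using eventually_happens'[OF trivial_limit_at_right_real] by blast
  show ?thesis
  proof (intro exI[of _ d] conjI allI impI)
    fix v q :: real assume v: "\<bar>v - u\<bar> \<le> d" and q: "\<bar>q - 1\<bar> \<le> d"
    have "v * q powr (- (1 / \<alpha>)) \<le> (u + d) * (1 - d) powr (- (1 / \<alpha>))"
      using v q d assms by (intro mult_mono powr_mono2') auto
    moreover have "(u - d) * (1 + d) powr (- (1 / \<alpha>)) \<le> v * q powr (- (1 / \<alpha>))"
      using v q d assms by (intro mult_mono powr_mono2') auto
    ultimately show "\<bar>v * q powr (- (1 / \<alpha>)) - u\<bar> \<le> \<delta>" using d by linarith
  qed (use d in auto)
qed

section \<open>Averages over the increments of p and their moments of order
  \<open>k \<alpha>\<close>\<close>

context mono_recurrence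
begin

definition pdiff :: "real fps" where "pdiff = (1 - fps_X) * p"

text \<open>Expectation for the weights \<open>(p(n - m) - p(n - m - 1)) / p(n)\<close>, which are nonnegative and sum to 1.\<close>

definition avg :: "nat \<Rightarrow> (nat \<Rightarrow> real) \<Rightarrow> real" where
  "avg n f = (\<Sum>m\<le>n. f m * fps_nth pdiff (n - m)) / fps_nth p n"

lemma pdiff_nonneg: "fps_nth pdiff j \<ge> 0"
  by (cases j) (use p_pos[of 0] p_le[of "j - 1" j] in \<open>auto simp: pdiff_def algebra_simps\<close>)

lemma avg_mono:
  assumes "\<And>m. m \<le> n \<Longrightarrow> f m \<le> g m"
  shows "avg n f \<le> avg n g"
  unfolding avg_def using p_pos[of n]
  by (intro divide_right_mono sum_mono mult_right_mono assms pdiff_nonneg) auto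

lemma avg_add: "avg n (\<lambda>m. f m + g m) = avg n f + avg n g"
  by (simp add: avg_def ring_distribs sum.distrib add_divide_distrib)

lemma avg_diff: "avg n (\<lambda>m. f m - g m) = avg n f - avg n g"
  by (simp add: avg_def ring_distribs sum_subtractf diff_divide_distrib)

lemma avg_cmult: "avg n (\<lambda>m. c * f m) = c * avg n f"
  by (simp add: avg_def sum_distrib_left mult.assoc)

lemma avg_abs: "\<bar>avg n f\<bar> \<le> avg n (\<lambda>m. \<bar>f m\<bar>)"
proof -
  have "avg n f \<le> avg n (\<lambda>m. \<bar>f m\<bar>)" by (rule avg_mono) simp
  moreover have "- avg n f \<le> avg n (\<lambda>m. \<bar>f m\<bar>)"
    using avg_mono[of n "\<lambda>m. (-1) * f m" "\<lambda>m. \<bar>f m\<bar>"] avg_cmult[of n "-1" f] by simp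
  ultimately show ?thesis by linarith
qed

definition psum :: "real fps \<Rightarrow> nat \<Rightarrow> real" where
  "psum f m = (\<Sum>i\<le>m. fps_nth f i)"

lemma psum_fps: "psum f m = fps_nth (f * Abs_fps (\<lambda>_. 1)) m"
  by (simp add: psum_def fps_mult_nth atLeast0AtMost)

lemma one_minus_X_ones: "(1 - fps_X) * Abs_fps (\<lambda>_. 1) = (1 :: real fps)"
  by (rule fps_ext) (auto simp: algebra_simps fps_one_nth split: nat.splits)

text \<open>Abel summation, as the identity \<open>f p = (f / (1 - X)) ((1 - X) p)\<close>.\<close>

lemma psum_mult: "f * p = (f * Abs_fps (\<lambda>_. 1)) * pdiff"
proof -
  have "(f * Abs_fps (\<lambda>_. 1)) * pdiff = f * p * ((1 - fps_X) * Abs_fps (\<lambda>_. 1))"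
    by (simp add: pdiff_def mult_ac)
  also have "\<dots> = f * p" by (simp only: one_minus_X_ones mult_1_right)
  finally show ?thesis by (rule sym)
qed

lemma avg_psum: "avg n (psum f) = fps_nth (f * p) n / fps_nth p n"
  unfolding psum_mult avg_def psum_fps fps_mult_nth[of _ pdiff] by (simp add: atLeast0AtMost)

text \<open>Multiplying by \<open>X^h\<close> shifts the partial sums and leaves the weights alone,
  so the coefficient at \<open>n - h\<close> becomes an average under the same measure as the one at
  \<open>n\<close>.\<close>

lemma avg_psum_shift:
  assumes "h \<le> n"
  shows "avg n (\<lambda>m. if h \<le> m then psum f (m - h) else 0) = fps_nth (f * p) (n - h) / fps_nth p n"
proof -
  have "fps_nth (f * p) (n - h) = fps_nth (fps_X ^ h * (f * Abs_fps (\<lambda>_. 1)) * pdiff) n"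
    unfolding psum_mult[of f] mult.assoc fps_X_power_mult_nth using assms by simp
  also have "\<dots> = (\<Sum>m\<le>n. (if h \<le> m then psum f (m - h) else 0) * fps_nth pdiff (n - m))"
    unfolding fps_mult_nth[of _ pdiff] fps_X_power_mult_nth psum_fps[symmetric] atLeast0AtMost
    by (intro sum.cong) auto
  finally show ?thesis by (simp add: avg_def)
qed

lemma avg_one: "avg n (\<lambda>_. 1) = 1"
proof -
  have "psum 1 = (\<lambda>_. 1)" by (auto simp: psum_def fps_one_nth)
  hence "avg n (\<lambda>_. 1) = fps_nth (1 * p) n / fps_nth p n" using avg_psum[of n 1] by simp
  thus ?thesis using p_pos[of n] by simp
qed

definition psum_const :: "nat \<Rightarrow> real" where "psum_const k = D ^ k / Gamma (real k * \<alpha> + 1)"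

lemma psum_const_pos: "psum_const k > 0"
  unfolding psum_const_def using D \<alpha> by (intro divide_pos_pos Gamma_real_pos) (auto intro: add_nonneg_pos)

lemma psum_power_limit:
  assumes "k > 0"
  shows "(\<lambda>M. psum (\<sigma> ^ k) M / real M powr (real k * \<alpha>)) \<longlonglongrightarrow> psum_const k"
  unfolding psum_def psum_const_def
proof (rule karamata)
  show "lap_conv (fps_nth (\<sigma> ^ k))" by (rule lap_fps_power[OF \<sigma>])
  have "((\<lambda>t. (t powr \<alpha> * lap (fps_nth \<sigma>) t) ^ k) \<longlongrightarrow> D ^ k) (at_right 0)"
    by (intro tendsto_power lim)
  moreover have "\<forall>\<^sub>F t in at_right 0. (t powr \<alpha> * lap (fps_nth \<sigma>) t) ^ k = t powr (real k * \<alpha>) * lap (fps_nth (\<sigma> ^ k)) t"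
    using eventually_at_right_less[of 0]
  proof eventually_elim
    case (elim t)
    have "t powr (real k * \<alpha>) = (t powr \<alpha>) ^ k"
      using elim by (simp add: powr_realpow[symmetric] powr_powr mult.commute)
    thus ?case using lap_fps_power(2)[OF \<sigma> elim] by (simp add: power_mult_distrib)
  qed
  ultimately show "((\<lambda>t. t powr (real k * \<alpha>) * lap (fps_nth (\<sigma> ^ k)) t) \<longlongrightarrow> D ^ k) (at_right 0)"
    by (rule Lim_transform_eventually)
  show "real k * \<alpha> > 0" using assms \<alpha> by simp
qed

lemma psum_power_error:
  assumes "k > 0" "\<epsilon> > 0"
  shows "\<exists>K\<ge>0. \<forall>j. \<bar>psum (\<sigma> ^ k) j - psum_const k * real j powr (real k * \<alpha>)\<bar> \<le> \<epsilon> * real j powr (real k * \<alpha>) + K"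
  by (rule ratio_limit_error_bound[OF psum_power_limit[OF assms(1)] _ _ assms(2)])
     (auto intro: eventually_mono[OF eventually_gt_at_top[of 0]])

text \<open>\<open>n^k\<close> is the natural unit because
  \<open>\<tau> n powr (- (k \<alpha>)) = (n / D)^k\<close>.\<close>

definition scaled_moment :: "nat \<Rightarrow> nat \<Rightarrow> real" where
  "scaled_moment k n = avg n (\<lambda>m. real m powr (real k * \<alpha>)) / real n ^ k"

lemma const_over_power_lim: "k > 0 \<Longrightarrow> (\<lambda>n. K / real n ^ k) \<longlonglongrightarrow> 0"
  by (intro tendsto_divide_0[OF tendsto_const] filterlim_at_top_imp_at_infinity
      filterlim_pow_at_top filterlim_real_sequentially)

lemma scaled_moment_error:
  assumes "k > 0" "\<epsilon> > 0"
  shows "\<exists>K\<ge>0. \<forall>n. \<bar>fps_nth (\<sigma> ^ k * p) n / (real n ^ k * fps_nth p n) - psum_const k * scaled_moment k n\<bar> \<le> \<epsilon> * scaled_moment k n + K / real n ^ k"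
proof -
  obtain K where K: "K \<ge> 0" "\<And>j. \<bar>psum (\<sigma> ^ k) j - psum_const k * real j powr (real k * \<alpha>)\<bar> \<le> \<epsilon> * real j powr (real k * \<alpha>) + K"
    using psum_power_error[OF assms] by blast
  have "\<bar>fps_nth (\<sigma> ^ k * p) n / (real n ^ k * fps_nth p n) - psum_const k * scaled_moment k n\<bar> \<le> \<epsilon> * scaled_moment k n + K / real n ^ k" for n
  proof -
    have "avg n (psum (\<sigma> ^ k)) - psum_const k * avg n (\<lambda>m. real m powr (real k * \<alpha>))
       = avg n (\<lambda>m. psum (\<sigma> ^ k) m - psum_const k * real m powr (real k * \<alpha>))"
      by (simp add: avg_diff avg_cmult)
    also have "\<bar>\<dots>\<bar> \<le> avg n (\<lambda>m. \<epsilon> * real m powr (real k * \<alpha>) + K * 1)"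
      by (rule order_trans[OF avg_abs]) (rule avg_mono, use K in simp)
    also have "\<dots> = \<epsilon> * avg n (\<lambda>m. real m powr (real k * \<alpha>)) + K"
      unfolding avg_add avg_cmult avg_one by simp
    finally have "\<bar>avg n (psum (\<sigma> ^ k)) - psum_const k * avg n (\<lambda>m. real m powr (real k * \<alpha>))\<bar> / real n ^ k
       \<le> (\<epsilon> * avg n (\<lambda>m. real m powr (real k * \<alpha>)) + K) / real n ^ k"
      by (intro divide_right_mono) auto
    also have "\<bar>avg n (psum (\<sigma> ^ k)) - psum_const k * avg n (\<lambda>m. real m powr (real k * \<alpha>))\<bar> / real n ^ k
      = \<bar>(avg n (psum (\<sigma> ^ k)) - psum_const k * avg n (\<lambda>m. real m powr (real k * \<alpha>))) / real n ^ k\<bar>"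
      by (simp add: abs_divide)
    finally show ?thesis unfolding avg_psum scaled_moment_def by (simp add: diff_divide_distrib add_divide_distrib mult.commute)
  qed
  thus ?thesis using K by blast
qed

text \<open>The error term contains the moment itself, so the estimate is used twice:
  \<open>\<epsilon> = psum_const k / 2\<close> gives boundedness, and then arbitrarily small
  \<open>\<epsilon>\<close> gives the limit.\<close>

lemma scaled_moment_limit:
  assumes "k > 0"
  shows "scaled_moment k \<longlonglongrightarrow> 1 / psum_const k"
proof -
  define x where "x n = fps_nth (\<sigma> ^ k * p) n / (real n ^ k * fps_nth p n)" for n
  have x: "x \<longlonglongrightarrow> 1" unfolding x_def using power_coeff_limit by blast
  obtain K where K: "\<And>n. \<bar>x n - psum_const k * scaled_moment k n\<bar> \<le> psum_const k / 2 * scaled_moment k n + K / real n ^ k"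
    using scaled_moment_error[OF assms, of "psum_const k / 2"] psum_const_pos[of k] unfolding x_def by auto
  \<comment> \<open>The crude estimate leaves
    \<open>psum_const k / 2 * scaled_moment k n \<le> 3\<close>, since eventually
    \<open>x n < 2\<close> and \<open>K / n^k < 1\<close>.\<close>
  have bound: "\<forall>\<^sub>F n in sequentially. scaled_moment k n \<le> 6 / psum_const k"
    using order_tendstoD(2)[OF x, of 2, simplified] order_tendstoD(2)[OF const_over_power_lim[OF assms, of K], of 1, simplified]
  proof eventually_elim
    case (elim n)
    have "psum_const k * scaled_moment k n - psum_const k / 2 * scaled_moment k n \<le> 3" using K[of n] elim by linarith
    thus ?case using psum_const_pos[of k] by (simp add: field_simps)
  qed
  have "(\<lambda>n. x n - psum_const k * scaled_moment k n) \<longlonglongrightarrow> 0"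
  proof (rule tendstoI)
    fix e :: real assume e: "e > 0"
    define \<epsilon> where "\<epsilon> = e * psum_const k / 12"
    have \<epsilon>: "\<epsilon> > 0" using e psum_const_pos[of k] by (simp add: \<epsilon>_def)
    obtain K' where K': "\<And>n. \<bar>x n - psum_const k * scaled_moment k n\<bar> \<le> \<epsilon> * scaled_moment k n + K' / real n ^ k"
      using scaled_moment_error[OF assms \<epsilon>] unfolding x_def by auto
    have "\<forall>\<^sub>F n in sequentially. K' / real n ^ k < e / 2"
      by (rule order_tendstoD(2)[OF const_over_power_lim[OF assms]]) (use e in auto)
    with bound show "\<forall>\<^sub>F n in sequentially. dist (x n - psum_const k * scaled_moment k n) 0 < e"
    proof eventually_elim
      case (elim n)
      have "\<epsilon> * scaled_moment k n \<le> \<epsilon> * (6 / psum_const k)" using elim \<epsilon> by (intro mult_left_mono) auto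
      also have "\<dots> = e / 2" using psum_const_pos[of k] by (simp add: \<epsilon>_def)
      finally have "\<bar>x n - psum_const k * scaled_moment k n\<bar> < e" using K'[of n] elim by linarith
      thus ?case by (simp add: dist_real_def)
    qed
  qed
  from tendsto_diff[OF x this] have "(\<lambda>n. psum_const k * scaled_moment k n) \<longlonglongrightarrow> 1" by simp
  from tendsto_divide[OF this tendsto_const, of "psum_const k"] show ?thesis using psum_const_pos[of k] by simp
qed

section \<open>Concentration of the averages and the ratios of p\<close>

definition shifted_power :: "nat \<Rightarrow> nat \<Rightarrow> nat \<Rightarrow> real" where
  "shifted_power k h m = (if h \<le> m then real (m - h) powr (real k * \<alpha>) else 0)"

text \<open>Two evaluations of the coefficient of \<open>\<sigma>^k p\<close> at
  \<open>n - h\<close>, divided by \<open>n^k p(n)\<close>. By \<open>power_coeff_limit\<close> it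
  is close to the ratio of p, because \<open>h / n\<close> tends to 0; as a shifted average it
  allows the partial sums to be replaced by \<open>psum_const k * (m - h)^(k \<alpha>)\<close>. The
  ratio is at most 1 by monotonicity, so relative errors are also absolute ones.\<close>

lemma shift_limit:
  assumes k: "k > 0" and h: "\<And>n. h n \<le> n" "(\<lambda>n. real (h n) / real n) \<longlonglongrightarrow> 0"
  shows "(\<lambda>n. psum_const k * avg n (shifted_power k (h n)) / real n ^ k - fps_nth p (n - h n) / fps_nth p n) \<longlonglongrightarrow> 0"
proof -
  define X where "X n = fps_nth (\<sigma> ^ k * p) (n - h n) / (real n ^ k * fps_nth p n)" for n
  define r where "r n = fps_nth p (n - h n) / fps_nth p n" for n
  have r: "0 \<le> r n" "r n \<le> 1" for n
    using p_pos[of n] p_pos[of "n - h n"] p_le[of "n - h n" n] by (auto simp: r_def)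
  have "(\<lambda>n. 1 - real (h n) / real n) \<longlonglongrightarrow> 1 - 0" by (intro tendsto_intros h)
  moreover have "\<forall>\<^sub>F n in sequentially. 1 - real (h n) / real n = real (n - h n) / real n"
    using eventually_gt_at_top[of 0] by eventually_elim (use h in \<open>simp add: of_nat_diff field_simps\<close>)
  ultimately have nh: "(\<lambda>n. real (n - h n) / real n) \<longlonglongrightarrow> 1" by (simp add: Lim_transform_eventually)
  have nhi: "filterlim (\<lambda>n. n - h n) at_top sequentially"
    unfolding filterlim_at_top
  proof
    fix Z :: nat
    show "\<forall>\<^sub>F n in sequentially. Z \<le> n - h n"
      using order_tendstoD(2)[OF h(2), of "1/2", simplified] eventually_ge_at_top[of "2 * Z + 1"]
    proof eventually_elim
      case (elim n)
      hence "2 * real (h n) < real n" by (simp add: field_simps)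
      hence "2 * h n < n" by linarith
      thus ?case using elim by linarith
    qed
  qed
  define Y where "Y n = fps_nth (\<sigma> ^ k * p) (n - h n) / (real (n - h n) ^ k * fps_nth p (n - h n)) * (real (n - h n) / real n) ^ k" for n
  have "Y \<longlonglongrightarrow> 1 * 1 ^ k" unfolding Y_def
    by (intro tendsto_mult tendsto_power nh filterlim_compose[OF power_coeff_limit nhi])
  hence Y1: "(\<lambda>n. Y n - 1) \<longlonglongrightarrow> 0" using tendsto_diff[OF _ tendsto_const, of Y 1 sequentially 1] by simp
  have "(\<lambda>n. r n * (Y n - 1)) \<longlonglongrightarrow> 0"
  proof (rule Lim_null_comparison)
    show "\<forall>\<^sub>F n in sequentially. norm (r n * (Y n - 1)) \<le> \<bar>Y n - 1\<bar>"
      using r by (intro always_eventually allI) (simp add: abs_mult mult_left_le_one_le)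
    show "(\<lambda>n. \<bar>Y n - 1\<bar>) \<longlonglongrightarrow> 0" using Y1 by (rule tendsto_rabs_zero)
  qed
  moreover have "\<forall>\<^sub>F n in sequentially. r n * (Y n - 1) = X n - r n"
    using nhi[THEN filterlim_at_top[THEN iffD1], rule_format, of 1] eventually_gt_at_top[of 0]
  proof eventually_elim
    case (elim n)
    define N where "N = n - h n"
    show ?case using p_pos[of N] p_pos[of n] elim
      unfolding r_def Y_def X_def N_def[symmetric] by (simp add: field_simps power_divide)
  qed
  ultimately have Xr: "(\<lambda>n. X n - r n) \<longlonglongrightarrow> 0" by (rule Lim_transform_eventually)
  have XG: "(\<lambda>n. psum_const k * avg n (shifted_power k (h n)) / real n ^ k - X n) \<longlonglongrightarrow> 0"
  proof (rule tendstoI)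
    fix e :: real assume e: "e > 0"
    define \<epsilon> where "\<epsilon> = e / (2 * (1 / psum_const k + 1))"
    have c: "1 / psum_const k + 1 > 0" using psum_const_pos[of k] by (simp add: add_pos_pos)
    have \<epsilon>: "\<epsilon> > 0" using e c by (simp add: \<epsilon>_def)
    obtain K where K: "\<And>j. \<bar>psum (\<sigma> ^ k) j - psum_const k * real j powr (real k * \<alpha>)\<bar> \<le> \<epsilon> * real j powr (real k * \<alpha>) + K" "K \<ge> 0"
      using psum_power_error[OF k \<epsilon>] by blast
    have "\<forall>\<^sub>F n in sequentially. K / real n ^ k < e / 2"
      by (rule order_tendstoD(2)[OF const_over_power_lim[OF k]]) (use e in auto)
    moreover have "\<forall>\<^sub>F n in sequentially. scaled_moment k n < 1 / psum_const k + 1"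
      by (rule order_tendstoD(2)[OF scaled_moment_limit[OF k]]) simp
    ultimately show "\<forall>\<^sub>F n in sequentially. dist (psum_const k * avg n (shifted_power k (h n)) / real n ^ k - X n) 0 < e"
    proof eventually_elim
      case (elim n)
      define S where "S m = (if h n \<le> m then psum (\<sigma> ^ k) (m - h n) else 0)" for m
      have ES: "avg n S / real n ^ k = X n"
        unfolding S_def avg_psum_shift[OF h(1)] X_def by (simp add: field_simps)
      have "\<bar>avg n S - psum_const k * avg n (shifted_power k (h n))\<bar> = \<bar>avg n (\<lambda>m. S m - psum_const k * shifted_power k (h n) m)\<bar>"
        by (simp add: avg_diff avg_cmult)
      also have "\<dots> \<le> avg n (\<lambda>m. \<epsilon> * real m powr (real k * \<alpha>) + K * 1)"
      proof (rule order_trans[OF avg_abs], rule avg_mono)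
        fix m
        have "real (m - h n) powr (real k * \<alpha>) \<le> real m powr (real k * \<alpha>)"
          using \<alpha> by (intro powr_mono2) auto
        hence "\<epsilon> * real (m - h n) powr (real k * \<alpha>) \<le> \<epsilon> * real m powr (real k * \<alpha>)"
          using \<epsilon> by (intro mult_left_mono) auto
        moreover have "\<epsilon> * real m powr (real k * \<alpha>) \<ge> 0" using \<epsilon> by simp
        ultimately have "\<bar>psum (\<sigma> ^ k) (m - h n) - psum_const k * real (m - h n) powr (real k * \<alpha>)\<bar> \<le> \<epsilon> * real m powr (real k * \<alpha>) + K"
          "0 \<le> \<epsilon> * real m powr (real k * \<alpha>) + K"
          using K(1)[of "m - h n"] K(2) by linarith+
        thus "\<bar>S m - psum_const k * shifted_power k (h n) m\<bar> \<le> \<epsilon> * real m powr (real k * \<alpha>) + K * 1"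
          unfolding S_def shifted_power_def by (cases "h n \<le> m") (simp_all only: if_True if_False mult_1_right mult_zero_right diff_self abs_zero)
      qed
      also have "\<dots> = \<epsilon> * avg n (\<lambda>m. real m powr (real k * \<alpha>)) + K"
        unfolding avg_add avg_cmult avg_one by simp
      finally have "\<bar>avg n S - psum_const k * avg n (shifted_power k (h n))\<bar> / real n ^ k
         \<le> (\<epsilon> * avg n (\<lambda>m. real m powr (real k * \<alpha>)) + K) / real n ^ k"
        by (intro divide_right_mono) auto
      also have "\<dots> = \<epsilon> * scaled_moment k n + K / real n ^ k" by (simp add: scaled_moment_def add_divide_distrib)
      also have "\<dots> < e"
      proof -
        have "\<epsilon> * scaled_moment k n \<le> \<epsilon> * (1 / psum_const k + 1)" using elim \<epsilon> by (intro mult_left_mono) auto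
        also have "e / (2 * B) * B = e / 2" if "B > 0" for B :: real using that by simp
        from this[OF c] have "\<epsilon> * (1 / psum_const k + 1) = e / 2" by (simp only: \<epsilon>_def)
        finally show ?thesis using elim by linarith
      qed
      also have "\<bar>avg n S - psum_const k * avg n (shifted_power k (h n))\<bar> / real n ^ k = \<bar>avg n S / real n ^ k - psum_const k * avg n (shifted_power k (h n)) / real n ^ k\<bar>"
        by (simp add: abs_divide flip: diff_divide_distrib)
      finally show ?case unfolding ES by (simp add: dist_real_def abs_minus_commute)
    qed
  qed
  from tendsto_add[OF XG Xr] show ?thesis by (simp add: r_def)
qed

text \<open>Only moments whose order is a multiple of \<open>\<alpha>\<close> are known, so Chebyshev's inequality is applied to
  \<open>(m \<tau> / (k \<alpha>))\<^sup>\<alpha>\<close> rather than to \<open>m\<close>; the quantity below is the limit of its mean square deviation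
  from 1 under the weight \<open>m\<^sup>k\<^sup>\<alpha>\<close>.\<close>

definition rel_variance :: "nat \<Rightarrow> real" where
  "rel_variance k = Gamma ((real k * \<alpha> + 1) + 2 * \<alpha>) / (Gamma (real k * \<alpha> + 1) * (real k * \<alpha>) powr (2 * \<alpha>))
     - 2 * (Gamma ((real k * \<alpha> + 1) + \<alpha>) / (Gamma (real k * \<alpha> + 1) * (real k * \<alpha>) powr \<alpha>)) + 1"

text \<open>Both Gamma quotients tend to 1 as \<open>k \<alpha>\<close> grows, which leaves
  \<open>1 - 2 + 1\<close>. This is the concentration for large \<open>k\<close>.\<close>

lemma rel_variance_limit: "rel_variance \<longlonglongrightarrow> 0"
proof -
  have f: "filterlim (\<lambda>k. real k * \<alpha> + 1) at_top sequentially" using \<alpha> by real_asymp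
  have G: "(\<lambda>k. Gamma ((real k * \<alpha> + 1) + a) / (Gamma (real k * \<alpha> + 1) * (real k * \<alpha>) powr a)) \<longlonglongrightarrow> 1"
    if a: "a \<ge> 0" for a
  proof -
    have "(\<lambda>k. Gamma ((real k * \<alpha> + 1) + a) / (Gamma (real k * \<alpha> + 1) * (real k * \<alpha> + 1) powr a)
        * ((real k * \<alpha> + 1) powr a / (real k * \<alpha>) powr a)) \<longlonglongrightarrow> 1 * 1"
    proof (rule tendsto_mult)
      show "(\<lambda>k. (real k * \<alpha> + 1) powr a / (real k * \<alpha>) powr a) \<longlonglongrightarrow> 1" using \<alpha> by real_asymp
    qed (rule filterlim_compose[OF Gamma_ratio_limit[OF a] f])
    moreover have "\<forall>\<^sub>F k in sequentially. Gamma ((real k * \<alpha> + 1) + a) / (Gamma (real k * \<alpha> + 1) * (real k * \<alpha> + 1) powr a)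
        * ((real k * \<alpha> + 1) powr a / (real k * \<alpha>) powr a) = Gamma ((real k * \<alpha> + 1) + a) / (Gamma (real k * \<alpha> + 1) * (real k * \<alpha>) powr a)"
    proof (intro always_eventually allI)
      fix k :: nat
      have "real k * \<alpha> + 1 > 0" using \<alpha> by (auto intro: add_nonneg_pos)
      hence "(real k * \<alpha> + 1) powr a \<noteq> 0" by simp
      thus "Gamma ((real k * \<alpha> + 1) + a) / (Gamma (real k * \<alpha> + 1) * (real k * \<alpha> + 1) powr a)
        * ((real k * \<alpha> + 1) powr a / (real k * \<alpha>) powr a) = Gamma ((real k * \<alpha> + 1) + a) / (Gamma (real k * \<alpha> + 1) * (real k * \<alpha>) powr a)"
        by (simp add: divide_simps)
    qed
    ultimately show ?thesis by (simp add: Lim_transform_eventually)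
  qed
  have "rel_variance \<longlonglongrightarrow> 1 - 2 * 1 + 1"
    unfolding rel_variance_def[abs_def] using \<alpha> by (intro tendsto_intros G) auto
  thus ?thesis by simp
qed

text \<open>Two regimes for \<open>Q = (m \<tau> / (k \<alpha>)) powr \<alpha>\<close>. If
  \<open>Q\<close> is within \<open>d\<close> of 1, then \<open>(1 - h / m)^(k \<alpha>)\<close> is
  within \<open>e\<close> of \<open>exp (- u)\<close>. Otherwise the difference is at most 1, hence
  at most \<open>(Q - 1)^2 / d^2\<close>, as in Chebyshev's inequality. \<open>d\<close> and
  \<open>X\<close> must not depend on \<open>k\<close>, which is chosen after them.\<close>

lemma shifted_power_approx:
  assumes u: "u > 0" and e: "e > 0"
  shows "\<exists>d X. 0 < d \<and> 0 < X \<and> (\<forall>k n h m. k > 0 \<longrightarrow> n > 0 \<longrightarrow> real k * \<alpha> \<ge> X \<longrightarrow> \<bar>real h * \<tau> n - u\<bar> \<le> d \<longrightarrow>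
     \<bar>shifted_power k h m - exp (- u) * real m powr (real k * \<alpha>)\<bar> \<le>
       e * real m powr (real k * \<alpha>) + 1 / d\<^sup>2 * (real m powr (real k * \<alpha>) * ((real m * \<tau> n / (real k * \<alpha>)) powr \<alpha> - 1)\<^sup>2))"
proof -
  have \<alpha>0: "\<alpha> > 0" using \<alpha> by simp
  obtain \<delta> X where \<delta>: "\<delta> > 0" "X > 0" and dX: "\<And>x z. x \<ge> X \<Longrightarrow> \<bar>z - u\<bar> \<le> \<delta> \<Longrightarrow> \<bar>max 0 (1 - z / x) powr x - exp (- u)\<bar> \<le> e"
    using exp_power_approx[OF e, of u] by blast
  obtain d where d: "0 < d" "d < 1" "d < u" and
    dv: "\<And>v q. \<bar>v - u\<bar> \<le> d \<Longrightarrow> \<bar>q - 1\<bar> \<le> d \<Longrightarrow> \<bar>v * q powr (- (1 / \<alpha>)) - u\<bar> \<le> \<delta>"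
    using scaled_root_approx[OF \<delta>(1) \<alpha>0 u] by blast
  show ?thesis
  proof (rule exI[of _ d], rule exI[of _ X], intro conjI allI impI)
    fix k n h m :: nat
    assume k: "k > 0" and n: "n > 0" and kX: "real k * \<alpha> \<ge> X" and h: "\<bar>real h * \<tau> n - u\<bar> \<le> d"
    define x where "x = real k * \<alpha>"
    have x: "x > 0" using k \<alpha>0 by (simp add: x_def)
    define Q where "Q = (real m * \<tau> n / x) powr \<alpha>"
    show "\<bar>shifted_power k h m - exp (- u) * real m powr (real k * \<alpha>)\<bar> \<le>
       e * real m powr (real k * \<alpha>) + 1 / d\<^sup>2 * (real m powr (real k * \<alpha>) * ((real m * \<tau> n / (real k * \<alpha>)) powr \<alpha> - 1)\<^sup>2)"
      unfolding x_def[symmetric] Q_def[symmetric]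
    proof (cases "m = 0")
      case True
      thus "\<bar>shifted_power k h m - exp (- u) * real m powr x\<bar> \<le> e * real m powr x + 1 / d\<^sup>2 * (real m powr x * (Q - 1)\<^sup>2)"
        by (simp add: shifted_power_def)
    next
      case False
      hence m: "real m > 0" by simp
      have sh: "shifted_power k h m = real m powr x * max 0 (1 - real h / real m) powr x"
      proof (cases "h \<le> m")
        case True
        have "real (m - h) = real m * (1 - real h / real m)" using True m by (simp add: field_simps of_nat_diff)
        moreover have "1 - real h / real m \<ge> 0" using True m by simp
        ultimately have "real (m - h) powr x = real m powr x * (1 - real h / real m) powr x"
          using m by (simp only: powr_mult)
        thus ?thesis using True \<open>1 - real h / real m \<ge> 0\<close> by (simp add: shifted_power_def x_def[symmetric])
      next
        case f: False
        hence "1 - real h / real m \<le> 0" using m by simp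
        thus ?thesis using f by (simp add: shifted_power_def)
      qed
      have main: "\<bar>max 0 (1 - real h / real m) powr x - exp (- u)\<bar> \<le> e + 1 / d\<^sup>2 * (Q - 1)\<^sup>2"
      proof (cases "\<bar>Q - 1\<bar> \<le> d")
        case True
        have Q: "Q powr (- (1 / \<alpha>)) = x / (real m * \<tau> n)"
          using m x \<tau>_pos[OF n] \<alpha>0 by (simp add: Q_def powr_powr powr_minus field_simps)
        have "\<bar>real h * \<tau> n * (x / (real m * \<tau> n)) - u\<bar> \<le> \<delta>"
          using dv[OF h True] unfolding Q .
        also have "real h * \<tau> n * (x / (real m * \<tau> n)) = real h / real m * x" using \<tau>_pos[OF n] by simp
        finally have "\<bar>max 0 (1 - real h / real m * x / x) powr x - exp (- u)\<bar> \<le> e"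
          by (intro dX) (use kX in \<open>simp_all add: x_def\<close>)
        hence "\<bar>max 0 (1 - real h / real m) powr x - exp (- u)\<bar> \<le> e" using x by simp
        moreover have "1 / d\<^sup>2 * (Q - 1)\<^sup>2 \<ge> 0" by simp
        ultimately show ?thesis by linarith
      next
        case False
        have "max 0 (1 - real h / real m) powr x \<le> 1 powr x"
          using x by (intro powr_mono2) auto
        moreover have "max 0 (1 - real h / real m) powr x \<ge> 0" "exp (- u) \<le> 1" "exp (- u) > 0" using u by simp_all
        ultimately have "\<bar>max 0 (1 - real h / real m) powr x - exp (- u)\<bar> \<le> 1" by (simp only: abs_le_iff powr_one_eq_one) linarith
        moreover have "d\<^sup>2 \<le> (Q - 1)\<^sup>2" using False d by (intro power2_le_iff_abs_le[THEN iffD2, of d "Q - 1"] | simp add: abs_le_square_iff[symmetric])+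
        hence "1 \<le> 1 / d\<^sup>2 * (Q - 1)\<^sup>2" using d by (simp add: field_simps)
        ultimately show ?thesis using e by linarith
      qed
      have "shifted_power k h m - exp (- u) * real m powr x = real m powr x * (max 0 (1 - real h / real m) powr x - exp (- u))"
        unfolding sh by (simp add: right_diff_distrib mult.commute)
      hence "\<bar>shifted_power k h m - exp (- u) * real m powr x\<bar> = real m powr x * \<bar>max 0 (1 - real h / real m) powr x - exp (- u)\<bar>"
        by (simp add: abs_mult)
      also have "\<dots> \<le> real m powr x * (e + 1 / d\<^sup>2 * (Q - 1)\<^sup>2)" by (intro mult_left_mono main) auto
      finally show "\<bar>shifted_power k h m - exp (- u) * real m powr x\<bar> \<le> e * real m powr x + 1 / d\<^sup>2 * (real m powr x * (Q - 1)\<^sup>2)"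
        by (simp add: algebra_simps)
    qed
  qed (use d \<delta> in auto)
qed

text \<open>Expanding the square leaves the moments of orders \<open>k \<alpha>\<close>,
  \<open>(k + 1) \<alpha>\<close> and \<open>(k + 2) \<alpha>\<close>. The identity
  \<open>\<tau> n powr \<alpha> = D / n\<close> cancels the powers of \<open>n\<close>, and
  quotients of \<open>psum_const\<close> yield the Gamma quotients.\<close>

lemma variance_limit:
  assumes k: "k > 0"
  shows "(\<lambda>n. psum_const k * avg n (\<lambda>m. real m powr (real k * \<alpha>) * ((real m * \<tau> n / (real k * \<alpha>)) powr \<alpha> - 1)\<^sup>2) / real n ^ k) \<longlonglongrightarrow> rel_variance k"
proof -
  define x where "x = real k * \<alpha>"
  have x: "x > 0" using k \<alpha> by (simp add: x_def)
  have g: "Gamma (real j * \<alpha> + 1) > 0" for j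
    using \<alpha> by (intro Gamma_real_pos) (auto intro: add_nonneg_pos)
  have "(\<lambda>n. psum_const k * ((D / x powr \<alpha>)\<^sup>2 * scaled_moment (k + 2) n - 2 * (D / x powr \<alpha>) * scaled_moment (k + 1) n + scaled_moment k n))
    \<longlonglongrightarrow> psum_const k * ((D / x powr \<alpha>)\<^sup>2 * (1 / psum_const (k + 2)) - 2 * (D / x powr \<alpha>) * (1 / psum_const (k + 1)) + 1 / psum_const k)"
    using k by (intro tendsto_intros scaled_moment_limit) auto
  also have "psum_const k * ((D / x powr \<alpha>)\<^sup>2 * (1 / psum_const (k + 2)) - 2 * (D / x powr \<alpha>) * (1 / psum_const (k + 1)) + 1 / psum_const k) = rel_variance k"
  proof -
    have s2: "real (k + 2) * \<alpha> + 1 = (real k * \<alpha> + 1) + 2 * \<alpha>" and s1: "real (k + 1) * \<alpha> + 1 = (real k * \<alpha> + 1) + \<alpha>"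
      by (simp_all add: algebra_simps)
    have "psum_const k * (1 / psum_const (k + 2)) * D\<^sup>2 = Gamma ((real k * \<alpha> + 1) + 2 * \<alpha>) / Gamma (real k * \<alpha> + 1)"
      using D unfolding psum_const_def s2 by (simp add: power_add power2_eq_square)
    moreover have "psum_const k * (1 / psum_const (k + 1)) * D = Gamma ((real k * \<alpha> + 1) + \<alpha>) / Gamma (real k * \<alpha> + 1)"
      using D unfolding psum_const_def s1 by simp
    moreover have "(x powr \<alpha>)\<^sup>2 = x powr (2 * \<alpha>)" by (simp add: power2_eq_square powr_add[symmetric])
    moreover have "psum_const k * ((D / x powr \<alpha>)\<^sup>2 * (1 / psum_const (k + 2)) - 2 * (D / x powr \<alpha>) * (1 / psum_const (k + 1)) + 1 / psum_const k)
      = psum_const k * (1 / psum_const (k + 2)) * D\<^sup>2 / (x powr \<alpha>)\<^sup>2 - 2 * (psum_const k * (1 / psum_const (k + 1)) * D / x powr \<alpha>) + 1"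
      using psum_const_pos[of k] by (simp add: algebra_simps power_divide)
    ultimately show ?thesis unfolding rel_variance_def x_def[symmetric] by simp
  qed
  finally have L: "(\<lambda>n. psum_const k * ((D / x powr \<alpha>)\<^sup>2 * scaled_moment (k + 2) n - 2 * (D / x powr \<alpha>) * scaled_moment (k + 1) n + scaled_moment k n)) \<longlonglongrightarrow> rel_variance k" .
  have "\<forall>\<^sub>F n in sequentially. psum_const k * ((D / x powr \<alpha>)\<^sup>2 * scaled_moment (k + 2) n - 2 * (D / x powr \<alpha>) * scaled_moment (k + 1) n + scaled_moment k n)
     = psum_const k * avg n (\<lambda>m. real m powr (real k * \<alpha>) * ((real m * \<tau> n / (real k * \<alpha>)) powr \<alpha> - 1)\<^sup>2) / real n ^ k"
    using eventually_gt_at_top[of 0]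
  proof eventually_elim
    case (elim n)
    define s where "s = D / (real n * x powr \<alpha>)"
    have pt: "real m powr (real k * \<alpha>) * ((real m * \<tau> n / x) powr \<alpha> - 1)\<^sup>2
       = s\<^sup>2 * real m powr (real (k + 2) * \<alpha>) - 2 * s * real m powr (real (k + 1) * \<alpha>) + real m powr (real k * \<alpha>)" for m
    proof -
      have "(real m * \<tau> n / x) powr \<alpha> = real m powr \<alpha> * s"
        using \<tau>_pos[OF elim] x by (simp add: powr_mult powr_divide \<tau>_powr[OF elim] s_def)
      moreover have "real m powr (real (k + 2) * \<alpha>) = real m powr (real k * \<alpha>) * (real m powr \<alpha>)\<^sup>2"
        by (simp add: power2_eq_square powr_add[symmetric] algebra_simps)
      moreover have "real m powr (real (k + 1) * \<alpha>) = real m powr (real k * \<alpha>) * real m powr \<alpha>"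
        by (simp add: powr_add[symmetric] algebra_simps)
      ultimately show ?thesis by (simp only:) (simp add: power2_eq_square algebra_simps)
    qed
    have E: "avg n (\<lambda>m. real m powr (real k * \<alpha>) * ((real m * \<tau> n / x) powr \<alpha> - 1)\<^sup>2)
      = s\<^sup>2 * (real n ^ (k + 2) * scaled_moment (k + 2) n) - 2 * s * (real n ^ (k + 1) * scaled_moment (k + 1) n) + real n ^ k * scaled_moment k n"
      unfolding pt avg_add avg_diff avg_cmult using elim by (simp add: scaled_moment_def)
    show ?case unfolding E[unfolded x_def] using elim x[unfolded x_def] unfolding s_def x_def
      by (simp add: field_simps power2_eq_square)
  qed
  from Lim_transform_eventually[OF L this] show ?thesis .
qed

theorem ratio_limit:
  assumes u: "u > 0"
  shows "(\<lambda>n. fps_nth p (n - nat \<lfloor>u / \<tau> n\<rfloor>) / fps_nth p n) \<longlonglongrightarrow> exp (- u)"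
proof (rule tendstoI)
  fix \<epsilon> :: real assume \<epsilon>: "\<epsilon> > 0"
  \<comment> \<open>\<open>shift_limit\<close> asks for \<open>h n \<le> n\<close> at every
    \<open>n\<close>. The minimum is eventually the floor, because \<open>n \<tau> n\<close> tends
    to infinity, and truncated subtraction makes it invisible in the conclusion.\<close>
  define h where "h n = min n (nat \<lfloor>u / \<tau> n\<rfloor>)" for n
  have hn: "h n \<le> n" for n by (simp add: h_def)
  have h\<tau>: "\<forall>\<^sub>F n in sequentially. u - \<tau> n \<le> real (h n) * \<tau> n \<and> real (h n) * \<tau> n \<le> u"
    using eventually_gt_at_top[of 0] n\<tau>_lim[THEN filterlim_at_top[THEN iffD1], rule_format, of u]
  proof eventually_elim
    case (elim n)
    note t = \<tau>_pos[OF elim(1)]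
    have "u / \<tau> n \<le> real n" using elim t by (simp add: field_simps)
    hence "nat \<lfloor>u / \<tau> n\<rfloor> \<le> n" by linarith
    hence "real (h n) = of_int \<lfloor>u / \<tau> n\<rfloor>" using u t by (simp add: h_def)
    hence "u / \<tau> n - 1 \<le> real (h n)" "real (h n) \<le> u / \<tau> n" by linarith+
    thus ?case using t by (simp add: field_simps)
  qed
  have \<tau>0: "\<tau> \<longlonglongrightarrow> 0" using \<tau>_lim by (simp add: filterlim_at)
  have "(\<lambda>n. real (h n) * \<tau> n) \<longlonglongrightarrow> u"
  proof (rule tendsto_sandwich[OF _ _ _ tendsto_const])
    show "(\<lambda>n. u - \<tau> n) \<longlonglongrightarrow> u" using tendsto_diff[OF tendsto_const \<tau>0, of u] by simp
  qed (use h\<tau> in \<open>auto elim: eventually_mono\<close>)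
  note hlim = this
  have "(\<lambda>n. real (h n) * \<tau> n * (1 / (real n * \<tau> n))) \<longlonglongrightarrow> u * 0"
    by (intro tendsto_mult hlim tendsto_divide_0[OF tendsto_const filterlim_at_top_imp_at_infinity[OF n\<tau>_lim]])
  moreover have "\<forall>\<^sub>F n in sequentially. real (h n) * \<tau> n * (1 / (real n * \<tau> n)) = real (h n) / real n"
    using eventually_gt_at_top[of 0] by eventually_elim (simp add: less_imp_neq[OF \<tau>_pos, symmetric])
  ultimately have h0: "(\<lambda>n. real (h n) / real n) \<longlonglongrightarrow> 0" by (simp add: Lim_transform_eventually)
  define r where "r n = fps_nth p (n - h n) / fps_nth p n" for n
  \<comment> \<open>Order of choices: \<open>d\<close> and \<open>X\<close> depend on
    \<open>\<epsilon>\<close> and \<open>u\<close> only, then one \<open>k\<close> with small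
    variance is fixed, and only then \<open>n\<close> grows.\<close>
  obtain d X where d: "0 < d" "0 < X" and dX: "\<And>k n h m. k > 0 \<Longrightarrow> n > 0 \<Longrightarrow> real k * \<alpha> \<ge> X \<Longrightarrow> \<bar>real h * \<tau> n - u\<bar> \<le> d \<Longrightarrow>
     \<bar>shifted_power k h m - exp (- u) * real m powr (real k * \<alpha>)\<bar> \<le>
       \<epsilon> / 8 * real m powr (real k * \<alpha>) + 1 / d\<^sup>2 * (real m powr (real k * \<alpha>) * ((real m * \<tau> n / (real k * \<alpha>)) powr \<alpha> - 1)\<^sup>2)"
    using shifted_power_approx[OF u, of "\<epsilon> / 8"] \<epsilon> by auto
  have "\<forall>\<^sub>F k in sequentially. rel_variance k < d\<^sup>2 * \<epsilon> / 8"
    by (rule order_tendstoD(2)[OF rel_variance_limit]) (use d \<epsilon> in auto)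
  moreover have "\<forall>\<^sub>F k in sequentially. real k * \<alpha> \<ge> X"
    using \<alpha> by real_asymp
  ultimately have "\<forall>\<^sub>F k in sequentially. rel_variance k < d\<^sup>2 * \<epsilon> / 8 \<and> real k * \<alpha> \<ge> X \<and> k > 0"
    using eventually_gt_at_top[of 0] by eventually_elim simp
  then obtain k where k: "rel_variance k < d\<^sup>2 * \<epsilon> / 8" "real k * \<alpha> \<ge> X" "k > 0"
    using eventually_happens'[OF sequentially_bot] by blast
  define V where "V n = psum_const k * avg n (\<lambda>m. real m powr (real k * \<alpha>) * ((real m * \<tau> n / (real k * \<alpha>)) powr \<alpha> - 1)\<^sup>2) / real n ^ k" for n
  have "\<forall>\<^sub>F n in sequentially. V n < d\<^sup>2 * \<epsilon> / 8"
    unfolding V_def by (rule order_tendstoD(2)[OF variance_limit[OF k(3)] k(1)])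
  moreover have "\<forall>\<^sub>F n in sequentially. \<bar>psum_const k * scaled_moment k n - 1\<bar> < min 1 (\<epsilon> / 8)"
  proof -
    have "(\<lambda>n. psum_const k * scaled_moment k n) \<longlonglongrightarrow> psum_const k * (1 / psum_const k)" by (intro tendsto_intros scaled_moment_limit k)
    hence "(\<lambda>n. psum_const k * scaled_moment k n) \<longlonglongrightarrow> 1" using psum_const_pos[of k] by simp
    from tendstoD[OF this, of "min 1 (\<epsilon> / 8)"] show ?thesis using \<epsilon> by (simp add: dist_real_def)
  qed
  moreover have "\<forall>\<^sub>F n in sequentially. \<bar>psum_const k * avg n (shifted_power k (h n)) / real n ^ k - r n\<bar> < \<epsilon> / 8"
    using tendstoD[OF shift_limit[OF k(3) hn h0], of "\<epsilon> / 8"] \<epsilon> by (simp add: dist_real_def r_def)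
  moreover have "\<forall>\<^sub>F n in sequentially. \<bar>real (h n) * \<tau> n - u\<bar> < d"
    using tendstoD[OF hlim d(1)] by (simp add: dist_real_def)
  ultimately show "\<forall>\<^sub>F n in sequentially. dist (fps_nth p (n - nat \<lfloor>u / \<tau> n\<rfloor>) / fps_nth p n) (exp (- u)) < \<epsilon>"
    using eventually_gt_at_top[of 0]
  proof eventually_elim
    case (elim n)
    let ?M = "\<lambda>m. real m powr (real k * \<alpha>)"
    let ?W = "\<lambda>m. ?M m * ((real m * \<tau> n / (real k * \<alpha>)) powr \<alpha> - 1)\<^sup>2"
    have "\<bar>avg n (shifted_power k (h n)) - exp (- u) * avg n ?M\<bar> = \<bar>avg n (\<lambda>m. shifted_power k (h n) m - exp (- u) * ?M m)\<bar>"
      by (simp add: avg_diff avg_cmult)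
    also have "\<dots> \<le> avg n (\<lambda>m. \<epsilon> / 8 * ?M m + 1 / d\<^sup>2 * ?W m)"
      by (rule order_trans[OF avg_abs], rule avg_mono, rule dX) (use k elim in auto)
    also have "\<dots> = \<epsilon> / 8 * avg n ?M + 1 / d\<^sup>2 * avg n ?W"
      unfolding avg_add avg_cmult ..
    finally have "psum_const k / real n ^ k * \<bar>avg n (shifted_power k (h n)) - exp (- u) * avg n ?M\<bar> \<le>
       psum_const k / real n ^ k * (\<epsilon> / 8 * avg n ?M + 1 / d\<^sup>2 * avg n ?W)"
      using psum_const_pos[of k] by (intro mult_left_mono) auto
    also have "\<dots> = \<epsilon> / 8 * (psum_const k * scaled_moment k n) + V n / d\<^sup>2" by (simp add: scaled_moment_def V_def distrib_left mult_ac)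
    also have "V n / d\<^sup>2 < \<epsilon> / 8" using elim d by (simp add: field_simps)
    also have "\<epsilon> / 8 * (psum_const k * scaled_moment k n) \<le> \<epsilon> / 8 * 2" using elim \<epsilon> by (intro mult_left_mono) linarith+
    finally have "psum_const k / real n ^ k * \<bar>avg n (shifted_power k (h n)) - exp (- u) * avg n ?M\<bar> < 3 * \<epsilon> / 8" by linarith
    also have "psum_const k / real n ^ k * \<bar>avg n (shifted_power k (h n)) - exp (- u) * avg n ?M\<bar> =
        \<bar>psum_const k / real n ^ k * (avg n (shifted_power k (h n)) - exp (- u) * avg n ?M)\<bar>"
      using psum_const_pos[of k] by (simp add: abs_mult)
    also have "psum_const k / real n ^ k * (avg n (shifted_power k (h n)) - exp (- u) * avg n ?M) =
       psum_const k * avg n (shifted_power k (h n)) / real n ^ k - exp (- u) * (psum_const k * scaled_moment k n)"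
      by (simp add: scaled_moment_def algebra_simps)
    finally have 1: "\<bar>psum_const k * avg n (shifted_power k (h n)) / real n ^ k - exp (- u) * (psum_const k * scaled_moment k n)\<bar> < 3 * \<epsilon> / 8" .
    have "exp (- u) * (psum_const k * scaled_moment k n) - exp (- u) = exp (- u) * (psum_const k * scaled_moment k n - 1)"
      by (simp add: right_diff_distrib)
    hence "\<bar>exp (- u) * (psum_const k * scaled_moment k n) - exp (- u)\<bar> = exp (- u) * \<bar>psum_const k * scaled_moment k n - 1\<bar>"
      by (simp add: abs_mult)
    also have "\<dots> \<le> 1 * \<bar>psum_const k * scaled_moment k n - 1\<bar>" using u by (intro mult_right_mono) auto
    finally have 2: "\<bar>exp (- u) * (psum_const k * scaled_moment k n) - exp (- u)\<bar> < \<epsilon> / 8" using elim by simp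
    have "\<bar>r n - exp (- u)\<bar> < \<epsilon>" using 1 2 elim \<epsilon> by linarith
    moreover have "n - nat \<lfloor>u / \<tau> n\<rfloor> = n - h n" by (simp add: h_def)
    ultimately show ?case by (simp add: r_def dist_real_def)
  qed
qed

text \<open>Monotone functions converging pointwise to a continuous limit converge uniformly on
  bounded intervals. The grid has mesh \<open>\<eta> = e / 2\<close>: the ratio is squeezed between
  its values at two neighbouring grid points, where it is within \<open>\<eta>\<close> of the
  exponential, and the exponential drops by at most \<open>\<eta>\<close> in between.\<close>

lemma ratio_uniform:
  assumes B: "B > 0" and e: "e > 0"
  shows "\<forall>\<^sub>F n in sequentially. \<forall>m. real m * \<tau> n \<le> B \<longrightarrow>
           \<bar>fps_nth p (n - m) / fps_nth p n - exp (- (real m * \<tau> n))\<bar> \<le> e"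
proof -
  define r where "r m n = fps_nth p (n - m) / fps_nth p n" for m n
  define \<eta> where "\<eta> = e / 2"
  have \<eta>: "\<eta> > 0" using e by (simp add: \<eta>_def)
  define J where "J = nat \<lceil>B / \<eta>\<rceil>"
  have lim: "(\<lambda>n. r (nat \<lfloor>(real i * \<eta>) / \<tau> n\<rfloor>) n) \<longlonglongrightarrow> exp (- (real i * \<eta>))" for i
  proof (cases "i = 0")
    case True
    have "fps_nth p n \<noteq> 0" for n using p_pos[of n] by simp
    thus ?thesis using True by (simp add: r_def)
  next
    case False
    thus ?thesis unfolding r_def using \<eta> by (intro ratio_limit) simp
  qed
  have "\<forall>\<^sub>F n in sequentially. \<forall>i\<in>{..Suc J}. \<bar>r (nat \<lfloor>(real i * \<eta>) / \<tau> n\<rfloor>) n - exp (- (real i * \<eta>))\<bar> < \<eta>"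
    by (rule eventually_ball_finite) (use tendstoD[OF lim \<eta>] in \<open>auto simp: dist_real_def\<close>)
  thus ?thesis using eventually_gt_at_top[of 0]
  proof eventually_elim
    case (elim n)
    note t = \<tau>_pos[OF elim(2)]
    show ?case
    proof (intro allI impI)
      fix m assume m: "real m * \<tau> n \<le> B"
      define i where "i = nat \<lfloor>real m * \<tau> n / \<eta>\<rfloor>"
      have i1: "real i \<le> real m * \<tau> n / \<eta>" "real m * \<tau> n / \<eta> < real i + 1"
        unfolding i_def using t \<eta> by simp_all
      have "real i \<le> B / \<eta>" using i1(1) divide_right_mono[OF m, of \<eta>] \<eta> by linarith
      hence iJ: "i \<le> J" unfolding J_def by linarith
      have lo: "real i * \<eta> \<le> real m * \<tau> n" and hi: "real m * \<tau> n < real (Suc i) * \<eta>"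
        using i1 \<eta> by (simp_all add: field_simps)
      have h1: "nat \<lfloor>(real i * \<eta>) / \<tau> n\<rfloor> \<le> m"
      proof -
        have "(real i * \<eta>) / \<tau> n \<le> real m" using lo t by (simp add: field_simps)
        thus ?thesis by linarith
      qed
      have h2: "m \<le> nat \<lfloor>(real (Suc i) * \<eta>) / \<tau> n\<rfloor>"
      proof -
        have "real m \<le> (real (Suc i) * \<eta>) / \<tau> n" using hi t by (simp add: field_simps)
        thus ?thesis by linarith
      qed
      have mono: "r b n \<le> r a n" if "a \<le> b" for a b
        unfolding r_def using that p_pos[of n] by (intro divide_right_mono p_le) auto
      have "r m n \<le> r (nat \<lfloor>(real i * \<eta>) / \<tau> n\<rfloor>) n" by (rule mono[OF h1])
      also have "\<dots> \<le> exp (- (real i * \<eta>)) + \<eta>" using elim(1)[rule_format, of i] iJ by (simp add: abs_less_iff)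
      finally have up: "r m n \<le> exp (- (real i * \<eta>)) + \<eta>" .
      have "exp (- (real (Suc i) * \<eta>)) - \<eta> \<le> r (nat \<lfloor>(real (Suc i) * \<eta>) / \<tau> n\<rfloor>) n"
        using elim(1)[rule_format, of "Suc i"] iJ by (simp add: abs_less_iff)
      also have "\<dots> \<le> r m n" by (rule mono[OF h2])
      finally have low: "exp (- (real (Suc i) * \<eta>)) - \<eta> \<le> r m n" .
      have ed: "exp (- (real i * \<eta>)) \<le> exp (- (real (Suc i) * \<eta>)) + \<eta>"
      proof -
        have "1 - exp (- \<eta>) \<le> \<eta>" using exp_ge_add_one_self[of "-\<eta>"] by simp
        hence "exp (- (real i * \<eta>)) * (1 - exp (- \<eta>)) \<le> 1 * \<eta>"
          using \<eta> by (intro mult_mono) auto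
        moreover have "exp (- (real (Suc i) * \<eta>)) = exp (- (real i * \<eta>)) * exp (- \<eta>)"
          by (simp add: exp_add[symmetric] algebra_simps)
        ultimately show ?thesis by (simp add: algebra_simps)
      qed
      have "exp (- (real m * \<tau> n)) \<le> exp (- (real i * \<eta>))" "exp (- (real (Suc i) * \<eta>)) \<le> exp (- (real m * \<tau> n))"
        using lo hi by simp_all
      hence "\<bar>r m n - exp (- (real m * \<tau> n))\<bar> \<le> 2 * \<eta>" using up low ed by linarith
      thus "\<bar>fps_nth p (n - m) / fps_nth p n - exp (- (real m * \<tau> n))\<bar> \<le> e"
        by (simp add: r_def \<eta>_def)
    qed
  qed
qed

text \<open>Dominated convergence for the ratios \<open>p(n - m) / p(n)\<close> against the
  coefficients of \<open>g\<close>. Up to \<open>m \<tau> \<le> B\<close> the ratios are uniformly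
  close to \<open>exp (- (m \<tau>))\<close>. Beyond \<open>B\<close>, half of the decay rate gives
  the small factor \<open>exp (- (\<delta> B / 2))\<close> and the other half
  \<open>lap g (\<delta> \<tau> / 2)\<close>; the doubling condition serves to compare the latter
  with \<open>lap g \<tau>\<close>.\<close>

theorem coeff_transfer:
  fixes g :: "real fps"
  assumes g: "lap_conv (fps_nth g)"
    and pos: "\<forall>\<^sub>F t in at_right 0. lap (fps_nth g) t > 0"
    and dbl: "\<And>d. 0 < d \<Longrightarrow> d < 1 \<Longrightarrow> \<exists>K. \<forall>\<^sub>F t in at_right 0. lap (fps_nth g) (d * t) \<le> K * lap (fps_nth g) t"
  shows "(\<lambda>n. fps_nth (g * p) n / (fps_nth p n * lap (fps_nth g) (\<tau> n))) \<longlonglongrightarrow> 1"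
proof (rule tendstoI)
  fix \<epsilon> :: real assume \<epsilon>: "\<epsilon> > 0"
  define G where "G = lap (fps_nth g)"
  note gn = lap_convD(1)[OF g]
  obtain C \<delta> where C: "C > 0" "0 < \<delta>" "\<delta> \<le> 1" and dec: "\<forall>\<^sub>F n in sequentially. \<forall>m\<le>n.
     fps_nth p (n - m) \<le> C * exp (- (\<delta> * (real m * \<tau> n))) * fps_nth p n"
    using decay by blast
  obtain K where K: "\<forall>\<^sub>F t in at_right 0. G (\<delta> / 2 * t) \<le> K * G t"
    using dbl[of "\<delta> / 2"] C unfolding G_def by auto
  have K': "\<forall>\<^sub>F t in at_right 0. G (\<delta> / 2 * t) \<le> \<bar>K\<bar> * G t"
    using K pos
  proof eventually_elim
    case (elim t)
    have "K * G t \<le> \<bar>K\<bar> * G t" using elim by (intro mult_right_mono) (auto simp: G_def)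
    thus ?case using elim by linarith
  qed
  have "((\<lambda>B. (C + 1) * exp (- (\<delta> / 2 * B)) * \<bar>K\<bar>) \<longlongrightarrow> 0) at_top"
    using C by real_asymp
  from order_tendstoD(2)[OF this, of "\<epsilon> / 2"] have "\<forall>\<^sub>F B in at_top. (C + 1) * exp (- (\<delta> / 2 * B)) * \<bar>K\<bar> < \<epsilon> / 2"
    using \<epsilon> by simp
  from eventually_conj[OF this eventually_gt_at_top[of 0]]
  obtain B where B: "B > 0" "(C + 1) * exp (- (\<delta> / 2 * B)) * \<bar>K\<bar> < \<epsilon> / 2"
    using eventually_happens'[OF trivial_limit_at_top_linorder] by blast
  \<comment> \<open>For \<open>m t \<le> B\<close> the uniform error \<open>e\<close> is at most
    \<open>e * exp B * exp (- (m t))\<close>, which sums to \<open>\<epsilon> / 4\<close> times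
    \<open>lap g t\<close>.\<close>
  define e where "e = \<epsilon> / 4 * exp (- B)"
  have e: "e > 0" using \<epsilon> by (simp add: e_def)
  show "\<forall>\<^sub>F n in sequentially. dist (fps_nth (g * p) n / (fps_nth p n * lap (fps_nth g) (\<tau> n))) 1 < \<epsilon>"
    using ratio_uniform[OF B(1) e] dec eventually_compose_filterlim[OF K' \<tau>_lim]
      eventually_compose_filterlim[OF pos \<tau>_lim] eventually_gt_at_top[of 0]
      filterlim_at_top_dense[THEN iffD1, OF n\<tau>_lim, rule_format, of B]
  proof eventually_elim
    case (elim n)
    define t where "t = \<tau> n"
    have t: "t > 0" using \<tau>_pos elim by (simp add: t_def)
    have G: "G t > 0" using elim by (simp add: G_def t_def)
    define r where "r m = (if m \<le> n then fps_nth p (n - m) / fps_nth p n else 0)" for m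
    have dt: "\<delta> / 2 * t > 0" using C t by simp
    have gp: "fps_nth (g * p) n / fps_nth p n = (\<Sum>m. fps_nth g m * r m)"
    proof -
      have "(\<Sum>m. fps_nth g m * r m) = (\<Sum>m\<le>n. fps_nth g m * r m)"
        by (rule suminf_finite) (auto simp: r_def)
      also have "\<dots> = (\<Sum>m\<le>n. fps_nth g m * fps_nth p (n - m) / fps_nth p n)"
        by (intro sum.cong) (auto simp: r_def)
      finally show ?thesis by (simp add: fps_mult_nth atLeast0AtMost sum_divide_distrib)
    qed
    have bd: "\<bar>r m - exp (- (real m * t))\<bar> \<le> e * exp B * exp (- (real m * t)) + (C + 1) * exp (- (\<delta> / 2 * B)) * exp (- (real m * (\<delta> / 2 * t)))" (is "_ \<le> ?a + ?b") for m
    proof (cases "real m * t \<le> B")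
      case True
      hence "real m * t < real n * t" using elim by (simp add: t_def)
      hence mn: "m \<le> n" using t by simp
      have "\<bar>r m - exp (- (real m * t))\<bar> \<le> e" using elim(1) True mn by (simp add: r_def t_def)
      also have "e * exp (real m * t) \<le> e * exp B" using True e by simp
      hence "e \<le> ?a" by (simp add: exp_minus field_simps)
      also have "0 \<le> ?b" using C by simp
      hence "?a \<le> ?a + ?b" by linarith
      finally show ?thesis .
    next
      case False
      have x: "\<delta> * (real m * t) \<le> real m * t" using C t by (intro mult_left_le_one_le) auto
      have "0 \<le> r m" using p_pos[of n] p_pos[of "n - m"] by (simp add: r_def)
      moreover have "r m \<le> C * exp (- (\<delta> * (real m * t)))"
      proof (cases "m \<le> n")
        case True
        have "fps_nth p (n - m) \<le> C * exp (- (\<delta> * (real m * t))) * fps_nth p n"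
          using elim(2) True by (simp add: t_def)
        thus ?thesis using p_pos[of n] True by (simp add: r_def divide_le_eq)
      qed (use C in \<open>simp add: r_def\<close>)
      moreover have "exp (- (real m * t)) \<le> exp (- (\<delta> * (real m * t)))" using x by simp
      moreover have "exp (- (real m * t)) > 0" by simp
      moreover have "(C + 1) * exp (- (\<delta> * (real m * t))) = C * exp (- (\<delta> * (real m * t))) + exp (- (\<delta> * (real m * t)))"
        by (simp add: algebra_simps)
      ultimately have "\<bar>r m - exp (- (real m * t))\<bar> \<le> (C + 1) * exp (- (\<delta> * (real m * t)))"
        by linarith
      also have "\<dots> = (C + 1) * (exp (- (\<delta> / 2 * (real m * t))) * exp (- (real m * (\<delta> / 2 * t))))"
        by (simp add: exp_add[symmetric] algebra_simps)
      also have "\<dots> \<le> (C + 1) * (exp (- (\<delta> / 2 * B)) * exp (- (real m * (\<delta> / 2 * t))))"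
        using False C by (intro mult_left_mono mult_right_mono) auto
      also have "\<dots> = ?b" by simp
      also have "0 \<le> ?a" using e by simp
      hence "?b \<le> ?a + ?b" by linarith
      finally show ?thesis .
    qed
    have s1: "summable (\<lambda>m. fps_nth g m * exp (- (real m * t)))" by (rule lap_convD(2)[OF g t])
    have s2: "summable (\<lambda>m. fps_nth g m * exp (- (real m * (\<delta> / 2 * t))))" by (rule lap_convD(2)[OF g dt])
    have sr: "summable (\<lambda>m. fps_nth g m * r m)"
      by (rule summable_finite[of "{..n}"]) (auto simp: r_def)
    have d0: "fps_nth (g * p) n / fps_nth p n - G t = (\<Sum>m. fps_nth g m * (r m - exp (- (real m * t))))"
      unfolding gp G_def lap_def using suminf_diff[OF sr s1] by (simp add: right_diff_distrib)
    have "\<bar>fps_nth (g * p) n / fps_nth p n - G t\<bar> \<le> (\<Sum>m. e * exp B * (fps_nth g m * exp (- (real m * t)))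
         + (C + 1) * exp (- (\<delta> / 2 * B)) * (fps_nth g m * exp (- (real m * (\<delta> / 2 * t)))))"
      unfolding d0
    proof (rule order_trans[OF summable_rabs suminf_le])
      have le: "\<bar>fps_nth g m * (r m - exp (- (real m * t)))\<bar> \<le> e * exp B * (fps_nth g m * exp (- (real m * t)))
         + (C + 1) * exp (- (\<delta> / 2 * B)) * (fps_nth g m * exp (- (real m * (\<delta> / 2 * t))))" for m
        using mult_left_mono[OF bd[of m] gn[of m]] gn[of m] by (simp add: abs_mult distrib_left mult_ac)
      show sb: "summable (\<lambda>m. e * exp B * (fps_nth g m * exp (- (real m * t)))
         + (C + 1) * exp (- (\<delta> / 2 * B)) * (fps_nth g m * exp (- (real m * (\<delta> / 2 * t)))))"
        by (intro summable_add summable_mult s1 s2)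
      show sa: "summable (\<lambda>m. \<bar>fps_nth g m * (r m - exp (- (real m * t)))\<bar>)"
        by (rule summable_comparison_test'[OF sb]) (use le in auto)
      thus "summable (\<lambda>m. \<bar>fps_nth g m * (r m - exp (- (real m * t)))\<bar>)" .
      show "\<bar>fps_nth g m * (r m - exp (- (real m * t)))\<bar> \<le> e * exp B * (fps_nth g m * exp (- (real m * t)))
         + (C + 1) * exp (- (\<delta> / 2 * B)) * (fps_nth g m * exp (- (real m * (\<delta> / 2 * t))))" for m by (rule le)
    qed
    also have "\<dots> = e * exp B * G t + (C + 1) * exp (- (\<delta> / 2 * B)) * G (\<delta> / 2 * t)"
      unfolding G_def lap_def
      by (simp only: suminf_add[OF summable_mult[OF s1] summable_mult[OF s2], symmetric] suminf_mult[OF s1] suminf_mult[OF s2])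
    finally have d1: "\<bar>fps_nth (g * p) n / fps_nth p n - G t\<bar> \<le> e * exp B * G t + (C + 1) * exp (- (\<delta> / 2 * B)) * G (\<delta> / 2 * t)" .
    have "e * exp B = \<epsilon> / 4" by (simp add: e_def mult.assoc exp_add[symmetric])
    note d1 = d1[unfolded this]
    have "(C + 1) * exp (- (\<delta> / 2 * B)) * G (\<delta> / 2 * t) \<le> (C + 1) * exp (- (\<delta> / 2 * B)) * (\<bar>K\<bar> * G t)"
      using elim C by (intro mult_left_mono) (auto simp: t_def)
    also have "\<dots> = ((C + 1) * exp (- (\<delta> / 2 * B)) * \<bar>K\<bar>) * G t" by simp
    also have "\<dots> \<le> \<epsilon> / 2 * G t" using B G by (intro mult_right_mono) auto
    finally have "\<bar>fps_nth (g * p) n / fps_nth p n - G t\<bar> \<le> 3 / 4 * \<epsilon> * G t" using d1 by simp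
    hence "\<bar>fps_nth (g * p) n / fps_nth p n - G t\<bar> / G t \<le> 3 / 4 * \<epsilon>" using G by (simp add: field_simps)
    also have "\<bar>fps_nth (g * p) n / fps_nth p n - G t\<bar> / G t = \<bar>(fps_nth (g * p) n / fps_nth p n - G t) / G t\<bar>"
      using G by (simp add: abs_divide)
    also have "(fps_nth (g * p) n / fps_nth p n - G t) / G t = fps_nth (g * p) n / (fps_nth p n * G t) - 1"
      using G by (simp add: field_simps)
    finally show ?case using \<epsilon> by (simp add: dist_real_def G_def t_def)
  qed
qed

end

section \<open>Partitions with parts from a sequence\<close>

lemma sum_mset_eq_sum_count:
  fixes c :: "'a \<Rightarrow> real"
  assumes "finite A" "set_mset M \<subseteq> A"
  shows "(\<Sum>i\<in>#M. c i) = (\<Sum>i\<in>A. real (count M i) * c i)"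
  using assms(2)
proof (induction M)
  case (add x M)
  have "(\<Sum>i\<in>A. real (count (add_mset x M) i) * c i) = (\<Sum>i\<in>A. real (count M i) * c i + (if i = x then c i else 0))"
    by (intro sum.cong refl) (simp add: algebra_simps)
  also have "\<dots> = (\<Sum>i\<in>A. real (count M i) * c i) + c x"
    using assms(1) add.prems by (simp add: sum.distrib)
  finally show ?case using add by simp
qed simp

section \<open>Partitions as multisets of positions and the removal of copies\<close>

locale part_seq =
  fixes L :: "nat \<Rightarrow> nat"
  assumes L_pos: "L i > 0"
    and L_finite: "finite {i. L i \<le> n}"
    and L_one: "\<exists>i. L i = 1"
begin

definition parts :: "nat \<Rightarrow> nat multiset set" where
  "parts n = {M. (\<Sum>i\<in>#M. L i) = n}"

lemma size_le_weight: "size M \<le> (\<Sum>i\<in>#M. L i)"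
proof (induction M)
  case (add x M)
  thus ?case using L_pos[of x] by simp
qed simp

lemma part_le_weight: "i \<in># M \<Longrightarrow> L i \<le> (\<Sum>i\<in>#M. L i)"
  by (metis image_mset_add_mset insert_DiffM le_add1 sum_mset.add_mset)

lemma finite_parts: "finite (parts n)"
proof (rule finite_subset)
  show "parts n \<subseteq> mset ` {xs. set xs \<subseteq> {i. L i \<le> n} \<and> length xs \<le> n}"
  proof
    fix M assume M: "M \<in> parts n"
    obtain xs where xs: "mset xs = M" using ex_mset by blast
    have "length xs \<le> n" using size_le_weight[of M] M xs by (auto simp: parts_def)
    moreover have "set xs \<subseteq> {i. L i \<le> n}" using part_le_weight[of _ M] M xs by (auto simp: parts_def)
    ultimately show "M \<in> mset ` {xs. set xs \<subseteq> {i. L i \<le> n} \<and> length xs \<le> n}" using xs by blast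
  qed
qed (intro finite_imageI finite_lists_length_le L_finite)

text \<open>Every summand is at least 1, so a partition of \<open>n\<close> has at most
  \<open>n\<close> members and the series over \<open>m\<close> is a finite sum.\<close>

lemma partition_moment_eq: "partition_moment L k n = (\<Sum>M\<in>parts n. real (size M) ^ k)"
proof -
  have eq: "real m ^ k * real (partitions_into L n m) = (\<Sum>M | M \<in> parts n \<and> size M = m. real (size M) ^ k)" for m
  proof -
    have "{M. size M = m \<and> (\<Sum>i\<in>#M. L i) = n} = {M. M \<in> parts n \<and> size M = m}" by (auto simp: parts_def)
    hence "real m ^ k * real (partitions_into L n m) = (\<Sum>M | M \<in> parts n \<and> size M = m. real m ^ k)"
      by (simp add: partitions_into_def)
    also have "\<dots> = (\<Sum>M | M \<in> parts n \<and> size M = m. real (size M) ^ k)" by (intro sum.cong) auto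
    finally show ?thesis .
  qed
  have "partition_moment L k n = (\<Sum>m\<le>n. \<Sum>M | M \<in> parts n \<and> size M = m. real (size M) ^ k)"
    unfolding partition_moment_def eq
  proof (rule suminf_finite)
    fix m assume "m \<notin> {..n}"
    hence "{M. M \<in> parts n \<and> size M = m} = {}" using size_le_weight by (fastforce simp: parts_def)
    thus "(\<Sum>M | M \<in> parts n \<and> size M = m. real (size M) ^ k) = 0" by (simp only: sum.empty)
  qed simp
  also have "\<dots> = (\<Sum>M\<in>parts n. real (size M) ^ k)"
    by (rule sum.group[OF finite_parts]) (use size_le_weight in \<open>auto simp: parts_def\<close>)
  finally show ?thesis .
qed

text \<open>The pair \<open>(i, j)\<close> stands for \<open>j + 1\<close> copies of the summand at position \<open>i\<close>.\<close>

definition pairs :: "nat \<Rightarrow> (nat \<times> nat) set" where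
  "pairs m = {(i, j). Suc j * L i = m}"

definition pairs_upto :: "nat \<Rightarrow> (nat \<times> nat) set" where
  "pairs_upto n = {(i, j). Suc j * L i \<le> n}"

lemma finite_pairs_upto: "finite (pairs_upto n)"
proof (rule finite_subset)
  show "pairs_upto n \<subseteq> {i. L i \<le> n} \<times> {..n}"
  proof
    fix x assume x: "x \<in> pairs_upto n"
    obtain i j where ij: "x = (i, j)" by (cases x)
    have "L i + j * L i \<le> n" using x by (simp add: pairs_upto_def ij)
    moreover have "j \<le> j * L i" using L_pos[of i] by simp
    ultimately have "L i \<le> n" "j \<le> n" by linarith+
    thus "x \<in> {i. L i \<le> n} \<times> {..n}" by (simp add: ij)
  qed
qed (intro finite_cartesian_product L_finite finite_atMost)

lemma finite_pairs: "finite (pairs m)"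
  by (rule finite_subset[OF _ finite_pairs_upto[of m]]) (auto simp: pairs_def pairs_upto_def)

text \<open>The Lambert series \<open>\<Sum> w i j x^(j L i)\<close> over all positions
  \<open>i\<close> and all \<open>j \<ge> 1\<close>; \<open>pairs\<close> counts copies from 0, so
  the weight is taken at \<open>Suc j\<close>.\<close>

definition coef :: "(nat \<Rightarrow> nat \<Rightarrow> real) \<Rightarrow> real fps" where
  "coef w = Abs_fps (\<lambda>m. \<Sum>(i, j)\<in>pairs m. w i (Suc j))"

lemma coef_mult_nth:
  "fps_nth (coef w * P) n = (\<Sum>(i, j)\<in>pairs_upto n. w i (Suc j) * fps_nth P (n - Suc j * L i))"
proof -
  have "fps_nth (coef w * P) n = (\<Sum>m\<le>n. \<Sum>x\<in>pairs m. (case x of (i, j) \<Rightarrow> w i (Suc j) * fps_nth P (n - Suc j * L i)))"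
    unfolding fps_mult_nth atLeast0AtMost
    by (intro sum.cong refl) (auto simp: coef_def sum_distrib_right pairs_def intro!: sum.cong)
  also have "\<dots> = (\<Sum>m\<le>n. \<Sum>x | x \<in> pairs_upto n \<and> (case x of (i, j) \<Rightarrow> Suc j * L i) = m. (case x of (i, j) \<Rightarrow> w i (Suc j) * fps_nth P (n - Suc j * L i)))"
    by (intro sum.cong refl) (auto simp: pairs_def pairs_upto_def)
  also have "\<dots> = (\<Sum>x\<in>pairs_upto n. (case x of (i, j) \<Rightarrow> w i (Suc j) * fps_nth P (n - Suc j * L i)))"
    by (rule sum.group[OF finite_pairs_upto]) (auto simp: pairs_upto_def)
  finally show ?thesis .
qed

text \<open>Deleting \<open>j + 1\<close> copies of position \<open>i\<close> is a bijection onto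
  the partitions of the remaining number.\<close>

lemma sum_parts_remove:
  assumes "Suc j * L i \<le> n"
  shows "(\<Sum>M | M \<in> parts n \<and> j < count M i. f M) = (\<Sum>M\<in>parts (n - Suc j * L i). f (M + replicate_mset (Suc j) i))"
proof (rule sum.reindex_bij_witness[of _ "\<lambda>M. M + replicate_mset (Suc j) i" "\<lambda>M. M - replicate_mset (Suc j) i"])
  fix M assume M: "M \<in> {M. M \<in> parts n \<and> j < count M i}"
  hence sub: "replicate_mset (Suc j) i \<subseteq># M" by (simp add: count_le_replicate_mset_subset_eq[symmetric] Suc_le_eq del: replicate_mset_Suc)
  thus *: "M - replicate_mset (Suc j) i + replicate_mset (Suc j) i = M" by (rule subset_mset.diff_add)
  have "(\<Sum>i\<in>#M. L i) = (\<Sum>i\<in>#(M - replicate_mset (Suc j) i). L i) + Suc j * L i"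
    by (subst *[symmetric]) (simp only: image_mset_union sum_mset.union image_replicate_mset sum_mset_replicate_mset of_nat_id)
  thus "M - replicate_mset (Suc j) i \<in> parts (n - Suc j * L i)" using M
    by (simp only: parts_def mem_Collect_eq) linarith
  show "f (M - replicate_mset (Suc j) i + replicate_mset (Suc j) i) = f M" by (simp only: *)
next
  fix M assume M: "M \<in> parts (n - Suc j * L i)"
  show "M + replicate_mset (Suc j) i - replicate_mset (Suc j) i = M" by simp
  have "(\<Sum>i\<in>#(M + replicate_mset (Suc j) i). L i) = (\<Sum>i\<in>#M. L i) + Suc j * L i"
    by (simp only: image_mset_union sum_mset.union image_replicate_mset sum_mset_replicate_mset of_nat_id)
  thus "M + replicate_mset (Suc j) i \<in> {M. M \<in> parts n \<and> j < count M i}"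
    using M assms by (simp add: parts_def del: mult_Suc)
qed

text \<open>A sum over the members of \<open>M\<close> meets position \<open>i\<close> once for
  every \<open>j < count M i\<close>. After interchanging the sums, \<open>j < count M i\<close>
  singles out the partitions from which \<open>j + 1\<close> copies can be removed.\<close>

lemma sum_parts_weighted:
  fixes f :: "nat multiset \<Rightarrow> real" and c :: "nat \<Rightarrow> real"
  shows "(\<Sum>M\<in>parts n. f M * (\<Sum>i\<in>#M. c i)) =
    (\<Sum>(i, j)\<in>pairs_upto n. c i * (\<Sum>M\<in>parts (n - Suc j * L i). f (M + replicate_mset (Suc j) i)))"
proof -
  have cs: "(\<Sum>i\<in>#M. c i) = (\<Sum>(i, j)\<in>pairs_upto n. if j < count M i then c i else 0)" if M: "M \<in> parts n" for M
  proof -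
    have "(\<Sum>i\<in>#M. c i) = (\<Sum>i\<in>set_mset M. real (count M i) * c i)"
      by (rule sum_mset_eq_sum_count) auto
    also have "\<dots> = (\<Sum>i\<in>set_mset M. \<Sum>j<count M i. c i)" by simp
    also have "\<dots> = (\<Sum>(i, j)\<in>(SIGMA i:set_mset M. {..<count M i}). c i)" by (rule sum.Sigma) auto
    also have "\<dots> = (\<Sum>x\<in>pairs_upto n. if x \<in> (SIGMA i:set_mset M. {..<count M i}) then (case x of (i, j) \<Rightarrow> c i) else 0)"
    proof (subst sum.inter_restrict[symmetric, OF finite_pairs_upto])
      have "(SIGMA i:set_mset M. {..<count M i}) \<subseteq> pairs_upto n"
      proof
        fix x assume x: "x \<in> (SIGMA i:set_mset M. {..<count M i})"
        obtain i j where ij: "x = (i, j)" by (cases x)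
        have "j < count M i" using x by (simp add: ij)
        hence "replicate_mset (Suc j) i \<subseteq># M" by (simp add: count_le_replicate_mset_subset_eq[symmetric] Suc_le_eq del: replicate_mset_Suc)
        hence *: "M = M - replicate_mset (Suc j) i + replicate_mset (Suc j) i" by (rule subset_mset.diff_add[symmetric])
        have "(\<Sum>i\<in>#M. L i) = (\<Sum>i\<in>#(M - replicate_mset (Suc j) i). L i) + Suc j * L i"
          by (subst *) (simp only: image_mset_union sum_mset.union image_replicate_mset sum_mset_replicate_mset of_nat_id)
        thus "x \<in> pairs_upto n" using M by (simp add: parts_def pairs_upto_def ij)
      qed
      thus "(\<Sum>(i, j)\<in>(SIGMA i:set_mset M. {..<count M i}). c i) =
        (\<Sum>(i, j)\<in>pairs_upto n \<inter> (SIGMA i:set_mset M. {..<count M i}). c i)" by (simp add: Int_absorb1)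
    qed
    also have "\<dots> = (\<Sum>(i, j)\<in>pairs_upto n. if j < count M i then c i else 0)"
    proof (intro sum.cong refl, clarify)
      fix i j
      have "i \<in># M" if "j < count M i" using that by (intro count_inI) auto
      thus "(if (i, j) \<in> (SIGMA i:set_mset M. {..<count M i}) then c i else 0) = (if j < count M i then c i else 0)" by auto
    qed
    finally show ?thesis .
  qed
  have "(\<Sum>M\<in>parts n. f M * (\<Sum>i\<in>#M. c i)) =
     (\<Sum>M\<in>parts n. \<Sum>(i, j)\<in>pairs_upto n. if j < count M i then c i * f M else 0)"
    by (intro sum.cong refl) (simp add: cs sum_distrib_left case_prod_unfold if_distrib mult.commute cong: if_cong)
  also have "\<dots> = (\<Sum>(i, j)\<in>pairs_upto n. \<Sum>M\<in>parts n. if j < count M i then c i * f M else 0)"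
    by (subst sum.swap) (simp add: case_prod_unfold)
  also have "\<dots> = (\<Sum>(i, j)\<in>pairs_upto n. c i * (\<Sum>M | M \<in> parts n \<and> j < count M i. f M))"
  proof (intro sum.cong refl, clarify)
    fix i j
    have "(\<Sum>M\<in>parts n. if j < count M i then c i * f M else 0) = (\<Sum>M\<in>{M \<in> parts n. j < count M i}. c i * f M)"
      by (rule sum.inter_filter[symmetric, OF finite_parts])
    thus "(\<Sum>M\<in>parts n. if j < count M i then c i * f M else 0) = c i * (\<Sum>M | M \<in> parts n \<and> j < count M i. f M)"
      by (simp add: sum_distrib_left)
  qed
  also have "\<dots> = (\<Sum>(i, j)\<in>pairs_upto n. c i * (\<Sum>M\<in>parts (n - Suc j * L i). f (M + replicate_mset (Suc j) i)))"
    by (intro sum.cong refl, clarify) (subst sum_parts_remove, auto simp: pairs_upto_def)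
  finally show ?thesis .
qed

definition partition_fps :: "real fps" where "partition_fps = Abs_fps (partition_moment L 0)"

definition \<sigma> :: "real fps" where "\<sigma> = coef (\<lambda>i j. real (L i))"

definition divisor_fps :: "nat \<Rightarrow> real fps" where "divisor_fps r = coef (\<lambda>i j. real j ^ r)"

fun moment_factor :: "nat \<Rightarrow> real fps" where
  "moment_factor 0 = 1"
| "moment_factor (Suc k) = (\<Sum>l\<le>k. fps_const (real (k choose l)) * divisor_fps (k - l) * moment_factor l)"

lemma partition_fps_nth: "fps_nth partition_fps n = real (card (parts n))"
  by (simp add: partition_fps_def partition_moment_eq)

text \<open>The members of a partition of \<open>n\<close> have values \<open>L i\<close> adding up
  to \<open>n\<close>, so the removal identity with \<open>f = 1\<close> counts every partition
  \<open>n\<close> times.\<close>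

lemma partition_fps_rec: "\<sigma> * partition_fps = fps_X * fps_deriv partition_fps"
proof (rule fps_ext)
  fix n
  have "fps_nth (fps_X * fps_deriv partition_fps) n = real n * fps_nth partition_fps n" by (cases n) auto
  also have "\<dots> = (\<Sum>M\<in>parts n. 1 * (\<Sum>i\<in>#M. real (L i)))"
  proof -
    have "(\<Sum>i\<in>#M. real (L i)) = real n" if "M \<in> parts n" for M
      using that by (auto simp: parts_def of_nat_sum_mset multiset.map_comp o_def)
    thus ?thesis by (simp add: partition_fps_nth mult.commute)
  qed
  also have "\<dots> = fps_nth (\<sigma> * partition_fps) n"
    unfolding sum_parts_weighted \<sigma>_def coef_mult_nth by (simp add: partition_fps_nth)
  finally show "fps_nth (\<sigma> * partition_fps) n = fps_nth (fps_X * fps_deriv partition_fps) n" by simp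
qed

text \<open>One factor of \<open>size M ^ (k + 1)\<close> is written as the sum of 1 over the
  members. Removing \<open>j\<close> copies turns the other factors into
  \<open>(size M + j)^k\<close>, and the binomial theorem separates the powers of \<open>j\<close>,
  which form \<open>divisor_fps\<close>, from the lower moments.\<close>

lemma moment_fps: "Abs_fps (partition_moment L k) = moment_factor k * partition_fps"
proof (induction k rule: less_induct)
  case (less k)
  show ?case
  proof (cases k)
    case 0
    thus ?thesis by (simp add: partition_fps_def)
  next
    case (Suc k')
    have "Abs_fps (partition_moment L k) = (\<Sum>l\<le>k'. fps_const (real (k' choose l)) * (divisor_fps (k' - l) * Abs_fps (partition_moment L l)))"
    proof (rule fps_ext)
      fix n
      have "fps_nth (Abs_fps (partition_moment L k)) n = (\<Sum>M\<in>parts n. real (size M) ^ k' * (\<Sum>i\<in>#M. 1))"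
        by (simp add: partition_moment_eq Suc mult.commute)
      also have "\<dots> = (\<Sum>(i, j)\<in>pairs_upto n. \<Sum>M\<in>parts (n - Suc j * L i). (real (size M) + real (Suc j)) ^ k')"
        unfolding sum_parts_weighted by (simp add: add_ac)
      also have "\<dots> = (\<Sum>(i, j)\<in>pairs_upto n. \<Sum>l\<le>k'. real (k' choose l) * (real (Suc j) ^ (k' - l) * partition_moment L l (n - Suc j * L i)))"
      proof (intro sum.cong refl, clarify)
        fix i j
        have "(\<Sum>M\<in>parts (n - Suc j * L i). (real (size M) + real (Suc j)) ^ k') =
           (\<Sum>M\<in>parts (n - Suc j * L i). \<Sum>l\<le>k'. real (k' choose l) * real (size M) ^ l * real (Suc j) ^ (k' - l))"
          by (simp only: binomial_ring)
        also have "\<dots> = (\<Sum>l\<le>k'. real (k' choose l) * (real (Suc j) ^ (k' - l) * partition_moment L l (n - Suc j * L i)))"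
          unfolding partition_moment_eq by (subst sum.swap) (simp only: sum_distrib_left sum_distrib_right mult_ac)
        finally show "(\<Sum>M\<in>parts (n - Suc j * L i). (real (size M) + real (Suc j)) ^ k') =
          (\<Sum>l\<le>k'. real (k' choose l) * (real (Suc j) ^ (k' - l) * partition_moment L l (n - Suc j * L i)))" .
      qed
      also have "\<dots> = (\<Sum>l\<le>k'. real (k' choose l) * (\<Sum>(i, j)\<in>pairs_upto n. real (Suc j) ^ (k' - l) * partition_moment L l (n - Suc j * L i)))"
        unfolding case_prod_unfold by (subst sum.swap) (simp only: sum_distrib_left)
      also have "\<dots> = fps_nth (\<Sum>l\<le>k'. fps_const (real (k' choose l)) * (divisor_fps (k' - l) * Abs_fps (partition_moment L l))) n"
        unfolding divisor_fps_def fps_sum_nth fps_mult_left_const_nth coef_mult_nth by simp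
      finally show "fps_nth (Abs_fps (partition_moment L k)) n = \<dots>" .
    qed
    also have "\<dots> = moment_factor k * partition_fps"
      unfolding Suc moment_factor.simps sum_distrib_right by (intro sum.cong refl) (simp add: less Suc mult.assoc)
    finally show ?thesis .
  qed
qed

text \<open>Adjoining the summand 1 is injective.\<close>

lemma partition_fps_mono: "mono (fps_nth partition_fps)"
proof (rule mono_iff_le_Suc[THEN iffD2], rule allI)
  fix n
  obtain i where i: "L i = 1" using L_one by blast
  have "card (parts n) \<le> card (parts (Suc n))"
    by (rule card_inj_on_le[of "add_mset i"]) (auto simp: parts_def i inj_on_def finite_parts[unfolded parts_def])
  thus "fps_nth partition_fps n \<le> fps_nth partition_fps (Suc n)" by (simp add: partition_fps_nth)
qed

lemma partition_fps_0: "fps_nth partition_fps 0 > 0"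
proof -
  have "{#} \<in> parts 0" by (simp add: parts_def)
  hence "card (parts 0) > 0" using finite_parts[of 0] by (auto simp: card_gt_0_iff)
  thus ?thesis by (simp add: partition_fps_nth)
qed

section \<open>Double series over positions and numbers of copies\<close>

lemma lap_coef:
  assumes w: "\<And>i j. w i j \<ge> 0"
    and s: "\<And>t. t > 0 \<Longrightarrow> (\<lambda>(i, j). w i (Suc j) * exp (- (real (Suc j) * (real (L i) * t)))) summable_on UNIV"
  shows "lap_conv (fps_nth (coef w))"
    and "t > 0 \<Longrightarrow> ((\<lambda>(i, j). w i (Suc j) * exp (- (real (Suc j) * (real (L i) * t)))) has_sum lap (fps_nth (coef w)) t) UNIV"
proof -
  define F where "F t = (\<lambda>(i, j). w i (Suc j) * exp (- (real (Suc j) * (real (L i) * t))))" for t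
  have *: "(\<lambda>m. fps_nth (coef w) m * exp (- (real m * t))) sums infsum (F t) UNIV" if t: "t > 0" for t
  proof -
    have hs: "(F t has_sum infsum (F t) UNIV) UNIV" using s[OF t] by (simp add: F_def)
    \<comment> \<open>Each pair lies in exactly one fibre \<open>pairs m\<close>, and the family is
      summable in any order, so it may be grouped by exponent.\<close>
    have bij: "bij_betw snd (Sigma UNIV pairs) UNIV"
      by (rule bij_betwI[where g = "\<lambda>(i, j). (Suc j * L i, (i, j))"]) (auto simp: pairs_def)
    have "((\<lambda>x. F t (snd x)) has_sum infsum (F t) UNIV) (Sigma UNIV pairs)"
      using hs has_sum_reindex_bij_betw[OF bij, of "F t"] by simp
    hence "((\<lambda>m. \<Sum>x\<in>pairs m. F t x) has_sum infsum (F t) UNIV) UNIV"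
      by (rule has_sum_SigmaD) (auto intro!: has_sum_finite finite_pairs)
    moreover have "(\<Sum>x\<in>pairs m. F t x) = fps_nth (coef w) m * exp (- (real m * t))" for m
    proof -
      have "F t (i, j) = w i (Suc j) * exp (- (real m * t))" if "(i, j) \<in> pairs m" for i j
      proof -
        have "real (Suc j) * real (L i) = real m" using that by (simp only: pairs_def of_nat_mult[symmetric]) simp
        thus ?thesis by (simp only: F_def prod.case mult.assoc[symmetric])
      qed
      thus ?thesis unfolding coef_def fps_nth_Abs_fps sum_distrib_right by (intro sum.cong) auto
    qed
    ultimately show ?thesis by (simp add: has_sum_imp_sums)
  qed
  show "lap_conv (fps_nth (coef w))"
    using * w by (auto simp: lap_conv_def coef_def sums_iff intro!: sum_nonneg)
  show "((\<lambda>(i, j). w i (Suc j) * exp (- (real (Suc j) * (real (L i) * t)))) has_sum lap (fps_nth (coef w)) t) UNIV" if t: "t > 0"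
  proof -
    have "lap (fps_nth (coef w)) t = infsum (F t) UNIV" using *[OF t] by (simp add: lap_def sums_iff)
    thus ?thesis using s[OF t] by (simp add: F_def)
  qed
qed

text \<open>By nonnegativity the double series may be summed in either order. Summing over the
  copies first leads to the functions \<open>psi\<close> at \<open>L i * t\<close>; its companion
  sums over the positions first and leads to \<Theta> and its derivative at multiples of
  \<open>t\<close>.\<close>

lemma lap_coef_outer_i:
  assumes w: "\<And>i j. w i j \<ge> 0"
    and S: "\<And>i t. t > 0 \<Longrightarrow> (\<lambda>j. w i (Suc j) * exp (- (real (Suc j) * (real (L i) * t)))) sums S i t"
    and sm: "\<And>t. t > 0 \<Longrightarrow> summable (\<lambda>i. S i t)"
  shows "lap_conv (fps_nth (coef w))" and "t > 0 \<Longrightarrow> (\<lambda>i. S i t) sums lap (fps_nth (coef w)) t"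
proof -
  have S': "((\<lambda>j. w i (Suc j) * exp (- (real (Suc j) * (real (L i) * t)))) has_sum S i t) UNIV" if "t > 0" for i t
    by (rule sums_nonneg_imp_has_sum[OF S[OF that]]) (simp add: w)
  have S0: "S i t \<ge> 0" if "t > 0" for i t
    using S'[OF that] by (rule has_sum_nonneg) (simp add: w)
  have sum: "(\<lambda>(i, j). w i (Suc j) * exp (- (real (Suc j) * (real (L i) * t)))) summable_on UNIV" if "t > 0" for t
  proof -
    have "(\<lambda>(i, j). w i (Suc j) * exp (- (real (Suc j) * (real (L i) * t)))) summable_on Sigma UNIV (\<lambda>_. UNIV)"
    proof (rule summable_on_SigmaI[where g = "\<lambda>i. S i t"])
      show "((\<lambda>y. case (i, y) of (i, j) \<Rightarrow> w i (Suc j) * exp (- (real (Suc j) * (real (L i) * t)))) has_sum S i t) UNIV" for i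
        using S'[OF that] by (simp only: prod.case)
    qed (use that in \<open>auto intro!: summable_nonneg_imp_summable_on sm S0 mult_nonneg_nonneg w\<close>)
    thus ?thesis by simp
  qed
  show "lap_conv (fps_nth (coef w))" by (rule lap_coef(1)[OF w sum])
  show "(\<lambda>i. S i t) sums lap (fps_nth (coef w)) t" if t: "t > 0"
  proof -
    have "((\<lambda>(i, j). w i (Suc j) * exp (- (real (Suc j) * (real (L i) * t)))) has_sum lap (fps_nth (coef w)) t) (Sigma UNIV (\<lambda>_. UNIV))"
      using lap_coef(2)[OF w sum t] by simp
    hence "((\<lambda>i. S i t) has_sum lap (fps_nth (coef w)) t) UNIV"
      by (rule has_sum_SigmaD) (use S'[OF t] in simp)
    thus ?thesis by (rule has_sum_imp_sums)
  qed
qed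

lemma lap_coef_outer_j:
  assumes w: "\<And>i j. w i j \<ge> 0"
    and S: "\<And>j t. t > 0 \<Longrightarrow> (\<lambda>i. w i (Suc j) * exp (- (real (Suc j) * (real (L i) * t)))) sums S j t"
    and sm: "\<And>t. t > 0 \<Longrightarrow> summable (\<lambda>j. S j t)"
  shows "lap_conv (fps_nth (coef w))" and "t > 0 \<Longrightarrow> (\<lambda>j. S j t) sums lap (fps_nth (coef w)) t"
proof -
  define F where "F t = (\<lambda>(j, i). w i (Suc j) * exp (- (real (Suc j) * (real (L i) * t))))" for t
  have swap: "(\<lambda>(i, j). w i (Suc j) * exp (- (real (Suc j) * (real (L i) * t)))) = (\<lambda>(i, j). F t (j, i))" for t
    by (simp add: F_def)
  have S': "((\<lambda>i. F t (j, i)) has_sum S j t) UNIV" if "t > 0" for j t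
    unfolding F_def prod.case by (rule sums_nonneg_imp_has_sum[OF S[OF that]]) (simp add: w)
  have F0: "F t x \<ge> 0" for t x by (cases x) (simp add: F_def w)
  have S0: "S j t \<ge> 0" if "t > 0" for j t
    using S'[OF that] by (rule has_sum_nonneg) (rule F0)
  have "F t summable_on Sigma UNIV (\<lambda>_. UNIV)" if "t > 0" for t
    using that by (intro summable_on_SigmaI[where g = "\<lambda>j. S j t"])
      (auto intro!: S' summable_nonneg_imp_summable_on sm S0 F0)
  hence sum: "(\<lambda>(i, j). w i (Suc j) * exp (- (real (Suc j) * (real (L i) * t)))) summable_on UNIV" if "t > 0" for t
    using summable_on_swap[of "F t" UNIV UNIV] that unfolding swap by simp
  show "lap_conv (fps_nth (coef w))" by (rule lap_coef(1)[OF w sum])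
  show "(\<lambda>j. S j t) sums lap (fps_nth (coef w)) t" if t: "t > 0"
  proof -
    have "(F t has_sum lap (fps_nth (coef w)) t) (Sigma UNIV (\<lambda>_. UNIV))"
      using lap_coef(2)[OF w sum t] has_sum_swap[where f = "F t" and A = UNIV and B = UNIV] unfolding swap by simp
    hence "((\<lambda>j. S j t) has_sum lap (fps_nth (coef w)) t) UNIV"
      by (rule has_sum_SigmaD) (use S'[OF t] in simp)
    thus ?thesis by (rule has_sum_imp_sums)
  qed
qed

end

section \<open>Complete Bell polynomials\<close>

text \<open>The number of variables and the weight are separate parameters: lowering the exponent
  \<open>b j\<close> by one reduces the weight to \<open>k - j\<close> but keeps the range of
  indices.\<close>

definition bell_exps :: "nat \<Rightarrow> nat \<Rightarrow> (nat \<Rightarrow> nat) set" where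
  "bell_exps N k = {b \<in> {1..N} \<rightarrow>\<^sub>E UNIV. (\<Sum>j=1..N. j * b j) = k}"

text \<open>The coefficient of \<open>z^k\<close> in
  \<open>exp (\<Sum>j=1..N. y j * z^j)\<close>.\<close>

definition bell_sum :: "(nat \<Rightarrow> real) \<Rightarrow> nat \<Rightarrow> nat \<Rightarrow> real" where
  "bell_sum y N k = (\<Sum>b\<in>bell_exps N k. \<Prod>j=1..N. y j ^ b j / fact (b j))"

lemma finite_bell_exps: "finite (bell_exps N k)"
proof (rule finite_subset)
  show "bell_exps N k \<subseteq> {1..N} \<rightarrow>\<^sub>E {..k}"
  proof
    fix b assume b: "b \<in> bell_exps N k"
    have "b j \<le> k" if j: "j \<in> {1..N}" for j
    proof -
      have "b j \<le> j * b j" using j by simp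
      also have "\<dots> \<le> (\<Sum>j=1..N. j * b j)" by (rule member_le_sum[OF j]) auto
      finally show ?thesis using b by (simp add: bell_exps_def)
    qed
    thus "b \<in> {1..N} \<rightarrow>\<^sub>E {..k}" using b by (auto simp: bell_exps_def PiE_def)
  qed
qed (intro finite_PiE, auto)

text \<open>A nonzero exponent of the new variable would already contribute more than
  \<open>N \<ge> k\<close> to the weight.\<close>

lemma bell_sum_Suc:
  assumes "k \<le> N"
  shows "bell_sum y (Suc N) k = bell_sum y N k"
  unfolding bell_sum_def
proof (rule sum.reindex_bij_witness[of _ "\<lambda>b. b(Suc N := 0)" "\<lambda>b. restrict b {1..N}"])
  fix b assume b: "b \<in> bell_exps (Suc N) k"
  hence eq: "(\<Sum>j=1..N. j * b j) + Suc N * b (Suc N) = k" by (simp add: bell_exps_def)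
  have z: "b (Suc N) = 0"
  proof (rule ccontr)
    assume "b (Suc N) \<noteq> 0"
    hence "N < Suc N * b (Suc N)" by (cases "b (Suc N)") auto
    also have "\<dots> \<le> k" unfolding eq[symmetric] by (rule le_add2)
    finally show False using assms by simp
  qed
  show *: "(restrict b {1..N})(Suc N := 0) = b"
    using b z by (auto simp: bell_exps_def PiE_def extensional_def restrict_def fun_eq_iff)
  show "restrict b {1..N} \<in> bell_exps N k"
    using eq z by (auto simp: bell_exps_def)
  show "(\<Prod>j=1..N. y j ^ restrict b {1..N} j / fact (restrict b {1..N} j)) = (\<Prod>j=1..Suc N. y j ^ b j / fact (b j))"
    using z by (simp add: prod.cl_ivl_Suc)
next
  fix b assume b: "b \<in> bell_exps N k"
  show "restrict (b(Suc N := 0)) {1..N} = b"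
    using b by (auto simp: bell_exps_def PiE_def extensional_def restrict_def fun_eq_iff)
  have "(\<Sum>j=1..N. j * (b(Suc N := 0)) j) = k" using b by (auto simp: bell_exps_def)
  thus "b(Suc N := 0) \<in> bell_exps (Suc N) k"
    using b by (auto simp: bell_exps_def PiE_def extensional_def)
qed

lemma bell_sum_eq: "k \<le> N \<Longrightarrow> bell_sum y N k = bell_sum y k k"
  by (induction N rule: dec_induct) (simp_all add: bell_sum_Suc)

text \<open>\<open>b j / fact (b j)\<close> is \<open>1 / fact (b j - 1)\<close>, so lowering
  \<open>b j\<close> by one splits off \<open>y j\<close>. In terms of the exponential this is
  \<open>y j\<close> times the derivative in \<open>y j\<close>.\<close>

lemma bell_sum_shift:
  assumes j: "j \<in> {1..N}" "j \<le> k"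
  shows "(\<Sum>b\<in>bell_exps N k. real (b j) * (\<Prod>i=1..N. y i ^ b i / fact (b i))) = y j * bell_sum y N (k - j)"
proof -
  have "(\<Sum>b\<in>bell_exps N k. real (b j) * (\<Prod>i=1..N. y i ^ b i / fact (b i))) =
    (\<Sum>b | b \<in> bell_exps N k \<and> b j > 0. real (b j) * (\<Prod>i=1..N. y i ^ b i / fact (b i)))"
    by (rule sum.mono_neutral_right) (auto simp: finite_bell_exps)
  also have "\<dots> = (\<Sum>b\<in>bell_exps N (k - j). y j * (\<Prod>i=1..N. y i ^ b i / fact (b i)))"
  proof (rule sum.reindex_bij_witness[of _ "\<lambda>b. b(j := Suc (b j))" "\<lambda>b. b(j := b j - 1)"])
    have split: "(\<Sum>i=1..N. i * b i) = j * b j + (\<Sum>i\<in>{1..N} - {j}. i * b i)" for b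
      using j by (intro sum.remove) auto
    have psplit: "(\<Prod>i=1..N. y i ^ b i / fact (b i)) = y j ^ b j / fact (b j) * (\<Prod>i\<in>{1..N} - {j}. y i ^ b i / fact (b i))" for b
      using j by (intro prod.remove) auto
    fix b assume b: "b \<in> {b. b \<in> bell_exps N k \<and> b j > 0}"
    then obtain c where c: "b j = Suc c" by (auto simp: gr0_conv_Suc)
    show "(b(j := b j - 1))(j := Suc ((b(j := b j - 1)) j)) = b" using c by auto
    have "(\<Sum>i\<in>{1..N} - {j}. i * (b(j := b j - 1)) i) = (\<Sum>i\<in>{1..N} - {j}. i * b i)"
      by (intro sum.cong) auto
    hence "(\<Sum>i=1..N. i * (b(j := b j - 1)) i) = k - j"
      using b c split[of b] split[of "b(j := b j - 1)"] by (auto simp: bell_exps_def)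
    thus "b(j := b j - 1) \<in> bell_exps N (k - j)"
      using b j by (auto simp: bell_exps_def PiE_def extensional_def)
    have "(\<Prod>i\<in>{1..N} - {j}. y i ^ (b(j := b j - 1)) i / fact ((b(j := b j - 1)) i)) =
       (\<Prod>i\<in>{1..N} - {j}. y i ^ b i / fact (b i))" by (intro prod.cong) auto
    thus "y j * (\<Prod>i=1..N. y i ^ (b(j := b j - 1)) i / fact ((b(j := b j - 1)) i)) =
       real (b j) * (\<Prod>i=1..N. y i ^ b i / fact (b i))"
      unfolding psplit[of b] psplit[of "b(j := b j - 1)"] by (simp add: c)
  next
    have split: "(\<Sum>i=1..N. i * b i) = j * b j + (\<Sum>i\<in>{1..N} - {j}. i * b i)" for b
      using j by (intro sum.remove) auto
    fix b assume b: "b \<in> bell_exps N (k - j)"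
    show "(b(j := Suc (b j)))(j := (b(j := Suc (b j))) j - 1) = b" by auto
    have "(\<Sum>i\<in>{1..N} - {j}. i * (b(j := Suc (b j))) i) = (\<Sum>i\<in>{1..N} - {j}. i * b i)"
      by (intro sum.cong) auto
    hence "(\<Sum>i=1..N. i * (b(j := Suc (b j))) i) = k"
      using b j split[of b] split[of "b(j := Suc (b j))"] by (auto simp: bell_exps_def)
    thus "b(j := Suc (b j)) \<in> {b. b \<in> bell_exps N k \<and> b j > 0}"
      using b j by (auto simp: bell_exps_def PiE_def extensional_def)
  qed
  finally show ?thesis by (simp add: bell_sum_def sum_distrib_left)
qed

text \<open>On every exponent vector the factor \<open>k\<close> can be written as the sum of
  \<open>j * b j\<close>; this is the operator \<open>z d/dz\<close> applied to the exponential
  series.\<close>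

lemma bell_sum_rec:
  "real k * bell_sum y k k = (\<Sum>j=1..k. real j * y j * bell_sum y (k - j) (k - j))"
proof -
  have "real k * bell_sum y k k = (\<Sum>b\<in>bell_exps k k. (\<Sum>j=1..k. real j * real (b j)) * (\<Prod>i=1..k. y i ^ b i / fact (b i)))"
    unfolding bell_sum_def sum_distrib_left
  proof (intro sum.cong refl)
    fix b assume "b \<in> bell_exps k k"
    hence h: "(\<Sum>j=1..k. j * b j) = k" by (simp add: bell_exps_def)
    have "(\<Sum>j=1..k. real j * real (b j)) = real (\<Sum>j=1..k. j * b j)" by simp
    also have "\<dots> = real k" by (rule arg_cong[OF h])
    finally show "real k * (\<Prod>i=1..k. y i ^ b i / fact (b i)) = (\<Sum>j=1..k. real j * real (b j)) * (\<Prod>i=1..k. y i ^ b i / fact (b i))"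
      by (simp only:)
  qed
  also have "\<dots> = (\<Sum>j=1..k. real j * (\<Sum>b\<in>bell_exps k k. real (b j) * (\<Prod>i=1..k. y i ^ b i / fact (b i))))"
    unfolding sum_distrib_right sum_distrib_left by (subst sum.swap) (simp only: mult.assoc)
  also have "\<dots> = (\<Sum>j=1..k. real j * y j * bell_sum y (k - j) (k - j))"
  proof (intro sum.cong refl)
    fix j assume j: "j \<in> {1..k}"
    hence "bell_sum y k (k - j) = bell_sum y (k - j) (k - j)" by (intro bell_sum_eq) auto
    with bell_sum_shift[OF j, of k y] j
    show "real j * (\<Sum>b\<in>bell_exps k k. real (b j) * (\<Prod>i=1..k. y i ^ b i / fact (b i))) =
       real j * y j * bell_sum y (k - j) (k - j)" by simp
  qed
  finally show ?thesis .
qed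

lemma bell_Y_eq: "bell_Y k x = fact k * bell_sum (\<lambda>j. x j / fact j) k k"
  unfolding bell_Y_def bell_sum_def bell_exps_def sum_distrib_left
  by (intro sum.cong refl) (simp add: prod_dividef)

lemma bell_Y_0: "bell_Y 0 x = 1"
  by (simp add: bell_Y_def)

text \<open>The recursion of \<open>moment_factor\<close>, with \<open>x r\<close> in the place of
  \<open>divisor_fps (r - 1)\<close>; this is how \<open>Y_k\<close> enters the asymptotics.\<close>

lemma bell_Y_Suc: "bell_Y (Suc k) x = (\<Sum>l\<le>k. real (k choose l) * x (Suc (k - l)) * bell_Y l x)"
proof -
  let ?S = "\<lambda>l. bell_sum (\<lambda>j. x j / fact j) l l"
  have "bell_Y (Suc k) x = fact k * (real (Suc k) * ?S (Suc k))"
    by (simp add: bell_Y_eq algebra_simps)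
  also have "\<dots> = fact k * (\<Sum>j=1..Suc k. real j * (x j / fact j) * ?S (Suc k - j))"
    by (simp only: bell_sum_rec)
  also have "(\<Sum>j=1..Suc k. real j * (x j / fact j) * ?S (Suc k - j)) =
     (\<Sum>l\<le>k. real (Suc (k - l)) * (x (Suc (k - l)) / fact (Suc (k - l))) * ?S l)"
    by (rule sum.reindex_bij_witness[of _ "\<lambda>l. Suc (k - l)" "\<lambda>j. Suc k - j"]) auto
  also have "fact k * \<dots> = (\<Sum>l\<le>k. real (k choose l) * x (Suc (k - l)) * bell_Y l x)"
    unfolding sum_distrib_left
  proof (intro sum.cong refl)
    fix l assume l: "l \<in> {..k}"
    have "real (Suc (k - l)) * (x (Suc (k - l)) / fact (Suc (k - l))) = x (Suc (k - l)) / fact (k - l)"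
      by (simp add: divide_simps del: of_nat_Suc)
    moreover have "real (k choose l) = fact k / (fact l * fact (k - l))"
      using l by (intro binomial_fact) auto
    ultimately show "fact k * (real (Suc (k - l)) * (x (Suc (k - l)) / fact (Suc (k - l))) * ?S l) =
       real (k choose l) * x (Suc (k - l)) * bell_Y l x"
      by (simp only: bell_Y_eq) simp
  qed
  finally show ?thesis .
qed

text \<open>\<open>G k\<close> has weight \<open>k\<close> if \<open>X r\<close> is given weight
  \<open>r\<close>. After division by the matching power of \<open>X 1\<close>, only the summand
  that contains \<open>X 1\<close> itself survives in each step. The filter is left open because the
  lemma serves both for \<open>t \<rightarrow> 0\<close> and for
  \<open>n \<rightarrow> \<infinity>\<close>.\<close>

lemma bell_recursion_dominant:
  fixes G X :: "nat \<Rightarrow> 'a \<Rightarrow> real"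
  assumes G0: "\<And>t. G 0 t = 1"
    and G: "\<forall>\<^sub>F t in F. \<forall>k. G (Suc k) t = (\<Sum>l\<le>k. real (k choose l) * X (Suc (k - l)) t * G l t)"
    and X1: "\<forall>\<^sub>F t in F. X 1 t \<noteq> 0"
    and X: "\<And>r. r \<ge> 2 \<Longrightarrow> ((\<lambda>t. X r t / X 1 t ^ r) \<longlongrightarrow> 0) F"
  shows "((\<lambda>t. G k t / X 1 t ^ k) \<longlongrightarrow> 1) F"
proof (induction k rule: less_induct)
  case (less k)
  show ?case
  proof (cases k)
    case 0
    thus ?thesis by (simp add: G0)
  next
    case (Suc k')
    have "((\<lambda>t. \<Sum>l\<le>k'. real (k' choose l) * (X (Suc (k' - l)) t / X 1 t ^ Suc (k' - l)) * (G l t / X 1 t ^ l)) \<longlongrightarrow>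
       (\<Sum>l\<le>k'. real (k' choose l) * (if l = k' then 1 else 0) * 1)) F"
    proof (intro tendsto_sum tendsto_mult tendsto_const)
      fix l assume l: "l \<in> {..k'}"
      show "((\<lambda>t. G l t / X 1 t ^ l) \<longlongrightarrow> 1) F" using l Suc by (intro less) auto
      show "((\<lambda>t. X (Suc (k' - l)) t / X 1 t ^ Suc (k' - l)) \<longlongrightarrow> (if l = k' then 1 else 0)) F"
      proof (cases "l = k'")
        case True
        have "((\<lambda>t. X 1 t / X 1 t ^ 1) \<longlongrightarrow> 1) F"
          by (rule tendsto_eventually) (use X1 in eventually_elim, simp)
        thus ?thesis using True by simp
      next
        case False
        thus ?thesis using X[of "Suc (k' - l)"] l by simp
      qed
    qed
    also have "(\<Sum>l\<le>k'. real (k' choose l) * (if l = k' then 1 else 0) * 1) = 1"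
      by (subst sum.mono_neutral_right[of _ "{k'}"]) auto
    finally show ?thesis
    proof (rule Lim_transform_eventually)
      show "\<forall>\<^sub>F t in F. (\<Sum>l\<le>k'. real (k' choose l) * (X (Suc (k' - l)) t / X 1 t ^ Suc (k' - l)) * (G l t / X 1 t ^ l)) = G k t / X 1 t ^ k"
        using G X1
      proof eventually_elim
        case (elim t)
        have "G k t / X 1 t ^ k = (\<Sum>l\<le>k'. real (k' choose l) * X (Suc (k' - l)) t * G l t / X 1 t ^ Suc k')"
          using elim by (simp add: Suc sum_divide_distrib)
        also have "\<dots> = (\<Sum>l\<le>k'. real (k' choose l) * (X (Suc (k' - l)) t / X 1 t ^ Suc (k' - l)) * (G l t / X 1 t ^ l))"
        proof (intro sum.cong refl)
          fix l assume "l \<in> {..k'}"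
          hence "Suc k' = Suc (k' - l) + l" by simp
          hence "X 1 t ^ Suc k' = X 1 t ^ Suc (k' - l) * X 1 t ^ l" by (metis power_add)
          thus "real (k' choose l) * X (Suc (k' - l)) t * G l t / X 1 t ^ Suc k' =
             real (k' choose l) * (X (Suc (k' - l)) t / X 1 t ^ Suc (k' - l)) * (G l t / X 1 t ^ l)" by simp
        qed
        finally show ?case by simp
      qed
    qed
  qed
qed

text \<open>The scaling by \<open>s^r\<close> respects the weights of the recursion, so the limits
  of the scaled terms obey the recursion of \<open>bell_Y\<close>.\<close>

lemma bell_recursion_limit:
  fixes G X :: "nat \<Rightarrow> 'a \<Rightarrow> real"
  assumes G0: "\<And>t. G 0 t = 1"
    and G: "\<forall>\<^sub>F t in F. \<forall>k. G (Suc k) t = (\<Sum>l\<le>k. real (k choose l) * X (Suc (k - l)) t * G l t)"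
    and X: "\<And>r. r \<ge> 1 \<Longrightarrow> ((\<lambda>t. s t ^ r * X r t) \<longlongrightarrow> x r) F"
  shows "((\<lambda>t. s t ^ k * G k t) \<longlongrightarrow> bell_Y k x) F"
proof (induction k rule: less_induct)
  case (less k)
  show ?case
  proof (cases k)
    case 0
    thus ?thesis by (simp add: G0 bell_Y_0)
  next
    case (Suc k')
    have "((\<lambda>t. \<Sum>l\<le>k'. real (k' choose l) * (s t ^ Suc (k' - l) * X (Suc (k' - l)) t) * (s t ^ l * G l t)) \<longlongrightarrow>
       (\<Sum>l\<le>k'. real (k' choose l) * x (Suc (k' - l)) * bell_Y l x)) F"
      by (intro tendsto_sum tendsto_mult tendsto_const X less) (use Suc in auto)
    thus ?thesis unfolding Suc bell_Y_Suc
    proof (rule Lim_transform_eventually)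
      show "\<forall>\<^sub>F t in F. (\<Sum>l\<le>k'. real (k' choose l) * (s t ^ Suc (k' - l) * X (Suc (k' - l)) t) * (s t ^ l * G l t)) = s t ^ Suc k' * G (Suc k') t"
        using G
      proof eventually_elim
        case (elim t)
        have "(\<Sum>l\<le>k'. real (k' choose l) * (s t ^ Suc (k' - l) * X (Suc (k' - l)) t) * (s t ^ l * G l t)) =
          (\<Sum>l\<le>k'. s t ^ Suc k' * (real (k' choose l) * X (Suc (k' - l)) t * G l t))"
        proof (intro sum.cong refl)
          fix l assume "l \<in> {..k'}"
          hence "Suc k' = Suc (k' - l) + l" by simp
          hence "s t ^ Suc k' = s t ^ Suc (k' - l) * s t ^ l" by (metis power_add)
          thus "real (k' choose l) * (s t ^ Suc (k' - l) * X (Suc (k' - l)) t) * (s t ^ l * G l t) =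
            s t ^ Suc k' * (real (k' choose l) * X (Suc (k' - l)) t * G l t)" by (simp only: mult_ac)
        qed
        also have "\<dots> = s t ^ Suc k' * G (Suc k') t" using elim by (simp only: sum_distrib_left)
        finally show ?case .
      qed
    qed
  qed
qed

lemma bell_Y_pos:
  assumes "\<And>j. j \<ge> 1 \<Longrightarrow> x j > 0"
  shows "bell_Y k x > 0"
proof (induction k rule: less_induct)
  case (less k)
  show ?case
  proof (cases k)
    case (Suc k')
    show ?thesis unfolding Suc bell_Y_Suc
      by (intro sum_pos mult_pos_pos assms less) (auto simp: Suc)
  qed (simp add: bell_Y_0)
qed

section \<open>Expansions at the origin\<close>

lemma tannery_at_right:
  fixes a :: "nat \<Rightarrow> real \<Rightarrow> real"
  assumes "\<And>k. ((\<lambda>t. a k t) \<longlongrightarrow> b k) (at_right 0)"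
    and "\<And>k t. t > 0 \<Longrightarrow> \<bar>a k t\<bar> \<le> M k" and "summable M"
  shows "((\<lambda>t. \<Sum>k. a k t) \<longlongrightarrow> (\<Sum>k. b k)) (at_right 0)"
proof -
  have "eventually (\<lambda>(k, t). norm (a k t) \<le> M k) (at_top \<times>\<^sub>F at_right 0)"
    using eventually_prodI[OF always_eventually[of "\<lambda>_. True"] eventually_at_right_less[of "0::real"], of at_top]
    by (auto elim!: eventually_mono simp: assms(2))
  from tannerys_theorem[OF assms(1) this assms(3)] show ?thesis by simp
qed

lemma summable_inverse_powr:
  assumes "s > 1"
  shows "summable (\<lambda>j. C * real (Suc j) powr (- s))"
  using assms summable_real_powr_iff[of "-s"] summable_Suc_iff[of "\<lambda>j. real j powr (-s)"]
  by (intro summable_mult) simp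

lemma riemann_zeta_eq: "riemann_zeta s = (\<Sum>j. real (Suc j) powr (- s))"
  by (simp add: riemann_zeta_def powr_minus divide_inverse)

lemma riemann_zeta_pos:
  assumes "s > 1"
  shows "riemann_zeta s > 0"
  unfolding riemann_zeta_eq
  using summable_inverse_powr[OF assms, of 1] by (intro suminf_pos) auto

text \<open>Termwise, \<open>t powr s * f (j t)\<close> tends to \<open>B j^(- s)\<close> under the
  summable majorant \<open>C j^(- s)\<close>, so Tannery's theorem applies. The bound on
  \<open>f\<close> is required for all positive \<open>t\<close>, because the multiples
  \<open>j t\<close> leave every neighbourhood of 0.\<close>

lemma dilation_sum:
  fixes f :: "real \<Rightarrow> real"
  assumes s: "s > 1" and f: "\<And>t. t > 0 \<Longrightarrow> \<bar>f t\<bar> \<le> C * t powr (- s)"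
    and lim: "((\<lambda>t. t powr s * f t) \<longlongrightarrow> B) (at_right 0)"
  shows "t > 0 \<Longrightarrow> summable (\<lambda>j. f (real (Suc j) * t))"
    and "((\<lambda>t. t powr s * (\<Sum>j. f (real (Suc j) * t))) \<longlongrightarrow> B * riemann_zeta s) (at_right 0)"
proof -
  have bd: "t powr s * \<bar>f (real (Suc j) * t)\<bar> \<le> C * real (Suc j) powr (- s)" if t: "t > 0" for j t
  proof -
    have "t powr s * \<bar>f (real (Suc j) * t)\<bar> \<le> t powr s * (C * (real (Suc j) * t) powr (- s))"
      by (intro mult_left_mono f) (use t in auto)
    also have "\<dots> = C * real (Suc j) powr (- s)" using t by (simp add: powr_mult powr_minus field_simps del: of_nat_Suc)
    finally show ?thesis .
  qed
  show sm: "summable (\<lambda>j. f (real (Suc j) * t))" if t: "t > 0" for t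
  proof (rule summable_comparison_test'[OF summable_inverse_powr[OF s, of "C / t powr s"]])
    show "norm (f (real (Suc j) * t)) \<le> C / t powr s * real (Suc j) powr (- s)" for j
      using bd[OF t, of j] t by (simp add: field_simps del: of_nat_Suc)
  qed
  have "((\<lambda>t. \<Sum>j. t powr s * f (real (Suc j) * t)) \<longlongrightarrow> (\<Sum>j. B * real (Suc j) powr (- s))) (at_right 0)"
  proof (rule tannery_at_right[OF _ _ summable_inverse_powr[OF s, of C]])
    fix j
    define c where "c = real (Suc j)"
    have c: "c > 0" by (simp add: c_def)
    have "filterlim (\<lambda>t. c * t) (at_right 0) (at_right 0)" using c by real_asymp
    from tendsto_mult[OF filterlim_compose[OF lim this] tendsto_const, of "c powr (- s)"]
    have "((\<lambda>t. (c * t) powr s * f (c * t) * c powr (- s)) \<longlongrightarrow> B * c powr (- s)) (at_right 0)" .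
    moreover have "\<forall>\<^sub>F t in at_right 0. (c * t) powr s * f (c * t) * c powr (- s) = t powr s * f (c * t)"
      using eventually_at_right_less[of 0]
      by eventually_elim (use c in \<open>simp add: powr_mult powr_minus field_simps\<close>)
    ultimately show "((\<lambda>t. t powr s * f (real (Suc j) * t)) \<longlongrightarrow> B * real (Suc j) powr (- s)) (at_right 0)"
      unfolding c_def by (rule Lim_transform_eventually)
    show "\<bar>t powr s * f (real (Suc j) * t)\<bar> \<le> C * real (Suc j) powr (- s)" if "t > 0" for t
      using bd[OF that, of j] by (simp add: abs_mult)
  qed
  also have "(\<Sum>j. B * real (Suc j) powr (- s)) = B * riemann_zeta s"
    unfolding riemann_zeta_eq using summable_inverse_powr[OF s, of 1] by (intro suminf_mult) simp
  finally show "((\<lambda>t. t powr s * (\<Sum>j. f (real (Suc j) * t))) \<longlongrightarrow> B * riemann_zeta s) (at_right 0)"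
  proof (rule Lim_transform_eventually)
    show "\<forall>\<^sub>F t in at_right 0. (\<Sum>j. t powr s * f (real (Suc j) * t)) = t powr s * (\<Sum>j. f (real (Suc j) * t))"
      using eventually_at_right_less[of 0] by eventually_elim (rule suminf_mult[OF sm])
  qed
qed

lemma powr_exp_bounded:
  fixes s :: real
  assumes "s \<ge> 0"
  shows "\<exists>K>0. \<forall>t\<ge>0. t powr s * exp (- t) \<le> K"
proof -
  have "((\<lambda>t. t powr s * exp (- t)) \<longlongrightarrow> 0) at_top" by real_asymp
  from order_tendstoD(2)[OF this zero_less_one] obtain T where T: "\<And>t. t \<ge> T \<Longrightarrow> t powr s * exp (- t) < 1"
    by (auto simp: eventually_at_top_linorder)
  have "t powr s * exp (- t) \<le> max 1 T powr s + 1" if t: "t \<ge> 0" for t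
  proof (cases "t \<ge> T")
    case True
    thus ?thesis using T[of t] by (smt (verit) powr_ge_zero)
  next
    case False
    hence "t powr s * exp (- t) \<le> max 1 T powr s * 1" using t assms
      by (intro mult_mono powr_mono2) auto
    thus ?thesis by simp
  qed
  moreover have "max 1 T powr s + 1 > 0" by (simp add: add_nonneg_pos)
  ultimately show ?thesis by blast
qed

section \<open>The polylogarithms of order \<open>- r\<close> at \<open>exp (- y)\<close>\<close>

definition psi :: "nat \<Rightarrow> real \<Rightarrow> real" where
  "psi r y = (\<Sum>j. real (Suc j) ^ r * exp (- (real (Suc j) * y)))"

text \<open>In contrast to powers, rising factorials have a generating function in one closed term;
  the chain \<open>(j + 1)^r \<le> (j + 1) ... (j + r) \<le> (j + r)^r\<close> will squeeze
  \<open>psi\<close> between two such series.\<close>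

lemma negbin_sums:
  assumes "y > 0"
  shows "(\<lambda>j. fact r * real ((j + r) choose r) * exp (- (real j * y))) sums (fact r * (1 - exp (- y)) powr (- real (Suc r)))"
proof -
  have "pochhammer (real (Suc r)) j / fact j = real ((j + r) choose r)" for j
  proof -
    have "pochhammer (real (Suc r)) j = fact (j + r) / fact r"
      using pochhammer_fact[of "j + r", where 'a = real] pochhammer_product'[of "1::real" r j]
      by (simp add: pochhammer_fact[symmetric] add.commute)
    moreover have "real ((j + r) choose r) = fact (j + r) / (fact r * fact j)"
      using binomial_fact[of r "j + r", where 'a = real] by simp
    ultimately show ?thesis by simp
  qed
  moreover have "lap_conv (\<lambda>m. 1 * pochhammer (real (Suc r)) m / fact m)" "lap (\<lambda>m. 1 * pochhammer (real (Suc r)) m / fact m) y = 1 * (1 - exp (-y)) powr (- real (Suc r))"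
    using lap_conv_pochhammer[of "real (Suc r)" 1] assms by (auto simp del: of_nat_Suc)
  ultimately have "(\<lambda>j. real ((j + r) choose r) * exp (- (real j * y))) sums ((1 - exp (- y)) powr (- real (Suc r)))"
    using lap_convD(2)[OF _ assms] by (simp add: lap_def sums_iff)
  thus ?thesis using sums_mult[of _ _ "fact r :: real"] by (simp add: mult.assoc)
qed

lemma power_le_fact_binomial: "real (Suc j) ^ r \<le> fact r * real ((j + r) choose r)"
proof -
  have "real (Suc j) ^ r = (\<Prod>i=0..<r. real (Suc j))" by simp
  also have "\<dots> \<le> (\<Prod>i=0..<r. real (Suc j) + real i)" by (intro prod_mono) auto
  also have "\<dots> = pochhammer (real (Suc j)) r" by (simp add: pochhammer_prod)
  also have "\<dots> = fact (j + r) / fact j"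
    using pochhammer_product'[of "1::real" j r] by (simp add: pochhammer_fact[symmetric])
  also have "\<dots> = fact r * real ((j + r) choose r)"
    using binomial_fact[of r "j + r", where 'a = real] by simp
  finally show ?thesis .
qed

lemma fact_binomial_le_power: "fact r * real ((j + r) choose r) \<le> real (j + r) ^ r"
proof -
  have "fact r * ((j + r) choose r) \<le> (j + r) ^ r"
    using binomial_fact_pow[of "j + r" r] by (simp add: mult.commute)
  hence "real (fact r * ((j + r) choose r)) \<le> real ((j + r) ^ r)" by (simp only: of_nat_le_iff)
  thus ?thesis by (simp del: of_nat_add)
qed

lemma psi_summable: "y > 0 \<Longrightarrow> summable (\<lambda>j. real (Suc j) ^ r * exp (- (real (Suc j) * y)))"
proof (rule summable_comparison_test')
  assume y: "y > 0"
  show "summable (\<lambda>j. exp (- y) * (fact r * real ((j + r) choose r) * exp (- (real j * y))))"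
    using negbin_sums[OF y, of r] by (intro summable_mult) (simp add: sums_iff)
  fix j
  have "real (Suc j) ^ r * exp (- (real (Suc j) * y)) \<le> (fact r * real ((j + r) choose r)) * exp (- (real (Suc j) * y))"
    by (intro mult_right_mono power_le_fact_binomial) auto
  moreover have "exp (- (real (Suc j) * y)) = exp (- y) * exp (- (real j * y))"
    by (simp add: exp_add[symmetric] algebra_simps)
  ultimately have "real (Suc j) ^ r * exp (- (real (Suc j) * y)) \<le> exp (- y) * (fact r * real ((j + r) choose r) * exp (- (real j * y)))"
    by (simp only: mult_ac)
  thus "norm (real (Suc j) ^ r * exp (- (real (Suc j) * y))) \<le> exp (- y) * (fact r * real ((j + r) choose r) * exp (- (real j * y)))"
    by (simp del: of_nat_Suc)
qed

lemma psi_nonneg: "y > 0 \<Longrightarrow> psi r y \<ge> 0"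
  unfolding psi_def by (intro suminf_nonneg psi_summable) auto

lemma psi_upper:
  assumes y: "y > 0"
  shows "psi r y \<le> fact r * exp (- y) * (1 - exp (- y)) powr (- real (Suc r))"
proof -
  have s: "(\<lambda>j. exp (- y) * (fact r * real ((j + r) choose r) * exp (- (real j * y)))) sums (exp (- y) * (fact r * (1 - exp (- y)) powr (- real (Suc r))))"
    by (intro sums_mult negbin_sums y)
  have "psi r y \<le> (\<Sum>j. exp (- y) * (fact r * real ((j + r) choose r) * exp (- (real j * y))))"
    unfolding psi_def
  proof (intro suminf_le psi_summable y)
    fix j
    have "real (Suc j) ^ r * exp (- (real (Suc j) * y)) \<le> (fact r * real ((j + r) choose r)) * exp (- (real (Suc j) * y))"
      by (intro mult_right_mono power_le_fact_binomial) auto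
    moreover have "exp (- (real (Suc j) * y)) = exp (- y) * exp (- (real j * y))"
      by (simp add: exp_add[symmetric] algebra_simps)
    ultimately show "real (Suc j) ^ r * exp (- (real (Suc j) * y)) \<le> exp (- y) * (fact r * real ((j + r) choose r) * exp (- (real j * y)))"
      by (simp only: mult_ac)
  qed (use s in \<open>simp add: sums_iff\<close>)
  also have "\<dots> = fact r * exp (- y) * (1 - exp (- y)) powr (- real (Suc r))" using s by (simp add: sums_iff)
  finally show ?thesis .
qed

text \<open>The upper estimate of the rising factorial involves \<open>j + r\<close>, so the series
  is compared with \<open>psi\<close> shifted by \<open>r\<close>. The first \<open>r\<close> terms
  are dropped, and the shift costs the factor \<open>exp (- ((r + 1) y))\<close>.\<close>

lemma psi_lower:
  assumes y: "y > 0"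
  shows "fact r * exp (- (real (Suc r) * y)) * (1 - exp (- y)) powr (- real (Suc r)) \<le> psi r y"
proof -
  define e where "e = exp (- (real (Suc r) * y))"
  have s: "(\<lambda>j. e * (fact r * real ((j + r) choose r) * exp (- (real j * y)))) sums (e * (fact r * (1 - exp (- y)) powr (- real (Suc r))))"
    by (intro sums_mult negbin_sums y)
  have sm: "summable (\<lambda>j. real (Suc (j + r)) ^ r * exp (- (real (Suc (j + r)) * y)))"
    using summable_ignore_initial_segment[OF psi_summable[OF y, of r], of r] .
  have "fact r * e * (1 - exp (- y)) powr (- real (Suc r)) = (\<Sum>j. e * (fact r * real ((j + r) choose r) * exp (- (real j * y))))"
    using s by (simp add: sums_iff)
  also have "\<dots> \<le> (\<Sum>j. real (Suc (j + r)) ^ r * exp (- (real (Suc (j + r)) * y)))"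
  proof (intro suminf_le sm)
    fix j
    have "fact r * real ((j + r) choose r) \<le> real (j + r) ^ r" by (rule fact_binomial_le_power)
    also have "\<dots> \<le> real (Suc (j + r)) ^ r" by (intro power_mono) auto
    finally have "(fact r * real ((j + r) choose r)) * exp (- (real (Suc (j + r)) * y)) \<le> real (Suc (j + r)) ^ r * exp (- (real (Suc (j + r)) * y))"
      by (intro mult_right_mono) auto
    also have "(fact r * real ((j + r) choose r)) * exp (- (real (Suc (j + r)) * y)) = e * (fact r * real ((j + r) choose r) * exp (- (real j * y)))"
    proof -
      have "exp (- (real (Suc (j + r)) * y)) = e * exp (- (real j * y))"
        by (simp add: e_def exp_add[symmetric] algebra_simps)
      thus ?thesis by (simp only: mult_ac)
    qed
    finally show "e * (fact r * real ((j + r) choose r) * exp (- (real j * y))) \<le> real (Suc (j + r)) ^ r * exp (- (real (Suc (j + r)) * y))" .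
  qed (use s in \<open>simp add: sums_iff\<close>)
  also have "\<dots> = psi r y - (\<Sum>j<r. real (Suc j) ^ r * exp (- (real (Suc j) * y)))"
    unfolding psi_def by (rule suminf_minus_initial_segment[OF psi_summable[OF y]])
  also have "\<dots> \<le> psi r y" by (simp add: sum_nonneg)
  finally show ?thesis by (simp add: e_def)
qed

lemma psi_limit: "((\<lambda>y. y ^ Suc r * psi r y) \<longlongrightarrow> fact r) (at_right 0)"
proof (rule tendsto_sandwich)
  have pw: "y ^ Suc r = y powr real (Suc r)" if "y > 0" for y :: real
    using that by (simp only: powr_realpow)
  define R where "R = real (Suc r)"
  have 1: "((\<lambda>y. y powr R * (fact r * exp (- (R * y)) * (1 - exp (- y)) powr (- R))) \<longlongrightarrow> fact r) (at_right 0)"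
    by real_asymp
  have 2: "((\<lambda>y. y powr R * (fact r * exp (- y) * (1 - exp (- y)) powr (- R))) \<longlongrightarrow> fact r) (at_right 0)"
    by real_asymp
  show "((\<lambda>y. y powr R * (fact r * exp (- (R * y)) * (1 - exp (- y)) powr (- R))) \<longlongrightarrow> fact r) (at_right 0)" by (rule 1)
  show "((\<lambda>y. y powr R * (fact r * exp (- y) * (1 - exp (- y)) powr (- R))) \<longlongrightarrow> fact r) (at_right 0)" by (rule 2)
  show "\<forall>\<^sub>F y in at_right 0. y powr R * (fact r * exp (- (R * y)) * (1 - exp (- y)) powr (- R)) \<le> y ^ Suc r * psi r y"
    using eventually_at_right_less[of 0]
  proof eventually_elim
    case (elim y)
    show ?case unfolding pw[OF elim] R_def[symmetric] using psi_lower[OF elim, of r]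
      by (intro mult_left_mono) (auto simp: R_def)
  qed
  show "\<forall>\<^sub>F y in at_right 0. y ^ Suc r * psi r y \<le> y powr R * (fact r * exp (- y) * (1 - exp (- y)) powr (- R))"
    using eventually_at_right_less[of 0]
  proof eventually_elim
    case (elim y)
    show ?case unfolding pw[OF elim] R_def[symmetric] using psi_upper[OF elim, of r]
      by (intro mult_left_mono) (auto simp: R_def)
  qed
qed

text \<open>A bound for all \<open>y\<close>, as the majorant must cover every argument
  \<open>L i * t\<close>. From \<open>1 + y \<le> exp y\<close> follows
  \<open>y \<le> (1 + y) (1 - exp (- y))\<close>, so the singular factor costs only a power of
  \<open>1 + y\<close>, which \<open>exp (- y)\<close> absorbs.\<close>

lemma psi_bounded: "\<exists>K>0. \<forall>y>0. y ^ Suc r * psi r y \<le> K"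
proof -
  define R where "R = real (Suc r)"
  obtain K where K: "K > 0" "\<And>t. t \<ge> 0 \<Longrightarrow> t powr R * exp (- t) \<le> K"
    using powr_exp_bounded[of R] by (auto simp: R_def)
  have "y ^ Suc r * psi r y \<le> fact r * exp 1 * K" if y: "y > 0" for y :: real
  proof -
    have "1 + y \<le> exp y" by (rule exp_ge_add_one_self)
    hence "exp (- y) \<le> inverse (1 + y)" using y unfolding exp_minus by (intro le_imp_inverse_le) auto
    hence "y / (1 + y) \<le> 1 - exp (- y)" using y by (simp add: field_simps)
    hence "y \<le> (1 + y) * (1 - exp (- y))" using y by (simp add: field_simps)
    hence "y powr R \<le> ((1 + y) * (1 - exp (- y))) powr R" using y by (intro powr_mono2) (auto simp: R_def)
    also have "\<dots> = (1 + y) powr R * (1 - exp (- y)) powr R" using y by (simp add: powr_mult)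
    finally have yR: "y powr R * (1 - exp (- y)) powr (- R) \<le> (1 + y) powr R"
      using y by (simp add: powr_minus field_simps)
    have "y ^ Suc r * psi r y = y powr R * psi r y" using y by (simp only: powr_realpow R_def)
    also have "\<dots> \<le> y powr R * (fact r * exp (- y) * (1 - exp (- y)) powr (- R))"
      unfolding R_def using y by (intro mult_left_mono psi_upper) auto
    also have "\<dots> = fact r * exp (- y) * (y powr R * (1 - exp (- y)) powr (- R))" by simp
    also have "\<dots> \<le> fact r * exp (- y) * (1 + y) powr R" by (intro mult_left_mono yR) auto
    also have "\<dots> = fact r * exp 1 * ((1 + y) powr R * exp (- (1 + y)))"
      by (simp add: exp_diff exp_minus field_simps)
    also have "\<dots> \<le> fact r * exp 1 * K" using y by (intro mult_left_mono K) auto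
    finally show ?thesis .
  qed
  moreover have "fact r * exp 1 * K > 0" using K by simp
  ultimately show ?thesis by blast
qed

text \<open>Splits off a decaying factor, by which the sum of \<open>psi r (L i * t)\<close> over
  the positions can be compared with \<Theta>.\<close>

lemma psi_half:
  assumes "y > 0"
  shows "psi r y \<le> exp (- (y / 2)) * psi r (y / 2)"
proof -
  have y2: "y / 2 > 0" using assms by simp
  have "psi r y \<le> (\<Sum>j. exp (- (y / 2)) * (real (Suc j) ^ r * exp (- (real (Suc j) * (y / 2)))))"
    unfolding psi_def
  proof (intro suminf_le psi_summable assms summable_mult y2)
    fix j
    have "1 * (y / 2) \<le> real (Suc j) * (y / 2)" using assms by (intro mult_right_mono) auto
    moreover have "real (Suc j) * y = real (Suc j) * (y / 2) + real (Suc j) * (y / 2)" by simp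
    ultimately have "exp (- (real (Suc j) * y)) \<le> exp (- (y / 2)) * exp (- (real (Suc j) * (y / 2)))"
      unfolding exp_add[symmetric] exp_le_cancel_iff by linarith
    hence "real (Suc j) ^ r * exp (- (real (Suc j) * y)) \<le> real (Suc j) ^ r * (exp (- (y / 2)) * exp (- (real (Suc j) * (y / 2))))"
      by (intro mult_left_mono) auto
    thus "real (Suc j) ^ r * exp (- (real (Suc j) * y)) \<le> exp (- (y / 2)) * (real (Suc j) ^ r * exp (- (real (Suc j) * (y / 2))))"
      by (simp only: mult_ac)
  qed
  also have "\<dots> = exp (- (y / 2)) * psi r (y / 2)"
    unfolding psi_def by (rule suminf_mult[OF psi_summable[OF y2]])
  finally show ?thesis .
qed

text \<open>One half of the exponential \<open>exp (- (j y))\<close> absorbs \<open>(j y)^r\<close>,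
  the other half remains as the argument \<open>y / 2\<close>.\<close>

lemma psi_le_psi_0: "\<exists>K>0. \<forall>y>0. y ^ r * psi r y \<le> K * psi 0 (y / 2)"
proof -
  obtain K where K: "K > 0" "\<And>t. t \<ge> 0 \<Longrightarrow> t powr real r * exp (- t) \<le> K"
    using powr_exp_bounded[of "real r"] by auto
  have "y ^ r * psi r y \<le> 2 ^ r * K * psi 0 (y / 2)" if y: "y > 0" for y :: real
  proof -
    have y2: "y / 2 > 0" using y by simp
    have "y ^ r * psi r y = (\<Sum>j. y ^ r * (real (Suc j) ^ r * exp (- (real (Suc j) * y))))"
      unfolding psi_def by (rule suminf_mult[OF psi_summable[OF y], symmetric])
    also have "\<dots> \<le> (\<Sum>j. 2 ^ r * K * (real (Suc j) ^ 0 * exp (- (real (Suc j) * (y / 2)))))"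
    proof (intro suminf_le psi_summable y summable_mult y2)
      fix j
      define z where "z = real (Suc j) * (y / 2)"
      have z: "z > 0" using y by (simp add: z_def)
      have "z ^ r * exp (- z) \<le> K" using K(2)[of z] z by (simp add: powr_realpow)
      hence "2 ^ r * (z ^ r * exp (- z)) * exp (- z) \<le> 2 ^ r * K * exp (- z)" by (intro mult_right_mono mult_left_mono) auto
      moreover have "exp (- (real (Suc j) * y)) = exp (- z) * exp (- z)" by (simp add: z_def exp_add[symmetric])
      moreover have "y ^ r * real (Suc j) ^ r = 2 ^ r * z ^ r" by (simp add: z_def power_mult_distrib[symmetric] mult_ac del: of_nat_Suc)
      ultimately show "y ^ r * (real (Suc j) ^ r * exp (- (real (Suc j) * y))) \<le> 2 ^ r * K * (real (Suc j) ^ 0 * exp (- (real (Suc j) * (y / 2))))"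
        unfolding z_def[symmetric] by (simp add: mult.assoc[symmetric] del: of_nat_Suc)
    qed
    also have "\<dots> = 2 ^ r * K * psi 0 (y / 2)"
      unfolding psi_def by (rule suminf_mult[OF psi_summable[OF y2]])
    finally show ?thesis .
  qed
  moreover have "2 ^ r * K > 0" using K by simp
  ultimately show ?thesis by blast
qed

section \<open>\<Theta>, its derivative and the Lambert series near the origin\<close>

locale theta_seq = part_seq +
  fixes A \<mu> :: real
  assumes L_mono: "mono L"
    and theta_summable: "t > 0 \<Longrightarrow> summable (\<lambda>i. exp (- (real (L i) * t)))"
    and A_pos: "A > 0" and \<mu>_pos: "\<mu> > 0"
    and theta_lim: "((\<lambda>t. t powr \<mu> * theta L t) \<longlongrightarrow> A) (at_right 0)"
begin

lemma theta_eq: "theta L t = (\<Sum>i. exp (- (real (L i) * t)))"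
  by (simp add: theta_def)

lemma L_ge_1: "real (L i) \<ge> 1"
  using L_pos[of i] by linarith

lemma theta_nonneg: "t > 0 \<Longrightarrow> theta L t \<ge> 0"
  unfolding theta_eq by (intro suminf_nonneg theta_summable) auto

text \<open>Every element is at least 1, so each term of \<Theta> loses at least the factor
  \<open>exp (- (t - d))\<close> between \<open>d\<close> and \<open>t\<close>.\<close>

lemma theta_decay:
  assumes "0 < d" "d \<le> t"
  shows "theta L t \<le> exp (- (t - d)) * theta L d"
proof -
  have "theta L t \<le> (\<Sum>i. exp (- (t - d)) * exp (- (real (L i) * d)))"
    unfolding theta_eq
  proof (intro suminf_le theta_summable summable_mult)
    fix i
    have "1 * (t - d) \<le> real (L i) * (t - d)" using L_ge_1[of i] assms by (intro mult_right_mono) auto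
    hence "(t - d) + real (L i) * d \<le> real (L i) * t" by (simp add: algebra_simps)
    thus "exp (- (real (L i) * t)) \<le> exp (- (t - d)) * exp (- (real (L i) * d))"
      by (simp add: exp_add[symmetric])
  qed (use assms in auto)
  also have "\<dots> = exp (- (t - d)) * theta L d"
    unfolding theta_eq by (intro suminf_mult theta_summable assms)
  finally show ?thesis .
qed

text \<open>Near 0 the limit gives the bound, away from 0 the exponential decay does.
  \<open>dilation_sum\<close> needs it on the whole half-line.\<close>

lemma theta_bound: "\<exists>C>0. \<forall>t>0. theta L t \<le> C * t powr (- \<mu>)"
proof -
  have "\<forall>\<^sub>F t in at_right 0. t powr \<mu> * theta L t < A + 1"
    by (rule order_tendstoD(2)[OF theta_lim]) simp
  then obtain d0 where d0: "d0 > 0" "\<And>t. 0 < t \<Longrightarrow> t < d0 \<Longrightarrow> t powr \<mu> * theta L t < A + 1"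
    by (auto simp: eventually_at_right_field)
  define d where "d = d0 / 2"
  have d: "d > 0" "\<And>t. 0 < t \<Longrightarrow> t \<le> d \<Longrightarrow> t powr \<mu> * theta L t < A + 1" using d0 by (auto simp: d_def)
  obtain K where K: "K > 0" "\<And>t. t \<ge> 0 \<Longrightarrow> t powr \<mu> * exp (- t) \<le> K"
    using powr_exp_bounded[of \<mu>] \<mu>_pos by auto
  define C where "C = A + 1 + K * exp d * theta L d"
  have Kd: "K * exp d * theta L d \<ge> 0" using K theta_nonneg[OF d(1)] by simp
  have "t powr \<mu> * theta L t \<le> C" if t: "t > 0" for t
  proof (cases "t \<le> d")
    case True
    thus ?thesis using d(2)[OF t] Kd by (simp add: C_def)
  next
    case False
    have "t powr \<mu> * theta L t \<le> t powr \<mu> * (exp (- (t - d)) * theta L d)"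
      using theta_decay[OF d(1)] False by (intro mult_left_mono) auto
    also have "\<dots> = (t powr \<mu> * exp (- t)) * (exp d * theta L d)"
      by (simp add: exp_diff exp_minus field_simps)
    also have "\<dots> \<le> K * (exp d * theta L d)"
      using K(2)[of t] t theta_nonneg[OF d(1)] by (intro mult_right_mono) auto
    finally show ?thesis using A_pos by (simp add: C_def)
  qed
  hence "theta L t \<le> C * t powr (- \<mu>)" if "t > 0" for t
    using that by (simp add: powr_minus field_simps)
  moreover have "C > 0" using A_pos Kd by (simp add: C_def)
  ultimately show ?thesis by blast
qed

text \<open>At \<open>t = 1 / L i\<close> each of the first \<open>i + 1\<close> terms of \<Theta>
  is at least \<open>exp (- 1)\<close>, since \<open>L\<close> is nondecreasing. Hence
  \<open>i + 1 \<le> K (L i)^\<mu>\<close>, and the series is dominated by a multiple of that of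
  \<open>(i + 1)^(- s / \<mu>)\<close>.\<close>

lemma zeta_summable:
  assumes s: "s > \<mu>"
  shows "summable (\<lambda>i. real (L i) powr (- s))"
proof -
  obtain C where C: "C > 0" "\<And>t. t > 0 \<Longrightarrow> theta L t \<le> C * t powr (- \<mu>)"
    using theta_bound by blast
  define K where "K = exp 1 * C"
  have K: "K > 0" using C by (simp add: K_def)
  have bd: "real (Suc i) \<le> K * real (L i) powr \<mu>" for i
  proof -
    define t where "t = 1 / real (L i)"
    have Li: "real (L i) > 0" using L_pos[of i] by simp
    have t: "t > 0" using Li by (simp add: t_def)
    have "real (Suc i) * exp (- 1) = (\<Sum>l\<le>i. exp (- 1))" by simp
    also have "\<dots> \<le> (\<Sum>l\<le>i. exp (- (real (L l) * t)))"
    proof (intro sum_mono)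
      fix l assume "l \<in> {..i}"
      hence "real (L l) \<le> real (L i)" using monoD[OF L_mono, of l i] by simp
      thus "exp (- 1) \<le> exp (- (real (L l) * t))" using Li by (simp add: t_def)
    qed
    also have "\<dots> \<le> theta L t"
      unfolding theta_eq by (intro sum_le_suminf theta_summable t) auto
    also have "\<dots> \<le> C * t powr (- \<mu>)" by (rule C(2)[OF t])
    also have "t powr (- \<mu>) = real (L i) powr \<mu>" using Li by (simp add: t_def powr_divide powr_minus)
    finally show ?thesis by (simp add: K_def exp_minus field_simps del: of_nat_Suc)
  qed
  show ?thesis
  proof (rule summable_comparison_test'[OF summable_inverse_powr[of "s / \<mu>" "K powr (s / \<mu>)"]])
    show "s / \<mu> > 1" using s \<mu>_pos by simp
    fix i
    have Li: "real (L i) > 0" using L_pos[of i] by simp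
    have "(K * real (L i) powr \<mu>) powr (- (s / \<mu>)) \<le> real (Suc i) powr (- (s / \<mu>))"
      using bd[of i] s \<mu>_pos by (intro powr_mono2') auto
    also have "(K * real (L i) powr \<mu>) powr (- (s / \<mu>)) = K powr (- (s / \<mu>)) * real (L i) powr (- s)"
      using K \<mu>_pos by (simp add: powr_mult powr_powr)
    finally have "K powr (s / \<mu>) * (K powr (- (s / \<mu>)) * real (L i) powr (- s)) \<le> K powr (s / \<mu>) * real (Suc i) powr (- (s / \<mu>))"
      by (intro mult_left_mono) auto
    thus "norm (real (L i) powr (- s)) \<le> K powr (s / \<mu>) * real (Suc i) powr (- (s / \<mu>))"
      using K by (simp add: mult.assoc[symmetric] powr_add[symmetric])
  qed
qed

text \<open>Minus the derivative of \<open>\<Theta>\<close>; since \<open>\<Theta>\<close> is convex, its asymptotics follow from those of difference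
  quotients of \<open>\<Theta>\<close>.\<close>

definition theta1 :: "real \<Rightarrow> real" where
  "theta1 t = (\<Sum>i. real (L i) * exp (- (real (L i) * t)))"

lemma theta1_summable:
  assumes t: "t > 0"
  shows "summable (\<lambda>i. real (L i) * exp (- (real (L i) * t)))"
proof (rule summable_comparison_test')
  show "summable (\<lambda>i. 2 / t * exp (- (real (L i) * (t / 2))))"
    using t by (intro summable_mult theta_summable) simp
  fix i
  define z where "z = real (L i) * (t / 2)"
  have "z \<le> exp z" using exp_ge_add_one_self[of z] by linarith
  hence "z * exp (- z) \<le> 1" by (simp add: exp_minus field_simps)
  hence "2 / t * exp (- z) * (z * exp (- z)) \<le> 2 / t * exp (- z) * 1" using t by (intro mult_left_mono) auto
  moreover have "exp (- (real (L i) * t)) = exp (- z) * exp (- z)" by (simp add: z_def exp_add[symmetric])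
  ultimately show "norm (real (L i) * exp (- (real (L i) * t))) \<le> 2 / t * exp (- (real (L i) * (t / 2)))"
    unfolding z_def[symmetric] using t by (simp add: z_def mult_ac)
qed

lemma theta1_nonneg: "t > 0 \<Longrightarrow> theta1 t \<ge> 0"
  unfolding theta1_def by (intro suminf_nonneg theta1_summable) auto

lemma theta1_upper:
  assumes "0 < h" "h < t"
  shows "h * theta1 t \<le> theta L (t - h) - theta L t"
proof -
  have s: "summable (\<lambda>i. exp (- (real (L i) * (t - h))))" "summable (\<lambda>i. exp (- (real (L i) * t)))"
    using assms by (auto intro!: theta_summable)
  have "h * theta1 t = (\<Sum>i. h * (real (L i) * exp (- (real (L i) * t))))"
    unfolding theta1_def using assms by (intro suminf_mult[symmetric] theta1_summable) simp
  also have "\<dots> \<le> (\<Sum>i. exp (- (real (L i) * (t - h))) - exp (- (real (L i) * t)))"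
  proof (intro suminf_le summable_mult theta1_summable summable_diff s)
    fix i
    have "1 + real (L i) * h \<le> exp (real (L i) * h)" by (rule exp_ge_add_one_self)
    hence "(1 + real (L i) * h) * exp (- (real (L i) * t)) \<le> exp (real (L i) * h) * exp (- (real (L i) * t))"
      by (intro mult_right_mono) auto
    also have "\<dots> = exp (- (real (L i) * (t - h)))" by (simp add: exp_add[symmetric] algebra_simps)
    finally show "h * (real (L i) * exp (- (real (L i) * t))) \<le> exp (- (real (L i) * (t - h))) - exp (- (real (L i) * t))"
      by (simp add: algebra_simps)
  qed (use assms in auto)
  also have "\<dots> = theta L (t - h) - theta L t" unfolding theta_eq by (rule suminf_diff[OF s, symmetric])
  finally show ?thesis .
qed

lemma theta1_lower:
  assumes "0 < h" "0 < t"
  shows "theta L t - theta L (t + h) \<le> h * theta1 t"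
proof -
  have s: "summable (\<lambda>i. exp (- (real (L i) * (t + h))))" "summable (\<lambda>i. exp (- (real (L i) * t)))"
    using assms by (auto intro!: theta_summable)
  have "theta L t - theta L (t + h) = (\<Sum>i. exp (- (real (L i) * t)) - exp (- (real (L i) * (t + h))))"
    unfolding theta_eq by (rule suminf_diff[OF s(2,1)])
  also have "\<dots> \<le> (\<Sum>i. h * (real (L i) * exp (- (real (L i) * t))))"
  proof (intro suminf_le summable_mult theta1_summable summable_diff s)
    fix i
    have "1 - real (L i) * h \<le> exp (- (real (L i) * h))" using exp_ge_add_one_self[of "- (real (L i) * h)"] by simp
    hence "(1 - real (L i) * h) * exp (- (real (L i) * t)) \<le> exp (- (real (L i) * h)) * exp (- (real (L i) * t))"
      by (intro mult_right_mono) auto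
    also have "\<dots> = exp (- (real (L i) * (t + h)))" by (simp add: exp_add[symmetric] algebra_simps)
    finally show "exp (- (real (L i) * t)) - exp (- (real (L i) * (t + h))) \<le> h * (real (L i) * exp (- (real (L i) * t)))"
      by (simp add: algebra_simps)
  qed (use assms in auto)
  also have "\<dots> = h * theta1 t"
    unfolding theta1_def by (intro suminf_mult theta1_summable assms)
  finally show ?thesis .
qed

lemma theta_lim_scale:
  assumes c: "c > 0"
  shows "((\<lambda>t. t powr \<mu> * theta L (c * t)) \<longlongrightarrow> A * c powr (- \<mu>)) (at_right 0)"
proof -
  have "filterlim (\<lambda>t. c * t) (at_right 0) (at_right 0)" using c by real_asymp
  from tendsto_mult[OF filterlim_compose[OF theta_lim this] tendsto_const, of "c powr (- \<mu>)"]
  have "((\<lambda>t. (c * t) powr \<mu> * theta L (c * t) * c powr (- \<mu>)) \<longlongrightarrow> A * c powr (- \<mu>)) (at_right 0)" .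
  moreover have "\<forall>\<^sub>F t in at_right 0. (c * t) powr \<mu> * theta L (c * t) * c powr (- \<mu>) = t powr \<mu> * theta L (c * t)"
    using eventually_at_right_less[of 0]
    by eventually_elim (use c in \<open>simp add: powr_mult powr_minus field_simps\<close>)
  ultimately show ?thesis by (rule Lim_transform_eventually)
qed

lemma theta1_bound: "\<exists>C>0. \<forall>t>0. theta1 t \<le> C * t powr (- (\<mu> + 1))"
proof -
  obtain C where C: "C > 0" "\<And>t. t > 0 \<Longrightarrow> theta L t \<le> C * t powr (- \<mu>)"
    using theta_bound by blast
  have "theta1 t \<le> 2 * C * 2 powr \<mu> * t powr (- (\<mu> + 1))" if t: "t > 0" for t
  proof -
    have "t / 2 * theta1 t \<le> theta L (t - t / 2) - theta L t" by (rule theta1_upper) (use t in auto)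
    also have "\<dots> \<le> theta L (t / 2)" using theta_nonneg[OF t] by simp
    also have "\<dots> \<le> C * (t / 2) powr (- \<mu>)" by (rule C) (use t in auto)
    finally have "theta1 t \<le> 2 * (C * (t / 2) powr (- \<mu>)) / t" using t by (simp add: field_simps)
    also have "\<dots> = 2 * C * 2 powr \<mu> * (t powr (- \<mu>) / t powr 1)"
      using t by (simp add: powr_divide powr_minus field_simps)
    also have "t powr (- \<mu>) / t powr 1 = t powr (- (\<mu> + 1))"
      unfolding powr_diff[symmetric] by simp
    finally show ?thesis .
  qed
  moreover have "2 * C * 2 powr \<mu> > 0" using C by simp
  ultimately show ?thesis by blast
qed

text \<open>The difference quotients have step \<open>h t\<close>, proportional to \<open>t\<close>.
  For fixed \<open>h\<close> their scaled limits are \<open>A ((1 - h)^(- \<mu>) - 1) / h\<close>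
  for the upper and \<open>A (1 - (1 + h)^(- \<mu>)) / h\<close> for the lower estimate, and both
  tend to \<open>\<mu> A\<close> with \<open>h\<close>. So a small \<open>h\<close> is fixed before
  \<open>t\<close> tends to 0.\<close>

lemma theta1_lim: "((\<lambda>t. t powr (\<mu> + 1) * theta1 t) \<longlongrightarrow> \<mu> * A) (at_right 0)"
proof (rule order_tendstoI)
  fix y assume y: "y > \<mu> * A"
  have "((\<lambda>h. A * (((1 - h) powr (- \<mu>) - 1) / h)) \<longlongrightarrow> A * \<mu>) (at_right 0)"
    by (intro tendsto_mult tendsto_const) real_asymp
  moreover have "A * \<mu> < y" using y by (simp add: mult.commute)
  ultimately have "\<forall>\<^sub>F h in at_right 0. A * (((1 - h) powr (- \<mu>) - 1) / h) < y"
    by (rule order_tendstoD(2))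
  from this eventually_at_right_real[OF zero_less_one]
  have "\<forall>\<^sub>F h in at_right 0. A * (((1 - h) powr (- \<mu>) - 1) / h) < y \<and> h \<in> {0<..<1}"
    by (rule eventually_conj)
  from eventually_happens'[OF trivial_limit_at_right_real this]
  obtain h where h: "A * (((1 - h) powr (- \<mu>) - 1) / h) < y" "0 < h" "h < 1"
    unfolding greaterThanLessThan_iff by blast
  have "((\<lambda>t. (t powr \<mu> * theta L ((1 - h) * t) - t powr \<mu> * theta L t) / h) \<longlongrightarrow> (A * (1 - h) powr (- \<mu>) - A) / h) (at_right 0)"
    using h by (intro tendsto_intros theta_lim_scale theta_lim) auto
  moreover have "(A * (1 - h) powr (- \<mu>) - A) / h < y" using h(1) by (simp add: right_diff_distrib)
  ultimately have "\<forall>\<^sub>F t in at_right 0. (t powr \<mu> * theta L ((1 - h) * t) - t powr \<mu> * theta L t) / h < y"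
    by (rule order_tendstoD(2))
  thus "\<forall>\<^sub>F t in at_right 0. t powr (\<mu> + 1) * theta1 t < y"
    using eventually_at_right_less[of 0]
  proof eventually_elim
    case (elim t)
    have eq: "t - h * t = (1 - h) * t" by (simp add: algebra_simps)
    have "(h * t) * theta1 t \<le> theta L (t - h * t) - theta L t" by (rule theta1_upper) (use h elim in auto)
    hence "t powr \<mu> * ((h * t) * theta1 t) \<le> t powr \<mu> * (theta L (t - h * t) - theta L t)" by (intro mult_left_mono) auto
    note this[unfolded eq]
    hence "t powr \<mu> * t * theta1 t \<le> (t powr \<mu> * theta L ((1 - h) * t) - t powr \<mu> * theta L t) / h"
      unfolding pos_le_divide_eq[OF h(2)] by (simp only: right_diff_distrib mult_ac)
    thus ?case using elim by (simp add: powr_add)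
  qed
next
  fix y assume y: "y < \<mu> * A"
  have "((\<lambda>h. A * ((1 - (1 + h) powr (- \<mu>)) / h)) \<longlongrightarrow> A * \<mu>) (at_right 0)"
    by (intro tendsto_mult tendsto_const) real_asymp
  moreover have "y < A * \<mu>" using y by (simp add: mult.commute)
  ultimately have "\<forall>\<^sub>F h in at_right 0. A * ((1 - (1 + h) powr (- \<mu>)) / h) > y"
    by (rule order_tendstoD(1))
  from this eventually_at_right_less[of 0]
  have "\<forall>\<^sub>F h in at_right 0. A * ((1 - (1 + h) powr (- \<mu>)) / h) > y \<and> h > 0"
    by (rule eventually_conj)
  from eventually_happens'[OF trivial_limit_at_right_real this]
  obtain h where h: "A * ((1 - (1 + h) powr (- \<mu>)) / h) > y" "0 < h"
    by blast
  have "((\<lambda>t. (t powr \<mu> * theta L t - t powr \<mu> * theta L ((1 + h) * t)) / h) \<longlongrightarrow> (A - A * (1 + h) powr (- \<mu>)) / h) (at_right 0)"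
    using h by (intro tendsto_intros theta_lim_scale theta_lim) auto
  moreover have "(A - A * (1 + h) powr (- \<mu>)) / h > y" using h(1) by (simp add: right_diff_distrib)
  ultimately have "\<forall>\<^sub>F t in at_right 0. (t powr \<mu> * theta L t - t powr \<mu> * theta L ((1 + h) * t)) / h > y"
    by (rule order_tendstoD(1))
  thus "\<forall>\<^sub>F t in at_right 0. t powr (\<mu> + 1) * theta1 t > y"
    using eventually_at_right_less[of 0]
  proof eventually_elim
    case (elim t)
    have eq: "t + h * t = (1 + h) * t" by (simp add: algebra_simps)
    have "theta L t - theta L (t + h * t) \<le> (h * t) * theta1 t" by (rule theta1_lower) (use h elim in auto)
    hence "t powr \<mu> * (theta L t - theta L (t + h * t)) \<le> t powr \<mu> * ((h * t) * theta1 t)" by (intro mult_left_mono) auto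
    note this[unfolded eq]
    hence "(t powr \<mu> * theta L t - t powr \<mu> * theta L ((1 + h) * t)) / h \<le> t powr \<mu> * t * theta1 t"
      unfolding pos_divide_le_eq[OF h(2)] by (simp only: right_diff_distrib mult_ac)
    thus ?case using elim by (simp add: powr_add)
  qed
qed

text \<open>Summing over the positions first gives the sum of \<open>theta1 (j t)\<close> over
  \<open>j \<ge> 1\<close>, and the dilation argument contributes the factor
  \<open>\<zeta>(\<mu> + 1)\<close>. The limit is the constant \<open>D\<close> of the saddle
  point.\<close>

lemma \<sigma>_lap:
  shows "lap_conv (fps_nth \<sigma>)"
    and "((\<lambda>t. t powr (\<mu> + 1) * lap (fps_nth \<sigma>) t) \<longlongrightarrow> \<mu> * A * riemann_zeta (\<mu> + 1)) (at_right 0)"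
proof -
  obtain C where C: "C > 0" "\<And>t. t > 0 \<Longrightarrow> theta1 t \<le> C * t powr (- (\<mu> + 1))"
    using theta1_bound by blast
  have C': "\<bar>theta1 t\<bar> \<le> C * t powr (- (\<mu> + 1))" if "t > 0" for t
    using C(2)[OF that] theta1_nonneg[OF that] by simp
  have \<mu>1: "\<mu> + 1 > 1" using \<mu>_pos by simp
  note ds = dilation_sum[OF \<mu>1 C' theta1_lim]
  have S: "(\<lambda>i. real (L i) * exp (- (real (Suc j) * (real (L i) * t)))) sums theta1 (real (Suc j) * t)" if "t > 0" for j t
  proof -
    have "real (Suc j) * t > 0" using that by simp
    from theta1_summable[OF this] show ?thesis
      by (simp add: theta1_def sums_iff mult_ac del: of_nat_Suc)
  qed
  show "lap_conv (fps_nth \<sigma>)" unfolding \<sigma>_def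
    by (rule lap_coef_outer_j(1)[OF _ S]) (use ds(1) in auto)
  have "(\<lambda>j. theta1 (real (Suc j) * t)) sums lap (fps_nth \<sigma>) t" if "t > 0" for t
    unfolding \<sigma>_def by (rule lap_coef_outer_j(2)[OF _ S]) (use ds(1) that in auto)
  hence "\<forall>\<^sub>F t in at_right 0. t powr (\<mu> + 1) * (\<Sum>j. theta1 (real (Suc j) * t)) = t powr (\<mu> + 1) * lap (fps_nth \<sigma>) t"
    using eventually_at_right_less[of 0] by (auto simp: sums_iff elim!: eventually_mono)
  from Lim_transform_eventually[OF ds(2) this]
  show "((\<lambda>t. t powr (\<mu> + 1) * lap (fps_nth \<sigma>) t) \<longlongrightarrow> \<mu> * A * riemann_zeta (\<mu> + 1)) (at_right 0)" .
qed

lemma divisor_fps_lap: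
  shows "lap_conv (fps_nth (divisor_fps r))"
    and "t > 0 \<Longrightarrow> (\<lambda>i. psi r (real (L i) * t)) sums lap (fps_nth (divisor_fps r)) t"
proof -
  have S: "(\<lambda>j. real (Suc j) ^ r * exp (- (real (Suc j) * (real (L i) * t)))) sums psi r (real (L i) * t)" if "t > 0" for i t
  proof -
    have "real (L i) * t > 0" using that L_pos[of i] by simp
    from psi_summable[OF this] show ?thesis by (simp add: psi_def sums_iff)
  qed
  obtain K where K: "K > 0" "\<And>y. y > 0 \<Longrightarrow> y ^ Suc r * psi r y \<le> K" using psi_bounded[of r] by blast
  have sm: "summable (\<lambda>i. psi r (real (L i) * t))" if t: "t > 0" for t
  proof (rule summable_comparison_test')
    show "summable (\<lambda>i. K / (t / 2) ^ Suc r * exp (- (real (L i) * (t / 2))))"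
      using t by (intro summable_mult theta_summable) simp
    fix i
    have y: "real (L i) * t > 0" using t L_pos[of i] by simp
    have y2: "real (L i) * (t / 2) > 0" using t L_pos[of i] by simp
    have "(t / 2) ^ Suc r * psi r (real (L i) * (t / 2)) \<le> (real (L i) * (t / 2)) ^ Suc r * psi r (real (L i) * (t / 2))"
      using L_ge_1[of i] t by (intro mult_right_mono power_mono psi_nonneg y2) auto
    also have "\<dots> \<le> K" by (rule K(2)[OF y2])
    finally have p: "psi r (real (L i) * (t / 2)) \<le> K / (t / 2) ^ Suc r" using t by (simp add: field_simps)
    have "psi r (real (L i) * t) \<le> exp (- (real (L i) * (t / 2))) * psi r (real (L i) * (t / 2))"
      using psi_half[OF y, of r] by simp
    also have "\<dots> \<le> exp (- (real (L i) * (t / 2))) * (K / (t / 2) ^ Suc r)" by (intro mult_left_mono p) auto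
    finally show "norm (psi r (real (L i) * t)) \<le> K / (t / 2) ^ Suc r * exp (- (real (L i) * (t / 2)))"
      using psi_nonneg[OF y, of r] by (simp add: mult.commute)
  qed
  show "lap_conv (fps_nth (divisor_fps r))" unfolding divisor_fps_def
    by (rule lap_coef_outer_i(1)[OF _ S sm]) auto
  show "(\<lambda>i. psi r (real (L i) * t)) sums lap (fps_nth (divisor_fps r)) t" if t: "t > 0"
    unfolding divisor_fps_def by (rule lap_coef_outer_i(2)[OF _ S sm t]) auto
qed

text \<open>Every \<open>L i\<close> is at least 1, so \<open>t^r\<close> may be enlarged to
  \<open>(L i * t)^r\<close> and \<open>psi r\<close> traded for \<open>psi 0\<close>. For
  \<open>\<mu> \<ge> 1\<close> this makes the higher arguments of the Bell recursion
  negligible.\<close>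

lemma divisor_fps_lap_le: "\<exists>K>0. \<forall>t>0. t ^ r * lap (fps_nth (divisor_fps r)) t \<le> K * lap (fps_nth (divisor_fps 0)) (t / 2)"
proof -
  obtain K where K: "K > 0" "\<And>y. y > 0 \<Longrightarrow> y ^ r * psi r y \<le> K * psi 0 (y / 2)" using psi_le_psi_0[of r] by blast
  have "t ^ r * lap (fps_nth (divisor_fps r)) t \<le> K * lap (fps_nth (divisor_fps 0)) (t / 2)" if t: "t > 0" for t
  proof (rule sums_le)
    show "(\<lambda>i. t ^ r * psi r (real (L i) * t)) sums (t ^ r * lap (fps_nth (divisor_fps r)) t)"
      by (intro sums_mult divisor_fps_lap t)
    show "(\<lambda>i. K * psi 0 (real (L i) * (t / 2))) sums (K * lap (fps_nth (divisor_fps 0)) (t / 2))"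
      by (intro sums_mult divisor_fps_lap) (use t in simp)
    fix i
    have y: "real (L i) * t > 0" using t L_pos[of i] by simp
    have "t ^ r * psi r (real (L i) * t) \<le> (real (L i) * t) ^ r * psi r (real (L i) * t)"
      using L_ge_1[of i] t by (intro mult_right_mono power_mono psi_nonneg y) auto
    also have "\<dots> \<le> K * psi 0 (real (L i) * (t / 2))" using K(2)[OF y] by simp
    finally show "t ^ r * psi r (real (L i) * t) \<le> K * psi 0 (real (L i) * (t / 2))" .
  qed
  thus ?thesis using K by blast
qed

text \<open>Tannery's theorem with the majorant \<open>K (L i)^(- (r + 1))\<close>, summable because
  \<open>r + 1 > \<mu>\<close>. With \<open>j = r + 1\<close> these limits are the arguments
  \<open>(j - 1)! \<zeta>_\<Lambda>(j)\<close> of \<open>Y_k\<close>.\<close>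

lemma divisor_fps_lim:
  assumes "real (Suc r) > \<mu>"
  shows "((\<lambda>t. t ^ Suc r * lap (fps_nth (divisor_fps r)) t) \<longlongrightarrow> fact r * (\<Sum>i. real (L i) powr (- real (Suc r)))) (at_right 0)"
proof -
  obtain K where K: "K > 0" "\<And>y. y > 0 \<Longrightarrow> y ^ Suc r * psi r y \<le> K" using psi_bounded[of r] by blast
  note zs = zeta_summable[OF assms]
  have pw: "real (L i) powr (- real (Suc r)) = 1 / real (L i) ^ Suc r" for i
    using L_pos[of i] by (simp only: powr_minus powr_realpow of_nat_0_less_iff inverse_eq_divide)
  have "((\<lambda>t. \<Sum>i. t ^ Suc r * psi r (real (L i) * t)) \<longlongrightarrow> (\<Sum>i. fact r * real (L i) powr (- real (Suc r)))) (at_right 0)"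
  proof (rule tannery_at_right)
    show "summable (\<lambda>i. K * real (L i) powr (- real (Suc r)))" by (intro summable_mult zs)
    fix i
    define c where "c = real (L i)"
    have c: "c > 0" using L_pos[of i] by (simp add: c_def)
    have "filterlim (\<lambda>t. c * t) (at_right 0) (at_right 0)" using c by real_asymp
    from tendsto_mult[OF filterlim_compose[OF psi_limit[of r] this] tendsto_const, of "1 / c ^ Suc r"]
    have "((\<lambda>t. (c * t) ^ Suc r * psi r (c * t) * (1 / c ^ Suc r)) \<longlongrightarrow> fact r * (1 / c ^ Suc r)) (at_right 0)" .
    moreover have "(c * t) ^ Suc r * psi r (c * t) * (1 / c ^ Suc r) = t ^ Suc r * psi r (c * t)" for t
      using c by (simp add: power_mult_distrib)
    ultimately show "((\<lambda>t. t ^ Suc r * psi r (real (L i) * t)) \<longlongrightarrow> fact r * real (L i) powr (- real (Suc r))) (at_right 0)"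
      unfolding pw c_def by simp
    show "\<bar>t ^ Suc r * psi r (real (L i) * t)\<bar> \<le> K * real (L i) powr (- real (Suc r))" if t: "t > 0" for t
    proof -
      have y: "c * t > 0" using c t by simp
      have "c ^ Suc r * (t ^ Suc r * psi r (c * t)) \<le> K" using K(2)[OF y] by (simp add: power_mult_distrib mult_ac)
      hence "t ^ Suc r * psi r (c * t) \<le> K / c ^ Suc r" using c by (simp add: field_simps)
      thus ?thesis unfolding pw unfolding c_def[symmetric] using psi_nonneg[OF y, of r] t by simp
    qed
  qed
  also have "(\<Sum>i. fact r * real (L i) powr (- real (Suc r))) = fact r * (\<Sum>i. real (L i) powr (- real (Suc r)))"
    by (rule suminf_mult[OF zs])
  finally show ?thesis
  proof (rule Lim_transform_eventually)
    show "\<forall>\<^sub>F t in at_right 0. (\<Sum>i. t ^ Suc r * psi r (real (L i) * t)) = t ^ Suc r * lap (fps_nth (divisor_fps r)) t"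
      using eventually_at_right_less[of 0]
    proof eventually_elim
      case (elim t)
      have "(\<lambda>i. t ^ Suc r * psi r (real (L i) * t)) sums (t ^ Suc r * lap (fps_nth (divisor_fps r)) t)"
        by (intro sums_mult divisor_fps_lap elim)
      thus ?case by (simp only: sums_iff)
    qed
  qed
qed

text \<open>The positions are summed first. For \<open>\<mu> \<le> 1\<close> a bound of order
  \<open>t^(- \<mu>)\<close> is not summable over the multiples of \<open>t\<close>, so convergence
  is drawn from the exponential decay of \<Theta>.\<close>

lemma divisor_fps_0_sums:
  assumes t: "t > 0"
  shows "(\<lambda>j. theta L (real (Suc j) * t)) sums lap (fps_nth (divisor_fps 0)) t"
proof -
  have S: "(\<lambda>i. real (Suc j) ^ 0 * exp (- (real (Suc j) * (real (L i) * t)))) sums theta L (real (Suc j) * t)" if "t > 0" for j t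
  proof -
    have "real (Suc j) * t > 0" using that by simp
    from theta_summable[OF this] show ?thesis
      by (simp add: theta_eq sums_iff mult_ac del: of_nat_Suc)
  qed
  have sm: "summable (\<lambda>j. theta L (real (Suc j) * t))" if t: "t > 0" for t
  proof (rule summable_comparison_test')
    have "summable (\<lambda>j. real (Suc j) ^ 0 * exp (- (real (Suc j) * t)))" by (rule psi_summable[OF t])
    thus "summable (\<lambda>j. exp t * theta L t * exp (- (real (Suc j) * t)))" by (intro summable_mult) simp
    fix j
    have "1 * t \<le> real (Suc j) * t" using t by (intro mult_right_mono) auto
    hence "theta L (real (Suc j) * t) \<le> exp (- (real (Suc j) * t - t)) * theta L t"
      by (intro theta_decay t) simp
    also have "exp (- (real (Suc j) * t - t)) = exp t * exp (- (real (Suc j) * t))" by (simp add: exp_add[symmetric])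
    finally show "norm (theta L (real (Suc j) * t)) \<le> exp t * theta L t * exp (- (real (Suc j) * t))"
      using theta_nonneg[of "real (Suc j) * t"] t by (simp add: mult_ac)
  qed
  show ?thesis unfolding divisor_fps_def by (rule lap_coef_outer_j(2)[OF _ S sm t]) auto
qed

lemma divisor_fps_0_lim_gt_1:
  assumes "\<mu> > 1"
  shows "((\<lambda>t. t powr \<mu> * lap (fps_nth (divisor_fps 0)) t) \<longlongrightarrow> A * riemann_zeta \<mu>) (at_right 0)"
proof -
  obtain C where C: "C > 0" "\<And>t. t > 0 \<Longrightarrow> theta L t \<le> C * t powr (- \<mu>)"
    using theta_bound by blast
  have C': "\<bar>theta L t\<bar> \<le> C * t powr (- \<mu>)" if "t > 0" for t
    using C(2)[OF that] theta_nonneg[OF that] by simp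
  have "\<forall>\<^sub>F t in at_right 0. t powr \<mu> * (\<Sum>j. theta L (real (Suc j) * t)) = t powr \<mu> * lap (fps_nth (divisor_fps 0)) t"
    using eventually_at_right_less[of 0]
    by eventually_elim (use divisor_fps_0_sums in \<open>auto simp: sums_iff\<close>)
  from Lim_transform_eventually[OF dilation_sum(2)[OF assms C' theta_lim] this] show ?thesis by simp
qed

end

section \<open>The moments\<close>

lemma lap_fps_cmult:
  fixes f :: "real fps"
  assumes "lap_conv (fps_nth f)" "c \<ge> 0"
  shows "lap_conv (fps_nth (fps_const c * f))"
    and "t > 0 \<Longrightarrow> lap (fps_nth (fps_const c * f)) t = c * lap (fps_nth f) t"
proof -
  show "lap_conv (fps_nth (fps_const c * f))"
    unfolding lap_conv_def using lap_convD[OF assms(1)] assms(2)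
    by (auto simp: mult.assoc intro!: summable_mult)
  show "lap (fps_nth (fps_const c * f)) t = c * lap (fps_nth f) t" if t: "t > 0"
    using suminf_mult[OF lap_convD(2)[OF assms(1) t], of c] by (simp add: lap_def mult.assoc)
qed

lemma lap_fps_sum:
  fixes f :: "'a \<Rightarrow> real fps"
  assumes "\<And>i. i \<in> I \<Longrightarrow> lap_conv (fps_nth (f i))"
  shows "lap_conv (fps_nth (sum f I))"
    and "t > 0 \<Longrightarrow> lap (fps_nth (sum f I)) t = (\<Sum>i\<in>I. lap (fps_nth (f i)) t)"
proof -
  show "lap_conv (fps_nth (sum f I))"
    unfolding lap_conv_def fps_sum_nth using lap_convD[OF assms]
    by (auto simp: sum_distrib_right intro!: summable_sum sum_nonneg)
  show "lap (fps_nth (sum f I)) t = (\<Sum>i\<in>I. lap (fps_nth (f i)) t)" if t: "t > 0"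
    unfolding lap_def fps_sum_nth sum_distrib_right
    by (rule suminf_sum) (use lap_convD(2)[OF assms t] in auto)
qed

section \<open>The logarithmic case \<mu> = 1\<close>

context theta_seq
begin

text \<open>The sum of \<open>\<Theta>(j t)\<close> is split at \<open>j t = \<delta>\<close>.
  Below, \<open>t \<Theta>(j t)\<close> is within \<open>\<epsilon> / j\<close> of
  \<open>A / j\<close>, which adds up to \<open>A\<close> times a harmonic number of about
  \<open>\<delta> / t\<close> terms. Beyond, \<open>\<Theta>(j t) \<le> K exp (- (j t))\<close>, and
  the geometric series contributes at most \<open>K\<close> after multiplication by
  \<open>t\<close>. The harmonic number is asymptotic to \<open>ln (1 / t)\<close>.\<close>

lemma divisor_fps_0_lim_eq_1:
  assumes "\<mu> = 1"
  shows "((\<lambda>t. t * lap (fps_nth (divisor_fps 0)) t / ln (1 / t)) \<longlongrightarrow> A) (at_right 0)"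
proof (rule tendstoI)
  fix e :: real assume e: "e > 0"
  define \<epsilon> where "\<epsilon> = e / 4"
  have \<epsilon>: "\<epsilon> > 0" using e by (simp add: \<epsilon>_def)
  have "\<forall>\<^sub>F t in at_right 0. dist (t powr \<mu> * theta L t) A < \<epsilon>" by (rule tendstoD[OF theta_lim \<epsilon>])
  then obtain d where d: "d > 0" "\<And>t. 0 < t \<Longrightarrow> t < d \<Longrightarrow> \<bar>t * theta L t - A\<bar> < \<epsilon>"
    by (auto simp: eventually_at_right_field assms dist_real_def)
  define \<delta> where "\<delta> = d / 2"
  have \<delta>: "\<delta> > 0" "\<And>t. 0 < t \<Longrightarrow> t \<le> \<delta> \<Longrightarrow> \<bar>t * theta L t - A\<bar> < \<epsilon>" using d by (auto simp: \<delta>_def)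
  define K where "K = exp \<delta> * theta L \<delta>"
  have K: "K \<ge> 0" using theta_nonneg[OF \<delta>(1)] by (simp add: K_def)
  define N where "N t = nat \<lfloor>\<delta> / t\<rfloor>" for t
  have bound: "\<bar>t * lap (fps_nth (divisor_fps 0)) t - A * harm (N t)\<bar> \<le> \<epsilon> * harm (N t) + K" if t: "t > 0" for t
  proof -
    have Nt: "real (N t) \<le> \<delta> / t" "\<delta> / t < real (N t) + 1" using t \<delta> by (simp_all add: N_def)
    have s: "summable (\<lambda>j. theta L (real (Suc j) * t))" and l: "lap (fps_nth (divisor_fps 0)) t = (\<Sum>j. theta L (real (Suc j) * t))"
      using divisor_fps_0_sums[OF t] by (simp_all add: sums_iff)
    have head: "\<bar>(\<Sum>j<N t. t * theta L (real (Suc j) * t)) - A * harm (N t)\<bar> \<le> \<epsilon> * harm (N t)"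
    proof -
      have h: "harm (N t) = (\<Sum>j<N t. 1 / real (Suc j))"
        unfolding harm_def by (simp add: sum.atLeast1_atMost_eq inverse_eq_divide)
      have "\<bar>(\<Sum>j<N t. t * theta L (real (Suc j) * t)) - A * harm (N t)\<bar> = \<bar>\<Sum>j<N t. (t * theta L (real (Suc j) * t) - A * (1 / real (Suc j)))\<bar>"
        by (simp only: h sum_distrib_left sum_subtractf)
      also have "\<dots> \<le> (\<Sum>j<N t. \<bar>t * theta L (real (Suc j) * t) - A * (1 / real (Suc j))\<bar>)" by (rule sum_abs)
      also have "\<dots> \<le> (\<Sum>j<N t. \<epsilon> * (1 / real (Suc j)))"
      proof (intro sum_mono)
        fix j assume j: "j \<in> {..<N t}"
        define c where "c = real (Suc j)"
        have c: "c > 0" by (simp add: c_def)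
        have "c \<le> real (N t)" using j by (simp add: c_def)
        hence "c \<le> \<delta> / t" using Nt by linarith
        hence "c * t \<le> \<delta>" using t by (simp add: field_simps)
        hence "\<bar>(c * t) * theta L (c * t) - A\<bar> < \<epsilon>" using c t by (intro \<delta>) auto
        moreover have "t * theta L (c * t) - A * (1 / c) = ((c * t) * theta L (c * t) - A) * (1 / c)" using c by (simp add: field_simps)
        ultimately show "\<bar>t * theta L (real (Suc j) * t) - A * (1 / real (Suc j))\<bar> \<le> \<epsilon> * (1 / real (Suc j))"
          unfolding c_def[symmetric] using c by (simp only: abs_mult) (intro mult_mono, auto)
      qed
      also have "\<dots> = \<epsilon> * harm (N t)" by (simp only: h sum_distrib_left)
      finally show ?thesis .
    qed
    have tail: "0 \<le> (\<Sum>j. theta L (real (Suc (j + N t)) * t))" "t * (\<Sum>j. theta L (real (Suc (j + N t)) * t)) \<le> K"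
    proof -
      have s': "summable (\<lambda>j. theta L (real (Suc (j + N t)) * t))" using summable_ignore_initial_segment[OF s, of "N t"] .
      show "0 \<le> (\<Sum>j. theta L (real (Suc (j + N t)) * t))"
        by (intro suminf_nonneg s' theta_nonneg) (use t in auto)
      have "(\<Sum>j. theta L (real (Suc (j + N t)) * t)) \<le> (\<Sum>j. K * (real (Suc j) ^ 0 * exp (- (real (Suc j) * t))))"
      proof (intro suminf_le s' summable_mult psi_summable t)
        fix j
        have ge: "\<delta> \<le> real (Suc (j + N t)) * t"
        proof -
          have "\<delta> / t \<le> real (Suc (j + N t))" using Nt by simp
          thus ?thesis using t by (simp add: field_simps)
        qed
        have "theta L (real (Suc (j + N t)) * t) \<le> exp (- (real (Suc (j + N t)) * t - \<delta>)) * theta L \<delta>"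
          by (rule theta_decay[OF \<delta>(1) ge])
        also have "\<dots> = K * exp (- (real (Suc (j + N t)) * t))" by (simp add: K_def exp_add[symmetric])
        also have "\<dots> \<le> K * (real (Suc j) ^ 0 * exp (- (real (Suc j) * t)))"
          using K t by (intro mult_left_mono) (auto simp: mult_right_mono)
        finally show "theta L (real (Suc (j + N t)) * t) \<le> K * (real (Suc j) ^ 0 * exp (- (real (Suc j) * t)))" .
      qed
      also have "\<dots> = K * psi 0 t" unfolding psi_def by (rule suminf_mult[OF psi_summable[OF t]])
      also have "\<dots> \<le> K * (1 / t)"
      proof (intro mult_left_mono K)
        have "1 + t \<le> exp t" by (rule exp_ge_add_one_self)
        hence "exp t - 1 \<ge> t" by linarith
        have "psi 0 t \<le> exp (- t) * (1 - exp (- t)) powr (- 1)" using psi_upper[OF t, of 0] by simp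
        also have "\<dots> = 1 / (exp t - 1)" using t by (simp add: powr_minus exp_minus divide_simps)
        also have "\<dots> \<le> 1 / t" using \<open>exp t - 1 \<ge> t\<close> t by (intro divide_left_mono) auto
        finally show "psi 0 t \<le> 1 / t" .
      qed
      finally show "t * (\<Sum>j. theta L (real (Suc (j + N t)) * t)) \<le> K" using t by (simp add: field_simps)
    qed
    have "t * lap (fps_nth (divisor_fps 0)) t = t * (\<Sum>j. theta L (real (Suc (j + N t)) * t)) + (\<Sum>j<N t. t * theta L (real (Suc j) * t))"
      unfolding l using suminf_split_initial_segment[OF s, of "N t"] by (simp add: ring_distribs sum_distrib_left)
    moreover have "0 \<le> t * (\<Sum>j. theta L (real (Suc (j + N t)) * t))" using tail t by simp
    ultimately show ?thesis using head tail(2) by linarith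
  qed
  have Nlim: "filterlim N at_top (at_right 0)"
    unfolding N_def using \<delta> by real_asymp
  have em: "((\<lambda>t. harm (N t) - ln (real (N t))) \<longlongrightarrow> euler_mascheroni) (at_right 0)"
    by (rule filterlim_compose[OF euler_mascheroni_LIMSEQ Nlim])
  have l0: "((\<lambda>t. 1 / ln (1 / t)) \<longlongrightarrow> 0) (at_right (0::real))" by real_asymp
  have l1: "((\<lambda>t. ln (real (N t)) / ln (1 / t)) \<longlongrightarrow> 1) (at_right 0)"
    unfolding N_def using \<delta> by real_asymp
  have "((\<lambda>t. (harm (N t) - ln (real (N t))) * (1 / ln (1 / t)) + ln (real (N t)) / ln (1 / t)) \<longlongrightarrow> euler_mascheroni * 0 + 1) (at_right 0)"
    by (intro tendsto_intros em l0 l1)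
  hence hl: "((\<lambda>t. harm (N t) / ln (1 / t)) \<longlongrightarrow> 1) (at_right 0)"
    by (simp add: diff_divide_distrib)
  have "((\<lambda>t. \<epsilon> * (harm (N t) / ln (1 / t)) + K * (1 / ln (1 / t)) + A * \<bar>harm (N t) / ln (1 / t) - 1\<bar>) \<longlongrightarrow> \<epsilon> * 1 + K * 0 + A * \<bar>1 - 1\<bar>) (at_right 0)"
    by (intro tendsto_intros hl l0)
  moreover have "\<epsilon> * 1 + K * 0 + A * \<bar>1 - 1\<bar> < e" using e by (simp add: \<epsilon>_def)
  ultimately have "\<forall>\<^sub>F t in at_right 0. \<epsilon> * (harm (N t) / ln (1 / t)) + K * (1 / ln (1 / t)) + A * \<bar>harm (N t) / ln (1 / t) - 1\<bar> < e"
    by (rule order_tendstoD(2))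
  moreover have "\<forall>\<^sub>F t in at_right (0::real). t \<in> {0<..<1}" by (rule eventually_at_right_real) simp
  ultimately show "\<forall>\<^sub>F t in at_right 0. dist (t * lap (fps_nth (divisor_fps 0)) t / ln (1 / t)) A < e"
  proof eventually_elim
    case (elim t)
    define l where "l = ln (1 / t)"
    have t: "t > 0" and l: "l > 0" using elim by (auto simp: l_def ln_div)
    define P where "P = t * lap (fps_nth (divisor_fps 0)) t / l"
    define Q where "Q = harm (N t) / l"
    have "P - A * Q = (t * lap (fps_nth (divisor_fps 0)) t - A * harm (N t)) / l"
      by (simp add: P_def Q_def diff_divide_distrib)
    hence "\<bar>P - A * Q\<bar> = \<bar>t * lap (fps_nth (divisor_fps 0)) t - A * harm (N t)\<bar> / l"
      using l by simp
    also have "\<dots> \<le> (\<epsilon> * harm (N t) + K) / l"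
      using bound[OF t] l by (intro divide_right_mono) auto
    also have "\<dots> = \<epsilon> * Q + K * (1 / l)" by (simp add: Q_def add_divide_distrib)
    finally have 1: "\<bar>P - A * Q\<bar> \<le> \<epsilon> * Q + K * (1 / l)" .
    have "A * Q - A = A * (Q - 1)" by (simp add: right_diff_distrib)
    hence 2: "\<bar>A * Q - A\<bar> = A * \<bar>Q - 1\<bar>" using A_pos by (simp add: abs_mult)
    have 3: "\<epsilon> * Q + K * (1 / l) + A * \<bar>Q - 1\<bar> < e" using elim(1) by (simp only: Q_def l_def)
    have "\<bar>P - A\<bar> \<le> \<bar>P - A * Q\<bar> + \<bar>A * Q - A\<bar>" by linarith
    also have "\<dots> < e" using 1 2 3 by linarith
    finally show ?case by (simp only: P_def l_def dist_real_def)
  qed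
qed

section \<open>From Laplace transforms of the moment factors to the moments\<close>

sublocale mono_recurrence partition_fps \<sigma> "\<mu> + 1" "\<mu> * A * riemann_zeta (\<mu> + 1)"
  by unfold_locales
     (use partition_fps_0 partition_fps_mono \<sigma>_lap partition_fps_rec \<mu>_pos A_pos riemann_zeta_pos[of "\<mu> + 1"] in auto)

lemma moment_factor_lap:
  shows "lap_conv (fps_nth (moment_factor k))"
    and "t > 0 \<Longrightarrow> lap (fps_nth (moment_factor (Suc k))) t =
      (\<Sum>l\<le>k. real (k choose l) * lap (fps_nth (divisor_fps (k - l))) t * lap (fps_nth (moment_factor l)) t)"
proof -
  have conv: "lap_conv (fps_nth (moment_factor k))" for k
  proof (induction k rule: less_induct)
    case (less k)
    show ?case
    proof (cases k)
      case 0
      thus ?thesis using lap_fps_one(1) by (simp only: moment_factor.simps)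
    next
      case (Suc k')
      show ?thesis unfolding Suc moment_factor.simps
        by (intro lap_fps_sum lap_fps_mult(1) lap_fps_cmult(1) divisor_fps_lap(1) less) (auto simp: Suc)
    qed
  qed
  show "lap_conv (fps_nth (moment_factor k))" by (rule conv)
  assume t: "t > 0"
  have "lap (fps_nth (moment_factor (Suc k))) t = (\<Sum>l\<le>k. lap (fps_nth (fps_const (real (k choose l)) * divisor_fps (k - l) * moment_factor l)) t)"
    unfolding moment_factor.simps by (intro lap_fps_sum(2) t lap_fps_mult(1) lap_fps_cmult(1) divisor_fps_lap(1) conv) auto
  also have "\<dots> = (\<Sum>l\<le>k. real (k choose l) * lap (fps_nth (divisor_fps (k - l))) t * lap (fps_nth (moment_factor l)) t)"
    using t by (intro sum.cong refl) (simp add: lap_fps_mult(2) lap_fps_cmult divisor_fps_lap(1) conv)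
  finally show "lap (fps_nth (moment_factor (Suc k))) t =
      (\<Sum>l\<le>k. real (k choose l) * lap (fps_nth (divisor_fps (k - l))) t * lap (fps_nth (moment_factor l)) t)" .
qed

lemma moment_asymp:
  assumes pos: "\<forall>\<^sub>F t in at_right 0. lap (fps_nth (moment_factor k)) t > 0"
    and dbl: "\<And>d. 0 < d \<Longrightarrow> d < 1 \<Longrightarrow> \<exists>K. \<forall>\<^sub>F t in at_right 0. lap (fps_nth (moment_factor k)) (d * t) \<le> K * lap (fps_nth (moment_factor k)) t"
  shows "partition_moment L k \<sim>[at_top] (\<lambda>n. partition_moment L 0 n * lap (fps_nth (moment_factor k)) (\<tau> n))"
proof -
  have "(\<lambda>n. fps_nth (moment_factor k * partition_fps) n / (fps_nth partition_fps n * lap (fps_nth (moment_factor k)) (\<tau> n))) \<longlonglongrightarrow> 1"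
    by (rule coeff_transfer[OF moment_factor_lap(1) pos dbl])
  moreover have "fps_nth (moment_factor k * partition_fps) n = partition_moment L k n" for n
    by (simp add: moment_fps[symmetric])
  ultimately have "(\<lambda>n. partition_moment L k n / (partition_moment L 0 n * lap (fps_nth (moment_factor k)) (\<tau> n))) \<longlonglongrightarrow> 1"
    by (simp add: partition_fps_def)
  thus ?thesis by (rule asymp_equivI')
qed

text \<open>\<open>H\<close> is an explicit function of the same order as the Laplace transform.
  Positivity and the doubling condition of \<open>coeff_transfer\<close> pass from \<open>H\<close>
  to the transform, the latter with its constant multiplied by 4.\<close>

lemma moment_asymp_lim:
  assumes lim: "((\<lambda>t. lap (fps_nth (moment_factor k)) t / H t) \<longlongrightarrow> c) (at_right 0)" and c: "c > 0"
    and H: "\<forall>\<^sub>F t in at_right 0. H t > 0"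
    and Hd: "\<And>d. 0 < d \<Longrightarrow> d < 1 \<Longrightarrow> \<exists>K\<ge>0. \<forall>\<^sub>F t in at_right 0. H (d * t) \<le> K * H t"
  shows "partition_moment L k \<sim>[at_top] (\<lambda>n. partition_moment L 0 n * (c * H (\<tau> n)))"
proof -
  have b: "\<forall>\<^sub>F t in at_right 0. c / 2 * H t < lap (fps_nth (moment_factor k)) t \<and> lap (fps_nth (moment_factor k)) t < 2 * c * H t"
  proof -
    have "c / 2 < c" "c < 2 * c" using c by auto
    from order_tendstoD(1)[OF lim this(1)] order_tendstoD(2)[OF lim this(2)] H
    show ?thesis by eventually_elim (simp add: field_simps)
  qed
  have pos: "\<forall>\<^sub>F t in at_right 0. lap (fps_nth (moment_factor k)) t > 0"
    using b H
  proof eventually_elim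
    case (elim t)
    have "c / 2 * H t > 0" using elim c by simp
    thus ?case using elim by linarith
  qed
  have dbl: "\<exists>K. \<forall>\<^sub>F t in at_right 0. lap (fps_nth (moment_factor k)) (d * t) \<le> K * lap (fps_nth (moment_factor k)) t"
    if d: "0 < d" "d < 1" for d
  proof -
    obtain K where K: "K \<ge> 0" "\<forall>\<^sub>F t in at_right 0. H (d * t) \<le> K * H t" using Hd[OF d] by blast
    have "filterlim (\<lambda>t. d * t) (at_right 0) (at_right 0)" using d by real_asymp
    from eventually_compose_filterlim[OF b this] b K(2)
    have "\<forall>\<^sub>F t in at_right 0. lap (fps_nth (moment_factor k)) (d * t) \<le> 4 * K * lap (fps_nth (moment_factor k)) t"
    proof eventually_elim
      case (elim t)
      have "lap (fps_nth (moment_factor k)) (d * t) \<le> 2 * c * H (d * t)" using elim by simp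
      also have "\<dots> \<le> 2 * c * (K * H t)" using elim c by (intro mult_left_mono) auto
      also have "\<dots> = 4 * K * (c / 2 * H t)" by simp
      also have "\<dots> \<le> 4 * K * lap (fps_nth (moment_factor k)) t" using elim K by (intro mult_left_mono) auto
      finally show ?case .
    qed
    thus ?thesis by blast
  qed
  have "(\<lambda>n. lap (fps_nth (moment_factor k)) (\<tau> n) / H (\<tau> n) / c) \<longlonglongrightarrow> c / c"
    by (intro tendsto_divide filterlim_compose[OF lim \<tau>_lim] tendsto_const) (use c in auto)
  hence "(\<lambda>n. lap (fps_nth (moment_factor k)) (\<tau> n)) \<sim>[at_top] (\<lambda>n. c * H (\<tau> n))"
    using c by (intro asymp_equivI') (simp add: mult.commute)
  with moment_asymp[OF pos dbl] show ?thesis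
    by (rule asymp_equiv_trans[OF _ asymp_equiv_mult[OF asymp_equiv_refl]])
qed

lemma moment_factor_recursion:
  "\<forall>\<^sub>F t in at_right 0. \<forall>k. lap (fps_nth (moment_factor (Suc k))) t =
     (\<Sum>l\<le>k. real (k choose l) * lap (fps_nth (divisor_fps (Suc (k - l) - 1))) t * lap (fps_nth (moment_factor l)) t)"
  using eventually_at_right_less[of 0] by eventually_elim (use moment_factor_lap(2) in auto)

lemma moment_factor_0: "lap (fps_nth (moment_factor 0)) t = 1"
  using lap_fps_one(2) by (simp only: moment_factor.simps)

text \<open>With \<open>X r\<close> for the transform of \<open>divisor_fps (r - 1)\<close>,
  \<open>divisor_fps_lap_le\<close> and doubling bound \<open>X r / X 1 ^ r\<close> by a constant
  over \<open>(t * X 1 t) ^ (r - 1)\<close>. As \<open>t * h t\<close> tends to infinity, so does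
  \<open>t * X 1 t\<close>, and the recursion is dominated by its first argument.\<close>

lemma moment_factor_dominant:
  assumes lim: "((\<lambda>t. lap (fps_nth (divisor_fps 0)) t / h t) \<longlongrightarrow> c) (at_right 0)" and c: "c > 0"
    and h: "\<forall>\<^sub>F t in at_right 0. h t > 0" "filterlim (\<lambda>t. t * h t) at_top (at_right 0)"
    and hd: "\<exists>K\<ge>0. \<forall>\<^sub>F t in at_right 0. h (1 / 2 * t) \<le> K * h t"
  shows "((\<lambda>t. lap (fps_nth (moment_factor k)) t / h t ^ k) \<longlongrightarrow> c ^ k) (at_right 0)"
proof -
  define X where "X r = lap (fps_nth (divisor_fps (r - 1)))" for r
  have b: "\<forall>\<^sub>F t in at_right 0. c / 2 * h t < X 1 t \<and> X 1 t < 2 * c * h t"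
  proof -
    have "c / 2 < c" "c < 2 * c" using c by auto
    from order_tendstoD(1)[OF lim this(1)] order_tendstoD(2)[OF lim this(2)] h(1)
    show ?thesis by eventually_elim (simp add: X_def field_simps)
  qed
  have X1: "\<forall>\<^sub>F t in at_right 0. X 1 t > 0"
    using b h(1)
  proof eventually_elim
    case (elim t)
    have "c / 2 * h t > 0" using elim c by simp
    thus ?case using elim by linarith
  qed
  have tX: "filterlim (\<lambda>t. t * X 1 t) at_top (at_right 0)"
  proof (rule filterlim_at_top_mono)
    show "filterlim (\<lambda>t. c / 2 * (t * h t)) at_top (at_right 0)"
      by (rule filterlim_tendsto_pos_mult_at_top[OF tendsto_const _ h(2)]) (use c in simp)
    show "\<forall>\<^sub>F t in at_right 0. c / 2 * (t * h t) \<le> t * X 1 t"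
      using b eventually_at_right_less[of 0]
    proof eventually_elim
      case (elim t)
      have "t * (c / 2 * h t) \<le> t * X 1 t" using elim by (intro mult_left_mono) auto
      thus ?case by (simp add: mult_ac)
    qed
  qed
  obtain K where K: "K \<ge> 0" "\<forall>\<^sub>F t in at_right 0. h (1 / 2 * t) \<le> K * h t" using hd by blast
  have "filterlim (\<lambda>t. 1 / 2 * t) (at_right 0) (at_right (0::real))" by real_asymp
  from eventually_compose_filterlim[OF b this] b K(2)
  have Xd: "\<forall>\<^sub>F t in at_right 0. X 1 (t / 2) \<le> 4 * K * X 1 t"
  proof eventually_elim
    case (elim t)
    have "X 1 (t / 2) \<le> 2 * c * h (1 / 2 * t)" using elim by simp
    also have "\<dots> \<le> 2 * c * (K * h t)" using elim c by (intro mult_left_mono) auto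
    also have "\<dots> = 4 * K * (c / 2 * h t)" by simp
    also have "\<dots> \<le> 4 * K * X 1 t" using elim K by (intro mult_left_mono) auto
    finally show ?case .
  qed
  have "((\<lambda>t. lap (fps_nth (moment_factor k)) t / X 1 t ^ k) \<longlongrightarrow> 1) (at_right 0)"
  proof (rule bell_recursion_dominant[where G = "\<lambda>k. lap (fps_nth (moment_factor k))" and X = X])
    show "lap (fps_nth (moment_factor 0)) t = 1" for t by (rule moment_factor_0)
    show "\<forall>\<^sub>F t in at_right 0. \<forall>k. lap (fps_nth (moment_factor (Suc k))) t =
       (\<Sum>l\<le>k. real (k choose l) * X (Suc (k - l)) t * lap (fps_nth (moment_factor l)) t)"
      using moment_factor_recursion by (simp add: X_def)
    show "\<forall>\<^sub>F t in at_right 0. X 1 t \<noteq> 0" using X1 by eventually_elim simp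
    fix r :: nat assume r: "r \<ge> 2"
    define r' where "r' = r - 1"
    have r': "r = Suc r'" "r' > 0" using r by (auto simp: r'_def)
    obtain K' where K': "K' > 0" "\<And>t. t > 0 \<Longrightarrow> t ^ r' * lap (fps_nth (divisor_fps r')) t \<le> K' * lap (fps_nth (divisor_fps 0)) (t / 2)"
      using divisor_fps_lap_le[of r'] by blast
    have inf: "filterlim (\<lambda>t. (t * X 1 t) ^ r') at_top (at_right 0)"
      by (rule filterlim_pow_at_top[OF r'(2) tX])
    show "((\<lambda>t. X r t / X 1 t ^ r) \<longlongrightarrow> 0) (at_right 0)"
    proof (rule Lim_null_comparison)
      show "((\<lambda>t. K' * (4 * K) / (t * X 1 t) ^ r') \<longlongrightarrow> 0) (at_right 0)"
        by (rule tendsto_divide_0[OF tendsto_const filterlim_at_top_imp_at_infinity[OF inf]])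
      show "\<forall>\<^sub>F t in at_right 0. norm (X r t / X 1 t ^ r) \<le> K' * (4 * K) / (t * X 1 t) ^ r'"
        using X1 Xd eventually_at_right_less[of 0]
      proof eventually_elim
        case (elim t)
        have "t ^ r' * X r t \<le> K' * X 1 (t / 2)" using K'(2)[OF elim(3)] by (simp add: X_def r')
        also have "\<dots> \<le> K' * (4 * K * X 1 t)" using elim K' by (intro mult_left_mono) auto
        finally have "X r t \<le> K' * (4 * K * X 1 t) / t ^ r'" using elim(3) by (simp add: field_simps)
        hence "X r t / X 1 t ^ r \<le> K' * (4 * K * X 1 t) / t ^ r' / X 1 t ^ r"
          using elim by (intro divide_right_mono) auto
        also have "\<dots> = K' * (4 * K) / (t * X 1 t) ^ r'"
          using elim by (simp add: r'(1) power_mult_distrib field_simps)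
        finally have "X r t / X 1 t ^ r \<le> K' * (4 * K) / (t * X 1 t) ^ r'" .
        moreover have "X r t / X 1 t ^ r \<ge> 0"
          unfolding X_def using elim X_def by (intro divide_nonneg_nonneg lap_nonneg divisor_fps_lap(1) zero_le_power) auto
        ultimately show ?case by simp
      qed
    qed
  qed
  hence "((\<lambda>t. lap (fps_nth (moment_factor k)) t / X 1 t ^ k * (X 1 t / h t) ^ k) \<longlongrightarrow> 1 * c ^ k) (at_right 0)"
    by (intro tendsto_mult tendsto_power) (use lim in \<open>simp_all add: X_def\<close>)
  hence "((\<lambda>t. lap (fps_nth (moment_factor k)) t / X 1 t ^ k * (X 1 t / h t) ^ k) \<longlongrightarrow> c ^ k) (at_right 0)" by simp
  moreover have "\<forall>\<^sub>F t in at_right 0. lap (fps_nth (moment_factor k)) t / X 1 t ^ k * (X 1 t / h t) ^ k = lap (fps_nth (moment_factor k)) t / h t ^ k"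
    using X1 by eventually_elim (simp add: power_divide)
  ultimately show ?thesis by (rule Lim_transform_eventually)
qed

lemma moment_asymp_gt_1:
  assumes "\<mu> > 1"
  shows "partition_moment L k \<sim>[at_top]
     (\<lambda>n. partition_moment L 0 n * ((A * riemann_zeta \<mu>) ^ k * (\<tau> n powr (- \<mu>)) ^ k))"
proof (rule moment_asymp_lim)
  have z: "A * riemann_zeta \<mu> > 0" using A_pos riemann_zeta_pos[OF assms] by simp
  show "(A * riemann_zeta \<mu>) ^ k > 0" using z by simp
  have "\<forall>\<^sub>F t in at_right 0. t powr \<mu> * lap (fps_nth (divisor_fps 0)) t = lap (fps_nth (divisor_fps 0)) t / t powr (- \<mu>)"
    using eventually_at_right_less[of 0] by eventually_elim (simp add: powr_minus field_simps)
  note lim = Lim_transform_eventually[OF divisor_fps_0_lim_gt_1[OF assms] this]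
  show "((\<lambda>t. lap (fps_nth (moment_factor k)) t / (t powr (- \<mu>)) ^ k) \<longlongrightarrow> (A * riemann_zeta \<mu>) ^ k) (at_right 0)"
  proof (rule moment_factor_dominant[OF lim z])
    show "\<forall>\<^sub>F t in at_right 0. t powr (- \<mu>) > 0" using eventually_at_right_less[of 0] by eventually_elim simp
    show "filterlim (\<lambda>t. t * t powr (- \<mu>)) at_top (at_right 0)" using assms by real_asymp
    have "(1 / 2 * t) powr (- \<mu>) \<le> 2 powr \<mu> * t powr (- \<mu>)" for t
      unfolding powr_mult by (simp add: powr_divide powr_minus field_simps)
    thus "\<exists>K\<ge>0. \<forall>\<^sub>F t in at_right 0. (1 / 2 * t) powr (- \<mu>) \<le> K * t powr (- \<mu>)"
      by (intro exI[of _ "2 powr \<mu>"]) auto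
  qed
  show "\<forall>\<^sub>F t in at_right 0. (t powr (- \<mu>)) ^ k > 0" using eventually_at_right_less[of 0] by eventually_elim simp
  fix d :: real assume "0 < d" "d < 1"
  have "((d * t) powr (- \<mu>)) ^ k \<le> (d powr (- \<mu>)) ^ k * (t powr (- \<mu>)) ^ k" for t
    unfolding powr_mult power_mult_distrib by simp
  thus "\<exists>K\<ge>0. \<forall>\<^sub>F t in at_right 0. ((d * t) powr (- \<mu>)) ^ k \<le> K * (t powr (- \<mu>)) ^ k"
    by (intro exI[of _ "(d powr (- \<mu>)) ^ k"]) auto
qed

lemma moment_asymp_eq_1:
  assumes "\<mu> = 1"
  shows "partition_moment L k \<sim>[at_top]
     (\<lambda>n. partition_moment L 0 n * (A ^ k * (ln (1 / \<tau> n) / \<tau> n) ^ k))"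
proof (rule moment_asymp_lim)
  show "A ^ k > 0" using A_pos by simp
  define h where "h t = ln (1 / t) / t" for t :: real
  have h0: "\<forall>\<^sub>F t in at_right 0. h t > 0"
    using eventually_at_right_real[OF zero_less_one] by eventually_elim (simp add: h_def ln_div divide_neg_pos)
  have "\<forall>\<^sub>F t in at_right 0. t * lap (fps_nth (divisor_fps 0)) t / ln (1 / t) = lap (fps_nth (divisor_fps 0)) t / h t"
    using eventually_at_right_less[of 0] by eventually_elim (simp add: h_def)
  note lim = Lim_transform_eventually[OF divisor_fps_0_lim_eq_1[OF assms] this]
  have hd: "\<exists>K\<ge>0. \<forall>\<^sub>F t in at_right 0. h (d * t) \<le> K * h t" if d: "0 < d" "d < 1" for d
  proof -
    have "((\<lambda>t. h (d * t) / h t) \<longlongrightarrow> 1 / d) (at_right 0)" unfolding h_def using d by (real_asymp simp: inverse_eq_divide)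
    hence "\<forall>\<^sub>F t in at_right 0. h (d * t) / h t < 2 / d"
      by (rule order_tendstoD(2)) (use d in \<open>simp add: divide_strict_right_mono\<close>)
    with h0 have "\<forall>\<^sub>F t in at_right 0. h (d * t) \<le> 2 / d * h t"
      by eventually_elim (simp add: divide_less_eq)
    thus ?thesis using d by (intro exI[of _ "2 / d"]) auto
  qed
  show "((\<lambda>t. lap (fps_nth (moment_factor k)) t / (ln (1 / t) / t) ^ k) \<longlongrightarrow> A ^ k) (at_right 0)"
    unfolding h_def[symmetric]
  proof (rule moment_factor_dominant[OF lim A_pos h0])
    show "filterlim (\<lambda>t. t * h t) at_top (at_right 0)" unfolding h_def by real_asymp
    show "\<exists>K\<ge>0. \<forall>\<^sub>F t in at_right 0. h (1 / 2 * t) \<le> K * h t" by (rule hd) auto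
  qed
  show "\<forall>\<^sub>F t in at_right 0. (ln (1 / t) / t) ^ k > (0 :: real)" using h0[unfolded h_def] by eventually_elim simp
  fix d :: real assume d: "0 < d" "d < 1"
  obtain K where K: "K \<ge> 0" "\<forall>\<^sub>F t in at_right 0. h (d * t) \<le> K * h t" using hd[OF d] by blast
  have "filterlim (\<lambda>t. d * t) (at_right 0) (at_right 0)" using d by real_asymp
  from eventually_compose_filterlim[OF h0 this] K(2)
  have "\<forall>\<^sub>F t in at_right 0. h (d * t) ^ k \<le> K ^ k * h t ^ k"
    by eventually_elim (simp add: power_mult_distrib[symmetric] power_mono)
  thus "\<exists>K\<ge>0. \<forall>\<^sub>F t in at_right 0. (ln (1 / (d * t)) / (d * t)) ^ k \<le> K * (ln (1 / t) / t) ^ k"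
    using K(1) by (intro exI[of _ "K ^ k"]) (simp add: h_def)
qed

text \<open>For \<open>\<mu> < 1\<close> already \<open>divisor_fps 0\<close> is of exact order
  \<open>1 / t\<close>. With \<open>s t = t\<close> all arguments then contribute at the same order,
  and the whole polynomial \<open>Y_k\<close> survives.\<close>

lemma moment_asymp_lt_1:
  assumes "\<mu> < 1"
  defines "x \<equiv> \<lambda>j. fact (j - 1) * (\<Sum>i. real (L i) powr (- real j))"
  shows "partition_moment L k \<sim>[at_top] (\<lambda>n. partition_moment L 0 n * (bell_Y k x * (1 / \<tau> n ^ k)))"
proof (rule moment_asymp_lim)
  show "bell_Y k x > 0"
  proof (rule bell_Y_pos)
    fix j :: nat assume "j \<ge> 1"
    hence "summable (\<lambda>i. real (L i) powr (- real j))" using assms by (intro zeta_summable) linarith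
    moreover have "real (L i) powr (- real j) > 0" for i using L_pos[of i] by simp
    ultimately have "(\<Sum>i. real (L i) powr (- real j)) > 0" by (intro suminf_pos) auto
    thus "x j > 0" by (simp add: x_def)
  qed
  have "((\<lambda>t. t ^ k * lap (fps_nth (moment_factor k)) t) \<longlongrightarrow> bell_Y k x) (at_right 0)"
  proof (rule bell_recursion_limit[where G = "\<lambda>k. lap (fps_nth (moment_factor k))" and X = "\<lambda>r. lap (fps_nth (divisor_fps (r - 1)))" and s = "\<lambda>t. t"])
    show "lap (fps_nth (moment_factor 0)) t = 1" for t by (rule moment_factor_0)
    show "\<forall>\<^sub>F t in at_right 0. \<forall>k. lap (fps_nth (moment_factor (Suc k))) t =
       (\<Sum>l\<le>k. real (k choose l) * lap (fps_nth (divisor_fps (Suc (k - l) - 1))) t * lap (fps_nth (moment_factor l)) t)"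
      by (rule moment_factor_recursion)
    fix r :: nat assume "r \<ge> 1"
    then obtain r' where r': "r = Suc r'" by (cases r) auto
    show "((\<lambda>t. t ^ r * lap (fps_nth (divisor_fps (r - 1))) t) \<longlongrightarrow> x r) (at_right 0)"
      unfolding r' x_def diff_Suc_1 by (rule divisor_fps_lim) (use assms in simp)
  qed
  thus "((\<lambda>t. lap (fps_nth (moment_factor k)) t / (1 / t ^ k)) \<longlongrightarrow> bell_Y k x) (at_right 0)" by (simp add: mult.commute)
  show "\<forall>\<^sub>F t in at_right 0. 1 / t ^ k > (0 :: real)" using eventually_at_right_less[of 0] by eventually_elim simp
  fix d :: real assume d: "0 < d" "d < 1"
  have "1 / (d * t) ^ k \<le> 1 / d ^ k * (1 / t ^ k)" for t by (simp add: power_mult_distrib)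
  thus "\<exists>K\<ge>0. \<forall>\<^sub>F t in at_right 0. 1 / (d * t) ^ k \<le> K * (1 / t ^ k)"
    using d by (intro exI[of _ "1 / d ^ k"]) auto
qed

lemma \<tau>_powr_minus:
  assumes "n > 0"
  shows "\<tau> n powr (- s) = (real n / (\<mu> * A * riemann_zeta (\<mu> + 1))) powr (s / (\<mu> + 1))"
proof -
  define E where "E = \<mu> * A * riemann_zeta (\<mu> + 1)"
  have E: "E > 0" using D by (simp add: E_def)
  have "\<tau> n powr (- s) = (E / real n) powr (- (s / (\<mu> + 1)))"
    by (simp add: \<tau>_def E_def powr_powr)
  also have "\<dots> = (real n / E) powr (s / (\<mu> + 1))"
    using E assms by (simp add: powr_minus powr_divide)
  finally show ?thesis by (simp add: E_def)
qed

end

section \<open>From admissible sequences to the three cases\<close>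

lemma theta_seqI:
  assumes adm: "admissible L" and ex: "theta_expansion L \<kappa> A" and \<mu>: "\<mu> = - \<kappa> 0"
  shows "theta_seq L (A (- \<mu>)) \<mu>"
proof
  note adm' = adm[unfolded admissible_def]
  note ex' = ex[unfolded theta_expansion_def]
  show "L i > 0" for i using adm' by blast
  show "finite {i. L i \<le> n}" for n
  proof -
    have "{i. L i \<le> n} = (\<Union>m\<in>{..n}. {i. L i = m})" by auto
    thus ?thesis using adm' by simp
  qed
  show "\<exists>i. L i = 1" using adm' by (metis rangeE)
  show "mono L" using adm' by blast
  show s: "summable (\<lambda>i. exp (- (real (L i) * t)))" if "t > 0" for t using adm' that by simp
  show "\<mu> > 0" using ex' \<mu> by simp
  have "(\<lambda>t. theta L t - A (- \<mu>) * t powr (- \<mu>)) \<in> o[at_right 0](\<lambda>t. t powr (- \<mu>))"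
    using ex' \<mu> by (auto dest!: spec[of _ 0])
  from tendsto_add[OF smalloD_tendsto[OF this] tendsto_const, of "A (- \<mu>)"]
  have "((\<lambda>t. (theta L t - A (- \<mu>) * t powr (- \<mu>)) / t powr (- \<mu>) + A (- \<mu>)) \<longlongrightarrow> A (- \<mu>)) (at_right 0)" by simp
  moreover have "\<forall>\<^sub>F t in at_right 0. (theta L t - A (- \<mu>) * t powr (- \<mu>)) / t powr (- \<mu>) + A (- \<mu>) = t powr \<mu> * theta L t"
    using eventually_at_right_less[of 0] by eventually_elim (simp add: powr_minus field_simps)
  ultimately show lim: "((\<lambda>t. t powr \<mu> * theta L t) \<longlongrightarrow> A (- \<mu>)) (at_right 0)"
    by (rule Lim_transform_eventually)
  \<comment> \<open>The leading coefficient is positive: it is a limit of nonnegative values, and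
    nonzero by the expansion.\<close>
  have "theta L t \<ge> 0" if "t > 0" for t
    unfolding theta_def using s[OF that] by (intro suminf_nonneg) auto
  hence "A (- \<mu>) \<ge> 0"
    by (intro tendsto_lowerbound[OF lim]) (auto intro!: eventually_at_rightI[of 0 1])
  moreover have "A (- \<mu>) \<noteq> 0" using ex' \<mu> by simp
  ultimately show "A (- \<mu>) > 0" by simp
qed

text \<open>To the right of the abscissa \<open>zeta_seq\<close> is the Dirichlet series itself, and
  its terms at an integer are real.\<close>

lemma zeta_seq_of_nat:
  assumes pos: "\<And>i. L i > 0" and j: "real j > \<mu>" and s: "summable (\<lambda>i. real (L i) powr (- real j))"
  shows "Re (zeta_seq L \<mu> (of_nat j)) = (\<Sum>i. real (L i) powr (- real j))"
proof -
  have "of_nat (L i) powr (- of_nat j :: complex) = of_real (real (L i) powr (- real j))" for i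
    using powr_of_real[of "real (L i)" "- real j"] by simp
  hence "zeta_series L (of_nat j) = of_real (\<Sum>i. real (L i) powr (- real j))"
    unfolding zeta_series_def using suminf_of_real[OF s, where 'a = complex] by simp
  thus ?thesis using j by (simp add: zeta_seq_def)
qed

lemma bell_Y_cong:
  assumes "\<And>j. j \<ge> 1 \<Longrightarrow> x j = y j"
  shows "bell_Y k x = bell_Y k y"
  unfolding bell_Y_def using assms by (intro sum.cong refl arg_cong2[of _ _ _ _ "(*)"] prod.cong) auto

lemma riemann_zeta_2: "riemann_zeta 2 = pi\<^sup>2 / 6"
proof -
  have "(\<lambda>n. 1 / real (Suc n) powr 2) sums (pi\<^sup>2 / 6)"
    using inverse_squares_sums by (simp add: powr_numeral)
  thus ?thesis by (simp add: riemann_zeta_def sums_iff)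
qed

theorem corollary7:
  fixes L :: "nat \<Rightarrow> nat" and \<kappa> :: "nat \<Rightarrow> real" and A :: "real \<Rightarrow> real"
    and \<mu> :: real and k :: nat
  assumes "admissible L"
    and "theta_expansion L \<kappa> A"
    and "\<And>i. i > 0 \<Longrightarrow> \<kappa> i \<ge> 0"
    and "\<mu> = - \<kappa> 0"
    and "k \<ge> 1"
  shows
    "(\<mu> > 1 \<longrightarrow>
       partition_moment L k \<sim>[at_top]
         (\<lambda>n. partition_moment L 0 n
            * (real n / (\<mu> * riemann_zeta (\<mu> + 1))) powr (\<mu> * real k / (\<mu> + 1))
            * A (- \<mu>) powr (real k / (\<mu> + 1)) * riemann_zeta \<mu> ^ k))
     \<and> (\<mu> = 1 \<longrightarrow>
       partition_moment L k \<sim>[at_top]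
         (\<lambda>n. partition_moment L 0 n * real n powr (real k / 2)
            * (pi\<^sup>2 * A (- 1) / 6) powr (- (real k / 2))
            * bell_Y k (\<lambda>j. if j = 1
                then Re (finite_part (zeta_seq L \<mu>) 1) - A (- 1) / 2 * ln (pi\<^sup>2 * A (- 1) / (6 * real n))
                else fact (j - 1) * Re (zeta_seq L \<mu> (of_nat j)))))
     \<and> (\<mu> < 1 \<longrightarrow>
       partition_moment L k \<sim>[at_top]
         (\<lambda>n. partition_moment L 0 n * real n powr (real k / (\<mu> + 1))
            * (riemann_zeta (\<mu> + 1) * \<mu> * A (- \<mu>)) powr (- (real k / (\<mu> + 1)))
            * bell_Y k (\<lambda>j. fact (j - 1) * Re (zeta_seq L \<mu> (of_nat j)))))"
proof -
  interpret theta_seq L "A (- \<mu>)" \<mu> by (rule theta_seqI[OF assms(1,2,4)])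
  define T where "T = \<tau>"
  note T_pos = \<tau>_pos[folded T_def]
  define a where "a = A (- \<mu>)"
  define z where "z = riemann_zeta (\<mu> + 1)"
  have a: "a > 0" using A_pos by (simp add: a_def)
  have z: "z > 0" unfolding z_def using \<mu>_pos by (intro riemann_zeta_pos) simp
  note tp = \<tau>_powr_minus[folded T_def, folded a_def z_def]
  have ev: "\<forall>\<^sub>F n in at_top. n > (0 :: nat)" by (rule eventually_gt_at_top)
  show ?thesis
  proof (intro conjI impI)
    assume \<mu>1: "\<mu> > 1"
    show "partition_moment L k \<sim>[at_top]
         (\<lambda>n. partition_moment L 0 n
            * (real n / (\<mu> * riemann_zeta (\<mu> + 1))) powr (\<mu> * real k / (\<mu> + 1))
            * A (- \<mu>) powr (real k / (\<mu> + 1)) * riemann_zeta \<mu> ^ k)"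
    proof (rule asymp_equiv_trans[OF moment_asymp_gt_1[OF \<mu>1, folded T_def] asymp_equiv_refl_ev])
      show "\<forall>\<^sub>F n in at_top. partition_moment L 0 n * ((A (- \<mu>) * riemann_zeta \<mu>) ^ k * (T n powr (- \<mu>)) ^ k) =
         partition_moment L 0 n * (real n / (\<mu> * riemann_zeta (\<mu> + 1))) powr (\<mu> * real k / (\<mu> + 1))
            * A (- \<mu>) powr (real k / (\<mu> + 1)) * riemann_zeta \<mu> ^ k"
        using ev
      proof eventually_elim
        case (elim n)
        define e where "e = \<mu> * real k / (\<mu> + 1)"
        have "(T n powr (- \<mu>)) ^ k = T n powr (- (\<mu> * real k))"
          using T_pos[OF elim] by (simp add: powr_powr flip: powr_realpow)
        also have "\<dots> = (real n / (\<mu> * a * z)) powr e" unfolding tp[OF elim] e_def ..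
        also have "real n / (\<mu> * a * z) = real n / (\<mu> * z) / a" by (simp add: mult_ac)
        also have "\<dots> powr e = (real n / (\<mu> * z)) powr e / a powr e"
          by (rule powr_divide)
        finally have 1: "(T n powr (- \<mu>)) ^ k = (real n / (\<mu> * z)) powr e / a powr e" .
        \<comment> \<open>Origin of the exponent of \<open>A\<close>: it is \<open>k\<close> from
          the limit of the moment factor, reduced by \<open>\<mu> k / (\<mu> + 1)\<close> from the
          power of the saddle point.\<close>
        have "real k = real k / (\<mu> + 1) + e" 
        proof -
          have "real k / (\<mu> + 1) + e = real k * (\<mu> + 1) / (\<mu> + 1)"
            unfolding e_def add_divide_distrib[symmetric] by (simp add: algebra_simps)
          thus ?thesis using \<mu>_pos by simp
        qed
        hence "a ^ k = a powr (real k / (\<mu> + 1)) * a powr e"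
          using a by (metis powr_add powr_realpow)
        hence 2: "a ^ k / a powr e = a powr (real k / (\<mu> + 1))" using a by simp
        show ?case unfolding 1 a_def[symmetric] z_def[symmetric] e_def[symmetric] 2[symmetric]
          by (simp add: power_mult_distrib)
      qed
    qed
  next
    assume \<mu>1: "\<mu> = 1"
    define D where "D = pi\<^sup>2 * a / 6"
    have D0: "D > 0" using a by (simp add: D_def)
    \<comment> \<open>\<open>\<zeta>(2) = \<pi>^2 / 6\<close> turns the saddle point constant into
      the one displayed in the statement.\<close>
    have Dz: "\<mu> * a * z = D" by (simp add: \<mu>1 D_def z_def riemann_zeta_2)
    define c where "c j = (if j = 1 then Re (finite_part (zeta_seq L \<mu>) 1) else fact (j - 1) * Re (zeta_seq L \<mu> (of_nat j)))" for j
    define x where "x n j = (if j = 1 then c 1 - a / 2 * ln (D / real n) else c j)" for n j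
    \<comment> \<open>As \<open>a > 0\<close>, the term \<open>- (a / 2) ln (D / n)\<close> tends to
      infinity, while the arguments from the second on do not depend on \<open>n\<close>; hence
      \<open>bell_Y k (x n)\<close> is asymptotic to the \<open>k\<close>-th power of its first
      argument.\<close>
    have x1inf: "filterlim (\<lambda>n. x n 1) at_top sequentially"
      unfolding x_def using a D0 by simp real_asymp
    have dom: "(\<lambda>n. bell_Y k (x n) / x n 1 ^ k) \<longlonglongrightarrow> 1"
    proof (rule bell_recursion_dominant[where X = "\<lambda>r n. x n r"])
      show "\<forall>\<^sub>F n in sequentially. \<forall>k. bell_Y (Suc k) (x n) = (\<Sum>l\<le>k. real (k choose l) * x n (Suc (k - l)) * bell_Y l (x n))"
        by (simp add: bell_Y_Suc)
      show "\<forall>\<^sub>F n in sequentially. x n 1 \<noteq> 0"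
        using filterlim_at_top_dense[THEN iffD1, OF x1inf, rule_format, of 0] by eventually_elim simp
      fix r :: nat assume r: "r \<ge> 2"
      have "filterlim (\<lambda>n. x n 1 ^ r) at_top sequentially" using r by (intro filterlim_pow_at_top x1inf) simp
      hence "(\<lambda>n. c r / x n 1 ^ r) \<longlonglongrightarrow> 0"
        by (intro tendsto_divide_0[OF tendsto_const] filterlim_at_top_imp_at_infinity)
      thus "(\<lambda>n. x n r / x n 1 ^ r) \<longlonglongrightarrow> 0" using r by (simp add: x_def)
    qed (simp add: bell_Y_0)
    hence bx: "(\<lambda>n. bell_Y k (x n)) \<sim>[at_top] (\<lambda>n. x n 1 ^ k)" by (rule asymp_equivI')
    \<comment> \<open>The numerator is \<open>a * ln (1 / \<tau> n)\<close>, the quantity delivered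
      by \<open>moment_asymp_eq_1\<close>; it differs from the first argument of
      \<open>bell_Y\<close> by the constant \<open>c 1\<close>.\<close>
    have "(\<lambda>n. a * (- ln (D / real n) / 2) / (c 1 - a / 2 * ln (D / real n))) \<longlonglongrightarrow> 1"
      using a D0 by real_asymp
    hence "(\<lambda>n. a * (- ln (D / real n) / 2)) \<sim>[at_top] (\<lambda>n. x n 1)" by (intro asymp_equivI') (simp add: x_def)
    hence "(\<lambda>n. (a * (- ln (D / real n) / 2)) ^ k) \<sim>[at_top] (\<lambda>n. x n 1 ^ k)" by (rule asymp_equiv_power)
    hence lx: "(\<lambda>n. (a * (- ln (D / real n) / 2)) ^ k) \<sim>[at_top] (\<lambda>n. bell_Y k (x n))"
      by (rule asymp_equiv_trans[OF _ asymp_equiv_symI[OF bx]])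
    have lx': "(\<lambda>n. partition_moment L 0 n * real n powr (real k / 2) * D powr (- (real k / 2)) * (a * (- ln (D / real n) / 2)) ^ k)
       \<sim>[at_top] (\<lambda>n. partition_moment L 0 n * real n powr (real k / 2) * D powr (- (real k / 2)) * bell_Y k (x n))"
      by (intro asymp_equiv_mult asymp_equiv_refl lx)
    have eq: "\<forall>\<^sub>F n in at_top. partition_moment L 0 n * (A (- \<mu>) ^ k * (ln (1 / T n) / T n) ^ k) =
       partition_moment L 0 n * real n powr (real k / 2) * D powr (- (real k / 2)) * (a * (- ln (D / real n) / 2)) ^ k"
      using ev
    proof eventually_elim
      case (elim n)
      have t: "T n > 0" by (rule T_pos[OF elim])
      have "T n = (real n / D) powr (- (1 / 2))"
        using tp[OF elim, of "- 1", unfolded Dz] t by (simp add: \<mu>1)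
      hence "ln (T n) = ln (D / real n) / 2"
        using D0 elim by (simp add: ln_powr ln_div field_simps)
      hence 1: "ln (1 / T n) = - ln (D / real n) / 2" using t by (simp add: ln_div)
      have "1 / T n ^ k = T n powr (- real k)" using t by (simp add: powr_minus powr_realpow divide_inverse)
      also have "\<dots> = (real n / D) powr (real k / 2)" unfolding tp[OF elim] Dz by (simp add: \<mu>1)
      also have "\<dots> = real n powr (real k / 2) * D powr (- (real k / 2))"
        unfolding powr_divide powr_minus by (rule divide_inverse)
      finally have 2: "1 / T n ^ k = real n powr (real k / 2) * D powr (- (real k / 2))" .
      have "(ln (1 / T n) / T n) ^ k = (- ln (D / real n) / 2) ^ k * (1 / T n ^ k)"
        unfolding 1 by (simp only: power_divide mult_1_right times_divide_eq_right)
      thus ?case unfolding a_def[symmetric] 2 power_mult_distrib by (simp only: mult_ac)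
    qed
    have main: "partition_moment L k \<sim>[at_top] (\<lambda>n. partition_moment L 0 n * real n powr (real k / 2) * D powr (- (real k / 2)) * bell_Y k (x n))"
      by (rule asymp_equiv_trans[OF moment_asymp_eq_1[OF \<mu>1, folded T_def] asymp_equiv_trans[OF asymp_equiv_refl_ev[OF eq] lx']])
    have "x n = (\<lambda>j. if j = 1
                then Re (finite_part (zeta_seq L \<mu>) 1) - A (- 1) / 2 * ln (pi\<^sup>2 * A (- 1) / (6 * real n))
                else fact (j - 1) * Re (zeta_seq L \<mu> (of_nat j)))" for n
      by (rule ext) (simp add: x_def c_def D_def a_def \<mu>1)
    from main[unfolded this] show "partition_moment L k \<sim>[at_top]
         (\<lambda>n. partition_moment L 0 n * real n powr (real k / 2)
            * (pi\<^sup>2 * A (- 1) / 6) powr (- (real k / 2))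
            * bell_Y k (\<lambda>j. if j = 1
                then Re (finite_part (zeta_seq L \<mu>) 1) - A (- 1) / 2 * ln (pi\<^sup>2 * A (- 1) / (6 * real n))
                else fact (j - 1) * Re (zeta_seq L \<mu> (of_nat j))))"
      by (simp only: D_def a_def \<mu>1)
  next
    assume \<mu>1: "\<mu> < 1"
    have bY: "bell_Y k (\<lambda>j. fact (j - 1) * Re (zeta_seq L \<mu> (of_nat j))) =
        bell_Y k (\<lambda>j. fact (j - 1) * (\<Sum>i. real (L i) powr (- real j)))"
    proof (rule bell_Y_cong)
      fix j :: nat assume "j \<ge> 1"
      hence j: "real j > \<mu>" using \<mu>1 by linarith
      show "fact (j - 1) * Re (zeta_seq L \<mu> (of_nat j)) = fact (j - 1) * (\<Sum>i. real (L i) powr (- real j))"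
        by (simp only: zeta_seq_of_nat[OF L_pos j zeta_summable[OF j]])
    qed
    show "partition_moment L k \<sim>[at_top]
         (\<lambda>n. partition_moment L 0 n * real n powr (real k / (\<mu> + 1))
            * (riemann_zeta (\<mu> + 1) * \<mu> * A (- \<mu>)) powr (- (real k / (\<mu> + 1)))
            * bell_Y k (\<lambda>j. fact (j - 1) * Re (zeta_seq L \<mu> (of_nat j))))"
      unfolding bY
    proof (rule asymp_equiv_trans[OF moment_asymp_lt_1[OF \<mu>1, folded T_def] asymp_equiv_refl_ev])
      show "\<forall>\<^sub>F n in at_top. partition_moment L 0 n * (bell_Y k (\<lambda>j. fact (j - 1) * (\<Sum>i. real (L i) powr (- real j))) * (1 / T n ^ k)) =
         partition_moment L 0 n * real n powr (real k / (\<mu> + 1))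
            * (riemann_zeta (\<mu> + 1) * \<mu> * A (- \<mu>)) powr (- (real k / (\<mu> + 1)))
            * bell_Y k (\<lambda>j. fact (j - 1) * (\<Sum>i. real (L i) powr (- real j)))"
        using ev
      proof eventually_elim
        case (elim n)
        have "1 / T n ^ k = T n powr (- real k)"
          using T_pos[OF elim] by (simp add: powr_minus powr_realpow divide_inverse)
        also have "\<dots> = real n powr (real k / (\<mu> + 1)) * (z * \<mu> * a) powr (- (real k / (\<mu> + 1)))"
          unfolding tp[OF elim] unfolding powr_divide powr_minus by (simp only: divide_inverse mult_ac)
        finally show ?case unfolding a_def z_def by (simp only: mult_ac)
      qed
    qed
  qed
qed

end
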